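(* Let $(\mathcal C,\mathbb E,\mathfrak s)$ be an extriangulated category satisfying (WIC), with a proper class $\xi$ of $\mathbb E$-triangles having enough $\xi$-projectives and enough $\xi$-injectives. Let $\mathcal X$ be a quasi-resolving subcategory of $\mathcal C$ and $\mathcal H$ a $\xi\mathrm{xt}$-injective $\xi$-cogenerator of $\mathcal X$ such that either $\mathcal H$ is closed under $\xi$-extensions and $\xi$-cocones, or $\mathcal H$ is closed under direct summands. Then for any object $M$ of $\mathcal C$ with $\mathrm{res.dim}_{\mathcal X}(M)<\infty$ and any $n\ge0$, the following are equivalent: (1) $\mathrm{res.dim}_{\mathcal X}(M)\le n$. (2) $\Omega^{n+i}_{\mathcal P_{\mathcal X}(\xi)}(M)\in\mathcal X$ for all $i\ge0$. (3) $\Omega^{n+i}_{\mathcal X}(M)\in\mathcal X$ for all $i\ge0$. (4) $\xi\mathrm{xt}_\xi^{n+i}(M,H)=0$ for all $i\ge1$ and all $H\in\mathcal H$. (5) $\xi\mathrm{xt}_\xi^{n+i}(M,N)=0$ for all $i\ge1$ and all $N\in\widehat{\mathcal H}$. (6) There is an $\mathbb E$-triangle $M\to W\to X\dashrightarrow$ in $\xi$ with $X\in\mathcal X$ and $\mathrm{res.dim}_{\mathcal H}(W)\le n$. (7) There is an $\mathbb E$-triangle $K\to X'\to M\dashrightarrow$ in $\xi$ with $X'\in\mathcal X$ and $\mathrm{res.dim}_{\mathcal H}(K)\le n-1$. (8) There are two $\mathbb E$-triangles $W_M\to X_M\to M\dashrightarrow$ and $M\to W^M\to X^M\dashrightarrow$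 in $\xi$ such that $X_M,X^M\in\mathcal X$, $\mathrm{res.dim}_{\mathcal H}(W_M)\le n-1$ and $\mathrm{res.dim}_{\mathcal H}(W^M)=\mathrm{res.dim}_{\mathcal X}(W^M)\le n$. (9) There is a $\xi$-exact complex $0\to H_n\to H_{n-1}\to\cdots\to H_1\to X\to M\to0$ with $X\in\mathcal X$ and $H_i\in\mathcal H$ for $1\le i\le n$. (10) For every $0\le m\le n$ there is a $\xi$-exact complex $$0\to H_n\to\cdots\to H_{m+1}\to X\to P_{m-1}\to\cdots\to P_1\to P_0\to M\to0$$ with $X\in\mathcal X$, $H_i\in\mathcal H$ for $m+1\le i\le n$ and $P_j\in\mathcal P_{\mathcal X}(\xi)$ for $0\le j\le m-1$.
   Context: Extriangulated category (Nakaoka--Palu): an additive category $\mathcal C$, a biadditive functor $\mathbb E:\mathcal C^{\mathrm{op}}\times\mathcal C\to\mathbf{Ab}$, and $\mathfrak s$, as follows. For $\delta\in\mathbb E(C,A)$, $a:A\to A'$, $c:C'\to C$ put $a_*\delta=\mathbb E(C,a)(\delta)$ and $c^*\delta=\mathbb E(c,A)(\delta)$. Sequences $A\to B\to C$ and $A\to B'\to C$ are equivalent if some isomorphism $B\to B'$ commutes with the maps from $A$ and to $C$. $\mathfrak s$ assigns to each $\delta\in\mathbb E(C,A)$ an equivalence class of sequences $A\xrightarrow{x}B\xrightarrow{y}C$; a representative is written $A\xrightarrow{x}B\xrightarrow{y}C\overset{\delta}{\dashrightarrow}$ and called an $\mathbb E$-triangle ($x$ is an inflation, $y$ a deflation;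 $\delta$ is often omitted). Axioms, for $\mathbb E$-triangles $A\xrightarrow{x}B\xrightarrow{y}C\overset{\delta}{\dashrightarrow}$ and $A'\xrightarrow{x'}B'\xrightarrow{y'}C'\overset{\delta'}{\dashrightarrow}$: (i) if $a:A\to A'$, $c:C\to C'$ satisfy $a_*\delta=c^*\delta'$, there is $b:B\to B'$ with $bx=x'a$, $y'b=cy$; (ii) $\mathfrak s(0)=[A\to A\oplus C\to C]$ and $\mathfrak s(\delta\oplus\delta')=\mathfrak s(\delta)\oplus\mathfrak s(\delta')$; (iii) if $a:A\to A'$, $b:B\to B'$ satisfy $bx=x'a$, there is $c:C\to C'$ with $y'b=cy$ and $a_*\delta=c^*\delta'$, and dually; (iv) given $\mathbb E$-triangles $A\xrightarrow{f}B\xrightarrow{f'}D\overset{\delta}{\dashrightarrow}$ and $B\xrightarrow{g}C\xrightarrow{g'}F\overset{\delta'}{\dashrightarrow}$, there are $\mathbb E$-triangles $A\xrightarrow{gf}C\xrightarrow{h'}E\overset{\delta''}{\dashrightarrow}$ and $D\xrightarrow{d}E\xrightarrow{e}F\overset{f'_*\delta'}{\dashrightarrow}$ with $h'g=df'$, $eh'=g'$, $d^*\delta''=\delta$, $f_*\delta''=e^*\delta'$, and dually. (WIC): if $gf$ is an inflation so is $f$; if $gf$ is a deflation so is $g$. Proper class: a class $\xi$ of $\mathbb E$-triangles, closed under isomorphisms and finite coproducts, containing all split $\mathbb E$-triangles ($\delta=0$), closed under base change (replacing $\delta$ by $c^*\delta$) and cobase change (replacing $\delta$ by $a_*\delta$),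 and saturated: given $\mathbb E$-triangles $A_1\to B_1\to C\overset{\delta_1}{\dashrightarrow}$ and $A_2\to B_2\xrightarrow{y_2}C\overset{\delta_2}{\dashrightarrow}$, if the second one and the $\mathbb E$-triangle $A_1\to M\to B_2\overset{y_2^*\delta_1}{\dashrightarrow}$ lie in $\xi$, so does the first. $P$ is $\xi$-projective if $0\to\mathcal C(P,A)\to\mathcal C(P,B)\to\mathcal C(P,C)\to0$ is exact for every $\mathbb E$-triangle $A\to B\to C\dashrightarrow$ in $\xi$; $\xi$-injectives are defined dually; $\mathcal P(\xi)$ is the class of $\xi$-projectives. Enough $\xi$-projectives (injectives): every $A$ has an $\mathbb E$-triangle $K\to P\to A\dashrightarrow$ (resp. $A\to I\to K\dashrightarrow$) in $\xi$ with $P$ $\xi$-projective (resp. $I$ $\xi$-injective). A complex $\cdots\to X_{n+1}\to X_n\xrightarrow{d_n}X_{n-1}\to\cdots$ is $\xi$-exact if there are $\mathbb E$-triangles $K_{n+1}\xrightarrow{g_n}X_n\xrightarrow{f_n}K_n\dashrightarrow$ in $\xi$ (its $\xi$-resolution $\mathbb E$-triangles) with $d_n=g_{n-1}f_n$ for all $n$. For a bounded complex $0\to N\to X_{n-1}\to\cdots\to X_0\to M\to0$ this means such $\mathbb E$-triangles for $0\le i\le n-1$ with $K_0=M$, $K_n=N$; similarly for one-sided complexes. Terms whose index ranges are empty are omitted. All subcategories are full and additive. An $\mathcal X$-resolution of $M$ is a $\xi$-exact complex $\cdots\to X_1\to X_0\to M\to0$ with all $X_i\in\mathcal X$; the object $K_n$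 in its $\xi$-resolution $\mathbb E$-triangles ($K_0=M$) is called an $n$th $\xi$-$\mathcal X$-syzygy of $M$, denoted $\Omega^n_{\mathcal X}(M)$ (the conditions concern arbitrary such choices). $\mathrm{res}(\mathcal X)$ is the class of objects having an $\mathcal X$-resolution. $\mathcal P_{\mathcal X}(\xi)=\mathcal X\cap\mathcal P(\xi)$. A subcategory is closed under $\xi$-extensions (resp. $\xi$-cocones) if for every $\mathbb E$-triangle $A\to B\to C\dashrightarrow$ in $\xi$, having $A,C$ in it implies $B$ in it (resp. having $B,C$ in it implies $A$ in it). $\mathcal X$ is quasi-resolving if it is closed under $\xi$-extensions and $\xi$-cocones and $\mathcal X\subseteq\mathrm{res}(\mathcal P_{\mathcal X}(\xi))$. For a subcategory $\mathcal Y$, $\mathrm{res.dim}_{\mathcal Y}(M)$ is the least $n\ge0$ for which there is a $\xi$-exact complex $0\to Y_n\to\cdots\to Y_0\to M\to0$ with all $Y_i\in\mathcal Y$, and $\infty$ if there is none; $\widehat{\mathcal Y}$ is the class of objects with finite $\mathrm{res.dim}_{\mathcal Y}$. By convention $\mathrm{res.dim}\le-1$ means the object is zero. For $n\ge0$, $\xi\mathrm{xt}^n_\xi(A,B)=H^n(\mathcal C(\mathbf P,B))$, where $\mathbf P\to A$ is a $\xi$-projective resolution, i.e. a $\xi$-exact complex $\cdots\to P_1\to P_0\to A\to0$ with $P_i\in\mathcal P(\xi)$ (equivalently, computed by a $\xi$-injective coresolution of $B$). A subcategory $\mathcal H\subseteq\mathcal X$ is a $\xi$-cogenerator of $\mathcal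 X$ if every $X\in\mathcal X$ admits an $\mathbb E$-triangle $X\to H\to X'\dashrightarrow$ in $\xi$ with $H\in\mathcal H$, $X'\in\mathcal X$. It is $\xi\mathrm{xt}$-injective if $\xi\mathrm{xt}^{k}_\xi(X,H)=0$ for all $k\ge1$, $X\in\mathcal X$, $H\in\mathcal H$, and $\xi\mathrm{xt}^0_\xi(H,H')\cong\mathcal C(H,H')$ for all $H,H'\in\mathcal H$. *)

theory Defs
  imports "HOL-Algebra.Exact_Sequence" "HOL-Library.Extended_Nat"
begin

section \<open>Additive categories\<close>

text \<open>
  Hom-sets are the carriers of abelian groups; HOL-Algebra writes group objects multiplicatively, so
  the sum of morphisms is \<open>\<otimes>\<close> and the zero morphism is \<open>\<one>\<close> of the group in question.
  Hom-sets need not be disjoint: an element may be read as a morphism between several pairs of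
  objects, with the same composites.  No generality is lost, since morphisms can be tagged with
  their source and target.
\<close>

record ('o, 'm) addcat =
  Obj :: "'o set"
  Hom :: "'o \<Rightarrow> 'o \<Rightarrow> 'm monoid"
  Ident :: "'o \<Rightarrow> 'm"
  Comp :: "'m \<Rightarrow> 'm \<Rightarrow> 'm"  (infixl \<open>\<bullet>\<index>\<close> 70)

abbreviation mor :: "('o, 'm, 'z) addcat_scheme \<Rightarrow> 'o \<Rightarrow> 'o \<Rightarrow> 'm set" where
  "mor \<C> A B \<equiv> carrier (Hom \<C> A B)"

definition zero_object :: "('o, 'm, 'z) addcat_scheme \<Rightarrow> 'o \<Rightarrow> bool" where
  "zero_object \<C> Z \<longleftrightarrow> Z \<in> Obj \<C> \<and>
     (\<forall>A \<in> Obj \<C>. trivial_group (Hom \<C> A Z) \<and> trivial_group (Hom \<C> Z A))"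

text \<open>The object \<open>S\<close> is a direct sum of \<open>A\<close> and \<open>B\<close>, with injections \<open>i\<close>, \<open>j\<close> and projections
  \<open>p\<close>, \<open>q\<close>.\<close>

definition biproduct ::
  "('o, 'm, 'z) addcat_scheme \<Rightarrow> 'o \<Rightarrow> 'o \<Rightarrow> 'o \<Rightarrow> 'm \<Rightarrow> 'm \<Rightarrow> 'm \<Rightarrow> 'm \<Rightarrow> bool" where
  "biproduct \<C> A B S i j p q \<longleftrightarrow>
     A \<in> Obj \<C> \<and> B \<in> Obj \<C> \<and> S \<in> Obj \<C> \<and>
     i \<in> mor \<C> A S \<and> j \<in> mor \<C> B S \<and> p \<in> mor \<C> S A \<and> q \<in> mor \<C> S B \<and>
     p \<bullet>\<^bsub>\<C>\<^esub> i = Ident \<C> A \<and> q \<bullet>\<^bsub>\<C>\<^esub> j = Ident \<C> B \<and>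
     q \<bullet>\<^bsub>\<C>\<^esub> i = \<one>\<^bsub>Hom \<C> A B\<^esub> \<and> p \<bullet>\<^bsub>\<C>\<^esub> j = \<one>\<^bsub>Hom \<C> B A\<^esub> \<and>
     (i \<bullet>\<^bsub>\<C>\<^esub> p) \<otimes>\<^bsub>Hom \<C> S S\<^esub> (j \<bullet>\<^bsub>\<C>\<^esub> q) = Ident \<C> S"

definition iso_mor :: "('o, 'm, 'z) addcat_scheme \<Rightarrow> 'o \<Rightarrow> 'o \<Rightarrow> 'm \<Rightarrow> bool" where
  "iso_mor \<C> A B f \<longleftrightarrow> f \<in> mor \<C> A B \<and>
     (\<exists>g \<in> mor \<C> B A. g \<bullet>\<^bsub>\<C>\<^esub> f = Ident \<C> A \<and> f \<bullet>\<^bsub>\<C>\<^esub> g = Ident \<C> B)"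

locale additive_category =
  fixes \<C> :: "('o, 'm, 'z) addcat_scheme" (structure)
  assumes Hom_comm_group:
      "\<lbrakk>A \<in> Obj \<C>; B \<in> Obj \<C>\<rbrakk> \<Longrightarrow> comm_group (Hom \<C> A B)"
    and Comp_closed:
      "\<lbrakk>A \<in> Obj \<C>; B \<in> Obj \<C>; C \<in> Obj \<C>; f \<in> mor \<C> A B; g \<in> mor \<C> B C\<rbrakk>
        \<Longrightarrow> g \<bullet> f \<in> mor \<C> A C"
    and Comp_assoc:
      "\<lbrakk>A \<in> Obj \<C>; B \<in> Obj \<C>; C \<in> Obj \<C>; D \<in> Obj \<C>;
        f \<in> mor \<C> A B; g \<in> mor \<C> B C; h \<in> mor \<C> C D\<rbrakk>
        \<Longrightarrow> (h \<bullet> g) \<bullet> f = h \<bullet> (g \<bullet> f)"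
    and Ident_closed: "A \<in> Obj \<C> \<Longrightarrow> Ident \<C> A \<in> mor \<C> A A"
    and Ident_right:
      "\<lbrakk>A \<in> Obj \<C>; B \<in> Obj \<C>; f \<in> mor \<C> A B\<rbrakk> \<Longrightarrow> f \<bullet> Ident \<C> A = f"
    and Ident_left:
      "\<lbrakk>A \<in> Obj \<C>; B \<in> Obj \<C>; f \<in> mor \<C> A B\<rbrakk> \<Longrightarrow> Ident \<C> B \<bullet> f = f"
    and Comp_add_right:
      "\<lbrakk>A \<in> Obj \<C>; B \<in> Obj \<C>; C \<in> Obj \<C>;
        f \<in> mor \<C> A B; f' \<in> mor \<C> A B; g \<in> mor \<C> B C\<rbrakk>
        \<Longrightarrow> g \<bullet> (f \<otimes>\<^bsub>Hom \<C> A B\<^esub> f') = (g \<bullet> f) \<otimes>\<^bsub>Hom \<C> A C\<^esub> (g \<bullet> f')"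
    and Comp_add_left:
      "\<lbrakk>A \<in> Obj \<C>; B \<in> Obj \<C>; C \<in> Obj \<C>;
        f \<in> mor \<C> A B; g \<in> mor \<C> B C; g' \<in> mor \<C> B C\<rbrakk>
        \<Longrightarrow> (g \<otimes>\<^bsub>Hom \<C> B C\<^esub> g') \<bullet> f = (g \<bullet> f) \<otimes>\<^bsub>Hom \<C> A C\<^esub> (g' \<bullet> f)"
    and ex_zero_object: "\<exists>Z. zero_object \<C> Z"
    and ex_biproduct:
      "\<lbrakk>A \<in> Obj \<C>; B \<in> Obj \<C>\<rbrakk> \<Longrightarrow> \<exists>S i j p q. biproduct \<C> A B S i j p q"


section \<open>Extriangulated categories\<close>

text \<open>
  \<open>EE \<C> C A\<close> is the abelian group \<open>\<E>(C, A)\<close>, \<open>push \<C> a \<delta>\<close> is \<open>a\<^sub>*\<delta>\<close> and \<open>pull \<C> c \<delta>\<close> is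
  \<open>c\<^sup>*\<delta>\<close>.  \<open>rlz \<C> C A \<delta>\<close> is the equivalence class \<open>\<s>(\<delta>)\<close>; an element
  \<open>(x, B, y)\<close> of it is a sequence \<open>A \<rightarrow> B \<rightarrow> C\<close> with first map \<open>x\<close> and second map \<open>y\<close>.
\<close>

record ('o, 'm, 'e) extricat = "('o, 'm) addcat" +
  EE :: "'o \<Rightarrow> 'o \<Rightarrow> 'e monoid"
  push :: "'m \<Rightarrow> 'e \<Rightarrow> 'e"
  pull :: "'m \<Rightarrow> 'e \<Rightarrow> 'e"
  rlz :: "'o \<Rightarrow> 'o \<Rightarrow> 'e \<Rightarrow> ('m \<times> 'o \<times> 'm) set"

definition sequences :: "('o, 'm, 'z) addcat_scheme \<Rightarrow> 'o \<Rightarrow> 'o \<Rightarrow> ('m \<times> 'o \<times> 'm) set" where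
  "sequences \<C> A C = {(x, B, y). B \<in> Obj \<C> \<and> x \<in> mor \<C> A B \<and> y \<in> mor \<C> B C}"

definition seq_equiv :: "('o, 'm, 'z) addcat_scheme \<Rightarrow> 'o \<Rightarrow> 'o \<Rightarrow> ('m \<times> 'o \<times> 'm) rel" where
  "seq_equiv \<C> A C =
     {((x, B, y), (x', B', y')).
        (x, B, y) \<in> sequences \<C> A C \<and> (x', B', y') \<in> sequences \<C> A C \<and>
        (\<exists>b. iso_mor \<C> B B' b \<and> b \<bullet>\<^bsub>\<C>\<^esub> x = x' \<and> y' \<bullet>\<^bsub>\<C>\<^esub> b = y)}"

text \<open>The tuple \<open>(A, x, B, y, C, \<delta>)\<close> stands for the sequence \<open>A \<rightarrow> B \<rightarrow> C\<close> with maps \<open>x\<close>, \<open>y\<close>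
  and extension \<open>\<delta> \<in> \<E>(C, A)\<close>.\<close>

type_synonym ('o, 'm, 'e) triangle = "'o \<times> 'm \<times> 'o \<times> 'm \<times> 'o \<times> 'e"

definition etriangles :: "('o, 'm, 'e, 'z) extricat_scheme \<Rightarrow> ('o, 'm, 'e) triangle set" where
  "etriangles \<C> =
     {(A, x, B, y, C, \<delta>). A \<in> Obj \<C> \<and> C \<in> Obj \<C> \<and> \<delta> \<in> carrier (EE \<C> C A) \<and>
        (x, B, y) \<in> rlz \<C> C A \<delta>}"

text \<open>
  \<open>T''\<close> is a coproduct of \<open>T\<close> and \<open>T'\<close>.  Its maps are the direct sums of the maps, and its
  extension is \<open>\<delta> \<oplus> \<delta>'\<close>, the element of \<open>\<E>(C \<oplus> C', A \<oplus> A')\<close> with components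
  \<open>(\<delta>, 0, 0, \<delta>')\<close> in \<open>\<E>(C, A)\<close>, \<open>\<E>(C, A')\<close>, \<open>\<E>(C', A)\<close>, \<open>\<E>(C', A')\<close>.
\<close>

definition coproduct_triangle ::
  "('o, 'm, 'e, 'z) extricat_scheme \<Rightarrow> ('o, 'm, 'e) triangle \<Rightarrow> ('o, 'm, 'e) triangle
     \<Rightarrow> ('o, 'm, 'e) triangle \<Rightarrow> bool" where
  "coproduct_triangle \<C> =
     (\<lambda>(A, x, B, y, C, \<delta>) (A', x', B', y', C', \<delta>') (A'', x'', B'', y'', C'', \<delta>'').
        \<exists>iA jA pA qA iB jB pB qB iC jC pC qC.
          biproduct \<C> A A' A'' iA jA pA qA \<and>
          biproduct \<C> B B' B'' iB jB pB qB \<and>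
          biproduct \<C> C C' C'' iC jC pC qC \<and>
          x'' \<in> mor \<C> A'' B'' \<and> x'' \<bullet>\<^bsub>\<C>\<^esub> iA = iB \<bullet>\<^bsub>\<C>\<^esub> x \<and> x'' \<bullet>\<^bsub>\<C>\<^esub> jA = jB \<bullet>\<^bsub>\<C>\<^esub> x' \<and>
          y'' \<in> mor \<C> B'' C'' \<and> y'' \<bullet>\<^bsub>\<C>\<^esub> iB = iC \<bullet>\<^bsub>\<C>\<^esub> y \<and> y'' \<bullet>\<^bsub>\<C>\<^esub> jB = jC \<bullet>\<^bsub>\<C>\<^esub> y' \<and>
          \<delta>'' \<in> carrier (EE \<C> C'' A'') \<and>
          push \<C> pA (pull \<C> iC \<delta>'') = \<delta> \<and>
          push \<C> qA (pull \<C> iC \<delta>'') = \<one>\<^bsub>EE \<C> C A'\<^esub> \<and>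
          push \<C> pA (pull \<C> jC \<delta>'') = \<one>\<^bsub>EE \<C> C' A\<^esub> \<and>
          push \<C> qA (pull \<C> jC \<delta>'') = \<delta>')"

locale extriangulated_category = additive_category \<C>
  for \<C> :: "('o, 'm, 'e, 'z) extricat_scheme" (structure) +
  assumes EE_comm_group:
      "\<lbrakk>C \<in> Obj \<C>; A \<in> Obj \<C>\<rbrakk> \<Longrightarrow> comm_group (EE \<C> C A)"
    and push_hom:
      "\<lbrakk>C \<in> Obj \<C>; A \<in> Obj \<C>; A' \<in> Obj \<C>; a \<in> mor \<C> A A'\<rbrakk>
        \<Longrightarrow> push \<C> a \<in> hom (EE \<C> C A) (EE \<C> C A')"
    and pull_hom:
      "\<lbrakk>C \<in> Obj \<C>; C' \<in> Obj \<C>; A \<in> Obj \<C>; c \<in> mor \<C> C' C\<rbrakk>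
        \<Longrightarrow> pull \<C> c \<in> hom (EE \<C> C A) (EE \<C> C' A)"
    and push_Ident:
      "\<lbrakk>C \<in> Obj \<C>; A \<in> Obj \<C>; \<delta> \<in> carrier (EE \<C> C A)\<rbrakk> \<Longrightarrow> push \<C> (Ident \<C> A) \<delta> = \<delta>"
    and pull_Ident:
      "\<lbrakk>C \<in> Obj \<C>; A \<in> Obj \<C>; \<delta> \<in> carrier (EE \<C> C A)\<rbrakk> \<Longrightarrow> pull \<C> (Ident \<C> C) \<delta> = \<delta>"
    and push_Comp:
      "\<lbrakk>C \<in> Obj \<C>; A \<in> Obj \<C>; A' \<in> Obj \<C>; A'' \<in> Obj \<C>; \<delta> \<in> carrier (EE \<C> C A);
        a \<in> mor \<C> A A'; a' \<in> mor \<C> A' A''\<rbrakk>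
        \<Longrightarrow> push \<C> (a' \<bullet> a) \<delta> = push \<C> a' (push \<C> a \<delta>)"
    and pull_Comp:
      "\<lbrakk>C \<in> Obj \<C>; C' \<in> Obj \<C>; C'' \<in> Obj \<C>; A \<in> Obj \<C>; \<delta> \<in> carrier (EE \<C> C A);
        c \<in> mor \<C> C' C; c' \<in> mor \<C> C'' C'\<rbrakk>
        \<Longrightarrow> pull \<C> (c \<bullet> c') \<delta> = pull \<C> c' (pull \<C> c \<delta>)"
    and push_pull:
      "\<lbrakk>C \<in> Obj \<C>; C' \<in> Obj \<C>; A \<in> Obj \<C>; A' \<in> Obj \<C>; \<delta> \<in> carrier (EE \<C> C A);
        a \<in> mor \<C> A A'; c \<in> mor \<C> C' C\<rbrakk>
        \<Longrightarrow> push \<C> a (pull \<C> c \<delta>) = pull \<C> c (push \<C> a \<delta>)"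
    and push_add:
      "\<lbrakk>C \<in> Obj \<C>; A \<in> Obj \<C>; A' \<in> Obj \<C>; \<delta> \<in> carrier (EE \<C> C A);
        a \<in> mor \<C> A A'; a' \<in> mor \<C> A A'\<rbrakk>
        \<Longrightarrow> push \<C> (a \<otimes>\<^bsub>Hom \<C> A A'\<^esub> a') \<delta> = push \<C> a \<delta> \<otimes>\<^bsub>EE \<C> C A'\<^esub> push \<C> a' \<delta>"
    and pull_add:
      "\<lbrakk>C \<in> Obj \<C>; C' \<in> Obj \<C>; A \<in> Obj \<C>; \<delta> \<in> carrier (EE \<C> C A);
        c \<in> mor \<C> C' C; c' \<in> mor \<C> C' C\<rbrakk>
        \<Longrightarrow> pull \<C> (c \<otimes>\<^bsub>Hom \<C> C' C\<^esub> c') \<delta> = pull \<C> c \<delta> \<otimes>\<^bsub>EE \<C> C' A\<^esub> pull \<C> c' \<delta>"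
    and rlz_class:
      "\<lbrakk>C \<in> Obj \<C>; A \<in> Obj \<C>; \<delta> \<in> carrier (EE \<C> C A)\<rbrakk>
        \<Longrightarrow> rlz \<C> C A \<delta> \<in> sequences \<C> A C // seq_equiv \<C> A C"
    and rlz_morphism:
      "\<lbrakk>(A, x, B, y, C, \<delta>) \<in> etriangles \<C>; (A', x', B', y', C', \<delta>') \<in> etriangles \<C>;
        a \<in> mor \<C> A A'; c \<in> mor \<C> C C'; push \<C> a \<delta> = pull \<C> c \<delta>'\<rbrakk>
        \<Longrightarrow> \<exists>b \<in> mor \<C> B B'. b \<bullet> x = x' \<bullet> a \<and> y' \<bullet> b = c \<bullet> y"
    and rlz_zero:
      "biproduct \<C> A C S iA iC pA pC \<Longrightarrow> (A, iA, S, pC, C, \<one>\<^bsub>EE \<C> C A\<^esub>) \<in> etriangles \<C>"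
    and rlz_sum:
      "\<lbrakk>T \<in> etriangles \<C>; T' \<in> etriangles \<C>; coproduct_triangle \<C> T T' T''\<rbrakk>
        \<Longrightarrow> T'' \<in> etriangles \<C>"
    and ET3:
      "\<lbrakk>(A, x, B, y, C, \<delta>) \<in> etriangles \<C>; (A', x', B', y', C', \<delta>') \<in> etriangles \<C>;
        a \<in> mor \<C> A A'; b \<in> mor \<C> B B'; b \<bullet> x = x' \<bullet> a\<rbrakk>
        \<Longrightarrow> \<exists>c \<in> mor \<C> C C'. y' \<bullet> b = c \<bullet> y \<and> push \<C> a \<delta> = pull \<C> c \<delta>'"
    and ET3_op:
      "\<lbrakk>(A, x, B, y, C, \<delta>) \<in> etriangles \<C>; (A', x', B', y', C', \<delta>') \<in> etriangles \<C>;
        b \<in> mor \<C> B B'; c \<in> mor \<C> C C'; y' \<bullet> b = c \<bullet> y\<rbrakk>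
        \<Longrightarrow> \<exists>a \<in> mor \<C> A A'. b \<bullet> x = x' \<bullet> a \<and> push \<C> a \<delta> = pull \<C> c \<delta>'"
    and ET4:
      "\<lbrakk>(A, f, B, f', D, \<delta>) \<in> etriangles \<C>; (B, g, C, g', F, \<delta>') \<in> etriangles \<C>\<rbrakk>
        \<Longrightarrow> \<exists>E h' d e \<delta>''.
              (A, g \<bullet> f, C, h', E, \<delta>'') \<in> etriangles \<C> \<and>
              (D, d, E, e, F, push \<C> f' \<delta>') \<in> etriangles \<C> \<and>
              h' \<bullet> g = d \<bullet> f' \<and> e \<bullet> h' = g' \<and>
              pull \<C> d \<delta>'' = \<delta> \<and> push \<C> f \<delta>'' = pull \<C> e \<delta>'"
    and ET4_op:
      "\<lbrakk>(D, f', B, f, A, \<delta>) \<in> etriangles \<C>; (F, g', C, g, B, \<delta>') \<in> etriangles \<C>\<rbrakk>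
        \<Longrightarrow> \<exists>E h' d e \<delta>''.
              (E, h', C, f \<bullet> g, A, \<delta>'') \<in> etriangles \<C> \<and>
              (F, e, E, d, D, pull \<C> f' \<delta>') \<in> etriangles \<C> \<and>
              g \<bullet> h' = f' \<bullet> d \<and> h' \<bullet> e = g' \<and>
              push \<C> d \<delta>'' = \<delta> \<and> pull \<C> f \<delta>'' = push \<C> e \<delta>'"

definition inflation :: "('o, 'm, 'e, 'z) extricat_scheme \<Rightarrow> 'o \<Rightarrow> 'o \<Rightarrow> 'm \<Rightarrow> bool" where
  "inflation \<C> A B x \<longleftrightarrow> (\<exists>y C \<delta>. (A, x, B, y, C, \<delta>) \<in> etriangles \<C>)"

definition deflation :: "('o, 'm, 'e, 'z) extricat_scheme \<Rightarrow> 'o \<Rightarrow> 'o \<Rightarrow> 'm \<Rightarrow> bool" where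
  "deflation \<C> B C y \<longleftrightarrow> (\<exists>A x \<delta>. (A, x, B, y, C, \<delta>) \<in> etriangles \<C>)"

definition WIC :: "('o, 'm, 'e, 'z) extricat_scheme \<Rightarrow> bool" where
  "WIC \<C> \<longleftrightarrow>
     (\<forall>A \<in> Obj \<C>. \<forall>B \<in> Obj \<C>. \<forall>C \<in> Obj \<C>. \<forall>f \<in> mor \<C> A B. \<forall>g \<in> mor \<C> B C.
        (inflation \<C> A C (g \<bullet>\<^bsub>\<C>\<^esub> f) \<longrightarrow> inflation \<C> A B f) \<and>
        (deflation \<C> A C (g \<bullet>\<^bsub>\<C>\<^esub> f) \<longrightarrow> deflation \<C> B C g))"


section \<open>Proper classes, projectives and injectives\<close>

definition iso_triangle ::
  "('o, 'm, 'e, 'z) extricat_scheme \<Rightarrow> ('o, 'm, 'e) triangle \<Rightarrow> ('o, 'm, 'e) triangle \<Rightarrow> bool" where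
  "iso_triangle \<C> = (\<lambda>(A, x, B, y, C, \<delta>) (A', x', B', y', C', \<delta>').
     \<exists>a b c. iso_mor \<C> A A' a \<and> iso_mor \<C> B B' b \<and> iso_mor \<C> C C' c \<and>
       b \<bullet>\<^bsub>\<C>\<^esub> x = x' \<bullet>\<^bsub>\<C>\<^esub> a \<and> y' \<bullet>\<^bsub>\<C>\<^esub> b = c \<bullet>\<^bsub>\<C>\<^esub> y \<and> push \<C> a \<delta> = pull \<C> c \<delta>')"

text \<open>Closure under finite coproducts is expressed by the binary case; the empty coproduct is a
  split triangle.\<close>

locale proper_class = extriangulated_category \<C>
  for \<C> :: "('o, 'm, 'e, 'z) extricat_scheme" (structure)
  and \<xi> :: "('o, 'm, 'e) triangle set" +
  assumes subset_etriangles: "\<xi> \<subseteq> etriangles \<C>"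
    and closed_iso:
      "\<lbrakk>T \<in> \<xi>; T' \<in> etriangles \<C>; iso_triangle \<C> T T'\<rbrakk> \<Longrightarrow> T' \<in> \<xi>"
    and closed_coproduct:
      "\<lbrakk>T \<in> \<xi>; T' \<in> \<xi>; coproduct_triangle \<C> T T' T''\<rbrakk> \<Longrightarrow> T'' \<in> \<xi>"
    and split_in:
      "(A, x, B, y, C, \<one>\<^bsub>EE \<C> C A\<^esub>) \<in> etriangles \<C> \<Longrightarrow> (A, x, B, y, C, \<one>\<^bsub>EE \<C> C A\<^esub>) \<in> \<xi>"
    and base_change:
      "\<lbrakk>(A, x, B, y, C, \<delta>) \<in> \<xi>; C' \<in> Obj \<C>; c \<in> mor \<C> C' C;
        (A, x', B', y', C', pull \<C> c \<delta>) \<in> etriangles \<C>\<rbrakk>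
        \<Longrightarrow> (A, x', B', y', C', pull \<C> c \<delta>) \<in> \<xi>"
    and cobase_change:
      "\<lbrakk>(A, x, B, y, C, \<delta>) \<in> \<xi>; A' \<in> Obj \<C>; a \<in> mor \<C> A A';
        (A', x', B', y', C, push \<C> a \<delta>) \<in> etriangles \<C>\<rbrakk>
        \<Longrightarrow> (A', x', B', y', C, push \<C> a \<delta>) \<in> \<xi>"
    and saturated:
      "\<lbrakk>(A1, x1, B1, y1, C, \<delta>1) \<in> etriangles \<C>; (A2, x2, B2, y2, C, \<delta>2) \<in> \<xi>;
        (A1, m, M, e, B2, pull \<C> y2 \<delta>1) \<in> \<xi>\<rbrakk>
        \<Longrightarrow> (A1, x1, B1, y1, C, \<delta>1) \<in> \<xi>"

text \<open>In HOL-Algebra, \<open>short_exact_sequence Z Y X g f\<close> means that \<open>0 \<rightarrow> X \<rightarrow> Y \<rightarrow> Z \<rightarrow> 0\<close>,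
  with maps \<open>f\<close> and \<open>g\<close>, is exact.\<close>

definition projectives ::
  "('o, 'm, 'e, 'z) extricat_scheme \<Rightarrow> ('o, 'm, 'e) triangle set \<Rightarrow> 'o set" where
  "projectives \<C> \<xi> = {P \<in> Obj \<C>. \<forall>(A, x, B, y, C, \<delta>) \<in> \<xi>.
     short_exact_sequence (Hom \<C> P C) (Hom \<C> P B) (Hom \<C> P A)
       (\<lambda>h. y \<bullet>\<^bsub>\<C>\<^esub> h) (\<lambda>h. x \<bullet>\<^bsub>\<C>\<^esub> h)}"

definition injectives ::
  "('o, 'm, 'e, 'z) extricat_scheme \<Rightarrow> ('o, 'm, 'e) triangle set \<Rightarrow> 'o set" where
  "injectives \<C> \<xi> = {I \<in> Obj \<C>. \<forall>(A, x, B, y, C, \<delta>) \<in> \<xi>.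
     short_exact_sequence (Hom \<C> A I) (Hom \<C> B I) (Hom \<C> C I)
       (\<lambda>h. h \<bullet>\<^bsub>\<C>\<^esub> x) (\<lambda>h. h \<bullet>\<^bsub>\<C>\<^esub> y)}"

definition enough_projectives ::
  "('o, 'm, 'e, 'z) extricat_scheme \<Rightarrow> ('o, 'm, 'e) triangle set \<Rightarrow> bool" where
  "enough_projectives \<C> \<xi> \<longleftrightarrow>
     (\<forall>A \<in> Obj \<C>. \<exists>K x P y \<delta>. (K, x, P, y, A, \<delta>) \<in> \<xi> \<and> P \<in> projectives \<C> \<xi>)"

definition enough_injectives ::
  "('o, 'm, 'e, 'z) extricat_scheme \<Rightarrow> ('o, 'm, 'e) triangle set \<Rightarrow> bool" where
  "enough_injectives \<C> \<xi> \<longleftrightarrow>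
     (\<forall>A \<in> Obj \<C>. \<exists>x I y K \<delta>. (A, x, I, y, K, \<delta>) \<in> \<xi> \<and> I \<in> injectives \<C> \<xi>)"


section \<open>Exact complexes, resolutions and dimensions\<close>

text \<open>
  A complex \<open>\<cdots> \<rightarrow> X 1 \<rightarrow> X 0 \<rightarrow> M \<rightarrow> 0\<close> has differentials \<open>d (Suc n) : X (Suc n) \<rightarrow> X n\<close> and
  \<open>d 0 : X 0 \<rightarrow> M\<close>.  The data \<open>K\<close>, \<open>g\<close>, \<open>f\<close> are the resolution triangles
  \<open>K (Suc n) \<rightarrow> X n \<rightarrow> K n\<close> with maps \<open>g n\<close>, \<open>f n\<close>.
\<close>

definition resolution_triangles ::
  "('o, 'm, 'e, 'z) extricat_scheme \<Rightarrow> ('o, 'm, 'e) triangle set \<Rightarrow> 'o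
     \<Rightarrow> (nat \<Rightarrow> 'o) \<Rightarrow> (nat \<Rightarrow> 'm) \<Rightarrow> (nat \<Rightarrow> 'o) \<Rightarrow> (nat \<Rightarrow> 'm) \<Rightarrow> (nat \<Rightarrow> 'm) \<Rightarrow> bool" where
  "resolution_triangles \<C> \<xi> M X d K g f \<longleftrightarrow>
     K 0 = M \<and> d 0 = f 0 \<and> (\<forall>n. d (Suc n) = g n \<bullet>\<^bsub>\<C>\<^esub> f (Suc n)) \<and>
     (\<forall>n. \<exists>\<delta>. (K (Suc n), g n, X n, f n, K n, \<delta>) \<in> \<xi>)"

definition is_resolution ::
  "('o, 'm, 'e, 'z) extricat_scheme \<Rightarrow> ('o, 'm, 'e) triangle set \<Rightarrow> 'o set \<Rightarrow> 'o
     \<Rightarrow> (nat \<Rightarrow> 'o) \<Rightarrow> (nat \<Rightarrow> 'm) \<Rightarrow> bool" where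
  "is_resolution \<C> \<xi> \<Y> M X d \<longleftrightarrow>
     (\<forall>n. X n \<in> \<Y>) \<and> (\<exists>K g f. resolution_triangles \<C> \<xi> M X d K g f)"

definition res ::
  "('o, 'm, 'e, 'z) extricat_scheme \<Rightarrow> ('o, 'm, 'e) triangle set \<Rightarrow> 'o set \<Rightarrow> 'o set" where
  "res \<C> \<xi> \<Y> = {M \<in> Obj \<C>. \<exists>X d. is_resolution \<C> \<xi> \<Y> M X d}"

definition is_syzygy ::
  "('o, 'm, 'e, 'z) extricat_scheme \<Rightarrow> ('o, 'm, 'e) triangle set \<Rightarrow> 'o set
     \<Rightarrow> nat \<Rightarrow> 'o \<Rightarrow> 'o \<Rightarrow> bool" where
  "is_syzygy \<C> \<xi> \<Y> n M N \<longleftrightarrow>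
     (\<exists>X d K g f. (\<forall>i. X i \<in> \<Y>) \<and> resolution_triangles \<C> \<xi> M X d K g f \<and> K n = N)"

text \<open>
  The complex \<open>0 \<rightarrow> X n \<rightarrow> \<cdots> \<rightarrow> X 0 \<rightarrow> M \<rightarrow> 0\<close> is \<open>\<xi>\<close>-exact: the leftmost term is \<open>K n\<close>, so there
  are triangles for \<open>i < n\<close> only and \<open>f n\<close> is an identity.  For \<open>n = 0\<close> the complex is
  \<open>0 \<rightarrow> M \<rightarrow> M \<rightarrow> 0\<close>.
\<close>

definition exact_bounded ::
  "('o, 'm, 'e, 'z) extricat_scheme \<Rightarrow> ('o, 'm, 'e) triangle set \<Rightarrow> nat
     \<Rightarrow> (nat \<Rightarrow> 'o) \<Rightarrow> (nat \<Rightarrow> 'm) \<Rightarrow> 'o \<Rightarrow> bool" where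
  "exact_bounded \<C> \<xi> n X d M \<longleftrightarrow>
     (\<exists>K g f. K 0 = M \<and> K n = X n \<and> f n = Ident \<C> (X n) \<and> d 0 = f 0 \<and>
       (\<forall>i<n. d (Suc i) = g i \<bullet>\<^bsub>\<C>\<^esub> f (Suc i)) \<and>
       (\<forall>i<n. \<exists>\<delta>. (K (Suc i), g i, X i, f i, K i, \<delta>) \<in> \<xi>))"

definition res_dim ::
  "('o, 'm, 'e, 'z) extricat_scheme \<Rightarrow> ('o, 'm, 'e) triangle set \<Rightarrow> 'o set \<Rightarrow> 'o \<Rightarrow> enat" where
  "res_dim \<C> \<xi> \<Y> M =
     Inf {enat n |n. \<exists>X d. (\<forall>i\<le>n. X i \<in> \<Y>) \<and> exact_bounded \<C> \<xi> n X d M}"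

text \<open>The bound may be negative, in which case it means that the object is zero.\<close>

definition res_dim_le ::
  "('o, 'm, 'e, 'z) extricat_scheme \<Rightarrow> ('o, 'm, 'e) triangle set \<Rightarrow> 'o set \<Rightarrow> 'o \<Rightarrow> int \<Rightarrow> bool"
  where
  "res_dim_le \<C> \<xi> \<Y> M k \<longleftrightarrow>
     (if k < 0 then zero_object \<C> M else res_dim \<C> \<xi> \<Y> M \<le> enat (nat k))"

definition finite_res_dim ::
  "('o, 'm, 'e, 'z) extricat_scheme \<Rightarrow> ('o, 'm, 'e) triangle set \<Rightarrow> 'o set \<Rightarrow> 'o set" where
  "finite_res_dim \<C> \<xi> \<Y> = {M \<in> Obj \<C>. res_dim \<C> \<xi> \<Y> M < \<infinity>}"


section \<open>The groups \<open>\<xi>xt\<close>\<close>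

text \<open>Cohomology of the cochain complex \<open>\<C>(P 0, B) \<rightarrow> \<C>(P 1, B) \<rightarrow> \<cdots>\<close> of the deleted
  resolution; \<open>d 0\<close> is the augmentation and does not occur.\<close>

definition cocycles ::
  "('o, 'm, 'z) addcat_scheme \<Rightarrow> (nat \<Rightarrow> 'o) \<Rightarrow> (nat \<Rightarrow> 'm) \<Rightarrow> 'o \<Rightarrow> nat \<Rightarrow> 'm monoid" where
  "cocycles \<C> P d B n =
     (Hom \<C> (P n) B)\<lparr>carrier :=
        kernel (Hom \<C> (P n) B) (Hom \<C> (P (Suc n)) B) (\<lambda>h. h \<bullet>\<^bsub>\<C>\<^esub> d (Suc n))\<rparr>"

definition coboundaries ::
  "('o, 'm, 'z) addcat_scheme \<Rightarrow> (nat \<Rightarrow> 'o) \<Rightarrow> (nat \<Rightarrow> 'm) \<Rightarrow> 'o \<Rightarrow> nat \<Rightarrow> 'm set" where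
  "coboundaries \<C> P d B n =
     (case n of 0 \<Rightarrow> {\<one>\<^bsub>Hom \<C> (P 0) B\<^esub>} | Suc m \<Rightarrow> (\<lambda>h. h \<bullet>\<^bsub>\<C>\<^esub> d n) ` mor \<C> (P m) B)"

text \<open>A choice of projective resolution; the groups \<open>xt\<close> do not depend on it up to canonical
  isomorphism.\<close>

definition proj_resolution ::
  "('o, 'm, 'e, 'z) extricat_scheme \<Rightarrow> ('o, 'm, 'e) triangle set \<Rightarrow> 'o
     \<Rightarrow> (nat \<Rightarrow> 'o) \<times> (nat \<Rightarrow> 'm)" where
  "proj_resolution \<C> \<xi> A = (SOME (P, d). is_resolution \<C> \<xi> (projectives \<C> \<xi>) A P d)"

definition xt ::
  "('o, 'm, 'e, 'z) extricat_scheme \<Rightarrow> ('o, 'm, 'e) triangle set \<Rightarrow> nat \<Rightarrow> 'o \<Rightarrow> 'o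
     \<Rightarrow> 'm set monoid" where
  "xt \<C> \<xi> n A B = (let (P, d) = proj_resolution \<C> \<xi> A in
     cocycles \<C> P d B n Mod coboundaries \<C> P d B n)"

text \<open>The canonical map \<open>\<C>(A, B) \<rightarrow> \<xi>xt\<^sup>0(A, B)\<close> is composition with the augmentation \<open>P 0 \<rightarrow> A\<close>.\<close>

definition xt0_map ::
  "('o, 'm, 'e, 'z) extricat_scheme \<Rightarrow> ('o, 'm, 'e) triangle set \<Rightarrow> 'o \<Rightarrow> 'o \<Rightarrow> 'm \<Rightarrow> 'm set" where
  "xt0_map \<C> \<xi> A B h = (let (P, d) = proj_resolution \<C> \<xi> A in
     coboundaries \<C> P d B 0 #>\<^bsub>cocycles \<C> P d B 0\<^esub> (h \<bullet>\<^bsub>\<C>\<^esub> d 0))"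


section \<open>Subcategories\<close>

text \<open>Full additive subcategories, given by their objects; not assumed closed under isomorphism.\<close>

definition additive_subcategory :: "('o, 'm, 'z) addcat_scheme \<Rightarrow> 'o set \<Rightarrow> bool" where
  "additive_subcategory \<C> \<Y> \<longleftrightarrow> \<Y> \<subseteq> Obj \<C> \<and> (\<exists>Z \<in> \<Y>. zero_object \<C> Z) \<and>
     (\<forall>A \<in> \<Y>. \<forall>B \<in> \<Y>. \<exists>S \<in> \<Y>. \<exists>i j p q. biproduct \<C> A B S i j p q)"

definition closed_extensions :: "('o, 'm, 'e) triangle set \<Rightarrow> 'o set \<Rightarrow> bool" where
  "closed_extensions \<xi> \<Y> \<longleftrightarrow>
     (\<forall>(A, x, B, y, C, \<delta>) \<in> \<xi>. A \<in> \<Y> \<and> C \<in> \<Y> \<longrightarrow> B \<in> \<Y>)"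

definition closed_cocones :: "('o, 'm, 'e) triangle set \<Rightarrow> 'o set \<Rightarrow> bool" where
  "closed_cocones \<xi> \<Y> \<longleftrightarrow>
     (\<forall>(A, x, B, y, C, \<delta>) \<in> \<xi>. B \<in> \<Y> \<and> C \<in> \<Y> \<longrightarrow> A \<in> \<Y>)"

definition closed_summands :: "('o, 'm, 'z) addcat_scheme \<Rightarrow> 'o set \<Rightarrow> bool" where
  "closed_summands \<C> \<Y> \<longleftrightarrow>
     (\<forall>A B S i j p q. biproduct \<C> A B S i j p q \<and> S \<in> \<Y> \<longrightarrow> A \<in> \<Y> \<and> B \<in> \<Y>)"

definition quasi_resolving ::
  "('o, 'm, 'e, 'z) extricat_scheme \<Rightarrow> ('o, 'm, 'e) triangle set \<Rightarrow> 'o set \<Rightarrow> bool" where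
  "quasi_resolving \<C> \<xi> \<X> \<longleftrightarrow> additive_subcategory \<C> \<X> \<and>
     closed_extensions \<xi> \<X> \<and> closed_cocones \<xi> \<X> \<and>
     \<X> \<subseteq> res \<C> \<xi> (\<X> \<inter> projectives \<C> \<xi>)"

definition cogenerator :: "('o, 'm, 'e) triangle set \<Rightarrow> 'o set \<Rightarrow> 'o set \<Rightarrow> bool" where
  "cogenerator \<xi> \<X> \<H> \<longleftrightarrow> \<H> \<subseteq> \<X> \<and>
     (\<forall>X \<in> \<X>. \<exists>x H y X' \<delta>. (X, x, H, y, X', \<delta>) \<in> \<xi> \<and> H \<in> \<H> \<and> X' \<in> \<X>)"

definition xt_injective ::
  "('o, 'm, 'e, 'z) extricat_scheme \<Rightarrow> ('o, 'm, 'e) triangle set \<Rightarrow> 'o set \<Rightarrow> 'o set \<Rightarrow> bool" where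
  "xt_injective \<C> \<xi> \<X> \<H> \<longleftrightarrow>
     (\<forall>k\<ge>1. \<forall>X \<in> \<X>. \<forall>H \<in> \<H>. trivial_group (xt \<C> \<xi> k X H)) \<and>
     (\<forall>H \<in> \<H>. \<forall>H' \<in> \<H>. xt0_map \<C> \<xi> H H' \<in> iso (Hom \<C> H H') (xt \<C> \<xi> 0 H H'))"

end

theory Submission
  imports Defs
begin

text \<open>
  Three ingredients carry the theorem.

  The first is the calculus of \<open>\<xi>\<close>-resolutions.  Two deflations with the same target have a pullback
  (\<open>pullback_in\<close>), obtained by realizing the sum of the two extensions and applying the octahedral
  axiom; inflations have pushouts (\<open>pushout_in\<close>); and deflations and inflations in \<open>\<xi>\<close> compose, the
  former by saturation, the latter by saturation and base change to a projective cover.  With these the usual arguments show that \<open>\<X>\<close>-dimension at most \<open>n\<close> is inherited by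
  extensions with objects of \<open>\<X>\<close> and by cocones of morphisms to \<open>\<X>\<close>.  Schanuel's lemma
  (\<open>dim_syzygy_step\<close>) follows: the first syzygy of an object of dimension at most \<open>n + 1\<close> has
  dimension at most \<open>n\<close>, whatever \<open>\<X>\<close>-resolution is used.  Since objects of finite
  dimension have resolutions by projective objects of \<open>\<X>\<close>, this settles the conditions on syzygies.

  The second is the use of \<open>\<xi>xt\<close>.  Since \<open>\<C>(P, _)\<close> is exact on \<open>\<xi>\<close> for \<open>P\<close> projective, the comparison
  theorem and dimension shifting hold as in an abelian category, and the conditions on \<open>\<xi>xt\<close> reduce to
  the following (\<open>orthogonal_in_X\<close>): an object of finite dimension with \<open>\<xi>xt\<^sup>i(K, H) = 0\<close> for all \<open>i > 0\<close>
  and \<open>H\<close> in \<open>\<H>\<close> belongs to \<open>\<X>\<close>.  A triangle \<open>H \<rightarrow> B \<rightarrow> K\<close> with \<open>\<xi>xt\<^sup>1(K, H) = 0\<close> need not split in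
  general, because \<open>\<xi>xt\<^sup>0(B, H)\<close> may differ from \<open>\<C>(B, H)\<close>: there may be nonzero morphisms that vanish on all
  projective objects.  The hypothesis on \<open>\<xi>xt\<^sup>0\<close> within \<open>\<H>\<close>, combined with embeddings of objects of \<open>\<X>\<close>
  into objects of \<open>\<H>\<close>, gives the splitting when \<open>B\<close> lies in \<open>\<X>\<close> (\<open>H_splits\<close>), which suffices.

  The third is Auslander--Buchweitz approximation (\<open>coapproximation\<close>, \<open>approximation\<close>), a chain of
  pushouts along embeddings into \<open>\<H>\<close>.  It yields the conditions on single triangles and, spliced with
  projective covers, those on mixed resolutions (\<open>dim_le_iff_mixed_resolution\<close>).  Finally \<open>\<H>\<close>-dimension
  and \<open>\<X>\<close>-dimension agree when the former is finite, because an object of \<open>\<X>\<close> with a finite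
  \<open>\<H>\<close>-resolution lies in \<open>\<H>\<close> (\<open>X_inter_finite_H_dim\<close>): the resolution splits.  This is where the
  closure properties of \<open>\<H>\<close> enter.
\<close>

section \<open>Additive categories\<close>

context additive_category
begin

text \<open>Bundling the three conditions keeps the side conditions of composition laws short.\<close>

definition arr :: "'m \<Rightarrow> 'o \<Rightarrow> 'o \<Rightarrow> bool" where
  "arr f A B \<longleftrightarrow> A \<in> Obj \<C> \<and> B \<in> Obj \<C> \<and> f \<in> mor \<C> A B"

abbreviation plus_mor :: "'m \<Rightarrow> 'o \<Rightarrow> 'o \<Rightarrow> 'm \<Rightarrow> 'm"  (\<open>(_ \<boxplus>\<^bsub>_,_\<^esub> _)\<close> [65, 0, 0, 66] 65) where
  "f \<boxplus>\<^bsub>A,B\<^esub> g \<equiv> f \<otimes>\<^bsub>Hom \<C> A B\<^esub> g"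

abbreviation zero_mor :: "'o \<Rightarrow> 'o \<Rightarrow> 'm" where
  "zero_mor A B \<equiv> \<one>\<^bsub>Hom \<C> A B\<^esub>"

abbreviation neg_mor :: "'o \<Rightarrow> 'o \<Rightarrow> 'm \<Rightarrow> 'm" where
  "neg_mor A B f \<equiv> inv\<^bsub>Hom \<C> A B\<^esub> f"

lemma arrI: "A \<in> Obj \<C> \<Longrightarrow> B \<in> Obj \<C> \<Longrightarrow> f \<in> mor \<C> A B \<Longrightarrow> arr f A B"
  by (simp add: arr_def)

lemma arrD: "arr f A B \<Longrightarrow> A \<in> Obj \<C> \<and> B \<in> Obj \<C> \<and> f \<in> mor \<C> A B"
  by (simp add: arr_def)

lemma comp_arr: "arr f A B \<Longrightarrow> arr g B C \<Longrightarrow> arr (g \<bullet> f) A C"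
  by (auto simp: arr_def intro: Comp_closed)

lemma comp_assoc: "arr f A B \<Longrightarrow> arr g B C \<Longrightarrow> arr h C D \<Longrightarrow> (h \<bullet> g) \<bullet> f = h \<bullet> (g \<bullet> f)"
  by (auto simp: arr_def intro: Comp_assoc)

lemma id_arr: "A \<in> Obj \<C> \<Longrightarrow> arr (Ident \<C> A) A A"
  by (simp add: arr_def Ident_closed)

lemma comp_id: "arr f A B \<Longrightarrow> f \<bullet> Ident \<C> A = f"
  by (auto simp: arr_def intro: Ident_right)

lemma id_comp: "arr f A B \<Longrightarrow> Ident \<C> B \<bullet> f = f"
  by (auto simp: arr_def intro: Ident_left)

lemma Hom_group: "arr f A B \<Longrightarrow> comm_group (Hom \<C> A B)"
  by (auto simp: arr_def intro: Hom_comm_group)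

lemma zero_arr: "A \<in> Obj \<C> \<Longrightarrow> B \<in> Obj \<C> \<Longrightarrow> arr (zero_mor A B) A B"
  by (simp add: arr_def Hom_comm_group comm_groupE(2))

lemma add_arr: "arr f A B \<Longrightarrow> arr g A B \<Longrightarrow> arr (f \<boxplus>\<^bsub>A,B\<^esub> g) A B"
  by (auto simp: arr_def Hom_comm_group comm_groupE(1))

lemma neg_arr: "arr f A B \<Longrightarrow> arr (neg_mor A B f) A B"
  by (auto simp: arr_def Hom_comm_group comm_group.axioms(2) group.inv_closed)

lemma add_assoc:
  "arr f A B \<Longrightarrow> arr g A B \<Longrightarrow> arr h A B \<Longrightarrow>
     (f \<boxplus>\<^bsub>A,B\<^esub> g) \<boxplus>\<^bsub>A,B\<^esub> h = f \<boxplus>\<^bsub>A,B\<^esub> (g \<boxplus>\<^bsub>A,B\<^esub> h)"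
  by (auto simp: arr_def Hom_comm_group comm_groupE(3))

lemma add_comm: "arr f A B \<Longrightarrow> arr g A B \<Longrightarrow> f \<boxplus>\<^bsub>A,B\<^esub> g = g \<boxplus>\<^bsub>A,B\<^esub> f"
  by (auto simp: arr_def Hom_comm_group comm_groupE(4))

lemma zero_add: "arr f A B \<Longrightarrow> zero_mor A B \<boxplus>\<^bsub>A,B\<^esub> f = f"
  by (auto simp: arr_def Hom_comm_group comm_groupE(5))

lemma add_zero: "arr f A B \<Longrightarrow> f \<boxplus>\<^bsub>A,B\<^esub> zero_mor A B = f"
  by (metis arrD zero_arr zero_add add_comm)

lemma neg_add: "arr f A B \<Longrightarrow> neg_mor A B f \<boxplus>\<^bsub>A,B\<^esub> f = zero_mor A B"
  by (auto simp: arr_def Hom_comm_group comm_group.axioms(2) group.l_inv)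

lemma add_neg: "arr f A B \<Longrightarrow> f \<boxplus>\<^bsub>A,B\<^esub> neg_mor A B f = zero_mor A B"
  by (auto simp: arr_def Hom_comm_group comm_group.axioms(2) group.r_inv)

lemma add_cancel:
  assumes "arr f A B" "arr g A B" "arr h A B" "f \<boxplus>\<^bsub>A,B\<^esub> h = g \<boxplus>\<^bsub>A,B\<^esub> h"
  shows "f = g"
  using assms group.right_cancel[OF comm_group.axioms(2), OF Hom_group[OF assms(1)]]
  by (auto simp: arr_def)

lemma add_middle:
  assumes "arr a A B" "arr b A B" "arr c A B" "arr d A B"
  shows "(a \<boxplus>\<^bsub>A,B\<^esub> b) \<boxplus>\<^bsub>A,B\<^esub> (c \<boxplus>\<^bsub>A,B\<^esub> d) = (a \<boxplus>\<^bsub>A,B\<^esub> c) \<boxplus>\<^bsub>A,B\<^esub> (b \<boxplus>\<^bsub>A,B\<^esub> d)"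
  using assms by (metis add_arr add_assoc add_comm)

lemma comp_add:
  "arr f A B \<Longrightarrow> arr f' A B \<Longrightarrow> arr g B C \<Longrightarrow>
     g \<bullet> (f \<boxplus>\<^bsub>A,B\<^esub> f') = (g \<bullet> f) \<boxplus>\<^bsub>A,C\<^esub> (g \<bullet> f')"
  by (auto simp: arr_def intro: Comp_add_right)

lemma add_comp:
  "arr f A B \<Longrightarrow> arr g B C \<Longrightarrow> arr g' B C \<Longrightarrow>
     (g \<boxplus>\<^bsub>B,C\<^esub> g') \<bullet> f = (g \<bullet> f) \<boxplus>\<^bsub>A,C\<^esub> (g' \<bullet> f)"
  by (auto simp: arr_def intro: Comp_add_left)

lemma comp_zero:
  assumes "arr g B C" "A \<in> Obj \<C>" shows "g \<bullet> zero_mor A B = zero_mor A C"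
proof -
  have z: "arr (zero_mor A B) A B" using assms arrD zero_arr by blast
  have gz: "arr (g \<bullet> zero_mor A B) A C" using comp_arr z assms(1) by blast
  have "(g \<bullet> zero_mor A B) \<boxplus>\<^bsub>A,C\<^esub> (g \<bullet> zero_mor A B) = zero_mor A C \<boxplus>\<^bsub>A,C\<^esub> (g \<bullet> zero_mor A B)"
    using comp_add[OF z z assms(1)] zero_add[OF z] zero_add[OF gz] by simp
  then show ?thesis
    using add_cancel gz zero_arr arrD[OF gz] by blast
qed

lemma zero_comp:
  assumes "arr f A B" "C \<in> Obj \<C>" shows "zero_mor B C \<bullet> f = zero_mor A C"
proof -
  have z: "arr (zero_mor B C) B C" using assms arrD zero_arr by blast
  have zf: "arr (zero_mor B C \<bullet> f) A C" using comp_arr z assms(1) by blast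
  have "(zero_mor B C \<bullet> f) \<boxplus>\<^bsub>A,C\<^esub> (zero_mor B C \<bullet> f) = zero_mor A C \<boxplus>\<^bsub>A,C\<^esub> (zero_mor B C \<bullet> f)"
    using add_comp[OF assms(1) z z] zero_add[OF z] zero_add[OF zf] by simp
  then show ?thesis
    using add_cancel zf zero_arr arrD[OF zf] by blast
qed

lemma comp_neg:
  assumes "arr f A B" "arr g B C" shows "g \<bullet> neg_mor A B f = neg_mor A C (g \<bullet> f)"
proof -
  have n: "arr (neg_mor A B f) A B" using neg_arr assms by blast
  have gf: "arr (g \<bullet> f) A C" "arr (g \<bullet> neg_mor A B f) A C" using comp_arr n assms by blast+
  have "(g \<bullet> neg_mor A B f) \<boxplus>\<^bsub>A,C\<^esub> (g \<bullet> f) = g \<bullet> zero_mor A B"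
    using comp_add[OF n assms(1,2)] neg_add[OF assms(1)] by simp
  also have "\<dots> = neg_mor A C (g \<bullet> f) \<boxplus>\<^bsub>A,C\<^esub> (g \<bullet> f)"
    using comp_zero assms arrD neg_add[OF gf(1)] by metis
  finally show ?thesis using add_cancel gf neg_arr by blast
qed

lemma comp3_zero:
  assumes "arr f A B" "arr g B C" "arr h C D" "h \<bullet> g = zero_mor B D"
  shows "h \<bullet> (g \<bullet> f) = zero_mor A D"
  using assms by (metis comp_assoc zero_comp arrD)

lemma zero_objectD: "zero_object \<C> Z \<Longrightarrow> Z \<in> Obj \<C>"
  by (simp add: zero_object_def)

lemma to_zero: "zero_object \<C> Z \<Longrightarrow> arr f A Z \<Longrightarrow> f = zero_mor A Z"
  by (auto simp: zero_object_def arr_def trivial_group_def)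

lemma from_zero: "zero_object \<C> Z \<Longrightarrow> arr f Z A \<Longrightarrow> f = zero_mor Z A"
  by (auto simp: zero_object_def arr_def trivial_group_def)

lemma isoD:
  assumes "iso_mor \<C> A B f" "A \<in> Obj \<C>" "B \<in> Obj \<C>"
  obtains g where "arr f A B" "arr g B A" "g \<bullet> f = Ident \<C> A" "f \<bullet> g = Ident \<C> B"
  using assms by (auto simp: iso_mor_def arr_def)

lemma isoI:
  assumes "arr f A B" "arr g B A" "g \<bullet> f = Ident \<C> A" "f \<bullet> g = Ident \<C> B"
  shows "iso_mor \<C> A B f"
  using assms by (auto simp: iso_mor_def arr_def)

lemma biproductD:
  assumes "biproduct \<C> A B S i j p q"
  shows "A \<in> Obj \<C>" "B \<in> Obj \<C>" "S \<in> Obj \<C>" "arr i A S" "arr j B S" "arr p S A" "arr q S B"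
    "p \<bullet> i = Ident \<C> A" "q \<bullet> j = Ident \<C> B" "q \<bullet> i = zero_mor A B" "p \<bullet> j = zero_mor B A"
    "(i \<bullet> p) \<boxplus>\<^bsub>S,S\<^esub> (j \<bullet> q) = Ident \<C> S"
  using assms by (auto simp: biproduct_def arr_def)

lemma biproduct_swap:
  assumes "biproduct \<C> A B S i j p q" shows "biproduct \<C> B A S j i q p"
  using assms biproductD[OF assms] add_comm[of "i \<bullet> p" S S "j \<bullet> q"] comp_arr
  unfolding biproduct_def by metis

lemma biproduct_zero_left:
  assumes "zero_object \<C> Z" "A \<in> Obj \<C>"
  shows "biproduct \<C> Z A A (zero_mor Z A) (Ident \<C> A) (zero_mor A Z) (Ident \<C> A)"
proof -
  have Z: "Z \<in> Obj \<C>" using assms zero_objectD by blast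
  note a = id_arr[OF assms(2)] zero_arr[OF Z assms(2)] zero_arr[OF assms(2) Z] id_arr[OF Z]
  have "zero_mor A Z \<bullet> zero_mor Z A = Ident \<C> Z"
    using from_zero[OF assms(1)] a comp_arr by metis
  moreover have "(zero_mor Z A \<bullet> zero_mor A Z) = zero_mor A A"
    using comp_zero a assms by blast
  ultimately show ?thesis
    using a Z assms comp_id[OF a(1)] comp_id[OF a(3)] id_comp[OF a(2)] zero_add[OF a(1)]
    by (simp add: biproduct_def arr_def)
qed

lemma biproduct_transport:
  assumes S: "biproduct \<C> A B S i j p q" and f: "arr f S T" "arr g T S"
    and "g \<bullet> f = Ident \<C> S" "f \<bullet> g = Ident \<C> T"
  shows "biproduct \<C> A B T (f \<bullet> i) (f \<bullet> j) (p \<bullet> g) (q \<bullet> g)"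
proof -
  note b = biproductD[OF S]
  have T: "T \<in> Obj \<C>" using f arrD by blast
  have c: "(u \<bullet> g) \<bullet> (f \<bullet> v) = u \<bullet> v" if "arr u S U" "arr v V S" for u v U V
    using comp_assoc[OF comp_arr[OF that(2) f(1)] f(2) that(1)]
      comp_assoc[OF that(2) f(1,2)] assms(4) id_comp[OF that(2)] by simp
  have ip: "arr (i \<bullet> p) S S" "arr (j \<bullet> q) S S" using b comp_arr by blast+
  have d: "(f \<bullet> v) \<bullet> (u \<bullet> g) = f \<bullet> ((v \<bullet> u) \<bullet> g)" if "arr u S U" "arr v U S" for u v U
    using comp_assoc[OF comp_arr[OF f(2) that(1)] that(2) f(1)] comp_assoc[OF f(2) that] by simp
  have "((f \<bullet> i) \<bullet> (p \<bullet> g)) \<boxplus>\<^bsub>T,T\<^esub> ((f \<bullet> j) \<bullet> (q \<bullet> g))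
      = f \<bullet> (((i \<bullet> p) \<boxplus>\<^bsub>S,S\<^esub> (j \<bullet> q)) \<bullet> g)"
    using d[OF b(6,4)] d[OF b(7,5)] add_comp[OF f(2) ip]
      comp_add[OF comp_arr[OF f(2) ip(1)] comp_arr[OF f(2) ip(2)] f(1)] by simp
  also have "\<dots> = Ident \<C> T" using b(12) id_comp[OF f(2)] assms by simp
  finally show ?thesis
    using b T c[OF b(6,4)] c[OF b(7,5)] c[OF b(7,4)] c[OF b(6,5)]
      comp_arr[OF b(4) f(1)] comp_arr[OF b(5) f(1)] comp_arr[OF f(2) b(6)] comp_arr[OF f(2) b(7)]
    by (simp add: biproduct_def arr_def)
qed

end


section \<open>Extriangulated categories\<close>

lemma (in additive_category) equiv_seq_equiv:
  assumes "A \<in> Obj \<C>" "C \<in> Obj \<C>"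
  shows "equiv (sequences \<C> A C) (seq_equiv \<C> A C)"
proof (rule equivI)
  show "seq_equiv \<C> A C \<subseteq> sequences \<C> A C \<times> sequences \<C> A C"
    by (auto simp: seq_equiv_def)
  show "refl_on (sequences \<C> A C) (seq_equiv \<C> A C)"
  proof (rule refl_onI)
    fix s assume s: "s \<in> sequences \<C> A C"
    obtain x B y where e: "s = (x, B, y)" by (cases s)
    have a: "arr x A B" "arr y B C" "B \<in> Obj \<C>" using s e assms by (auto simp: sequences_def arr_def)
    have "iso_mor \<C> B B (Ident \<C> B)" by (meson a comp_id id_arr isoI)
    then show "(s, s) \<in> seq_equiv \<C> A C"
      using s e comp_id[OF a(2)] id_comp[OF a(1)] by (auto simp: seq_equiv_def)
  qed
  show "sym (seq_equiv \<C> A C)"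
  proof (rule symI)
    fix s t assume st: "(s, t) \<in> seq_equiv \<C> A C"
    obtain x B y x' B' y' b where e: "s = (x, B, y)" "t = (x', B', y')"
      and b: "iso_mor \<C> B B' b" "b \<bullet> x = x'" "y' \<bullet> b = y"
      using st unfolding seq_equiv_def by blast
    have a: "arr x A B" "arr y B C" "arr x' A B'" "arr y' B' C" "B \<in> Obj \<C>" "B' \<in> Obj \<C>"
      using st e assms by (auto simp: seq_equiv_def sequences_def arr_def)
    obtain g where g: "arr b B B'" "arr g B' B" "g \<bullet> b = Ident \<C> B" "b \<bullet> g = Ident \<C> B'"
      using isoD[OF b(1) a(5,6)] by blast
    have "g \<bullet> x' = x" "y \<bullet> g = y'"
      using b g comp_assoc[OF a(1) g(1,2)] id_comp[OF a(1)]
        comp_assoc[OF g(2,1) a(4)] comp_id[OF a(4)] by auto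
    moreover have "iso_mor \<C> B' B g" using g isoI by blast
    ultimately show "(t, s) \<in> seq_equiv \<C> A C" using st e by (auto simp: seq_equiv_def)
  qed
  show "trans (seq_equiv \<C> A C)"
  proof (rule transI)
    fix s t u assume st: "(s, t) \<in> seq_equiv \<C> A C" and tu: "(t, u) \<in> seq_equiv \<C> A C"
    obtain x B y x' B' y' b where e: "s = (x, B, y)" "t = (x', B', y')"
      and b: "iso_mor \<C> B B' b" "b \<bullet> x = x'" "y' \<bullet> b = y"
      using st unfolding seq_equiv_def by blast
    obtain x'' B'' y'' c where e': "u = (x'', B'', y'')"
      and c: "iso_mor \<C> B' B'' c" "c \<bullet> x' = x''" "y'' \<bullet> c = y'"
      using tu e unfolding seq_equiv_def by blast
    have a: "arr x A B" "arr y B C" "arr x' A B'" "arr y' B' C" "arr x'' A B''" "arr y'' B'' C"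
        "B \<in> Obj \<C>" "B' \<in> Obj \<C>" "B'' \<in> Obj \<C>"
      using st tu e e' assms by (auto simp: seq_equiv_def sequences_def arr_def)
    obtain g where g: "arr b B B'" "arr g B' B" "g \<bullet> b = Ident \<C> B" "b \<bullet> g = Ident \<C> B'"
      using isoD[OF b(1) a(7,8)] by blast
    obtain h where h: "arr c B' B''" "arr h B'' B'" "h \<bullet> c = Ident \<C> B'" "c \<bullet> h = Ident \<C> B''"
      using isoD[OF c(1) a(8,9)] by blast
    have "h \<bullet> (c \<bullet> b) = b" "b \<bullet> (g \<bullet> h) = h"
      using comp_assoc[OF g(1) h(1,2)] comp_assoc[OF h(2) g(2,1)] g h id_comp[OF g(1)] id_comp[OF h(2)]
      by simp_all
    then have "(g \<bullet> h) \<bullet> (c \<bullet> b) = Ident \<C> B" "(c \<bullet> b) \<bullet> (g \<bullet> h) = Ident \<C> B''"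
      using comp_assoc[OF comp_arr[OF g(1) h(1)] h(2) g(2)]
        comp_assoc[OF comp_arr[OF h(2) g(2)] g(1) h(1)] g h by simp_all
    then have "iso_mor \<C> B B'' (c \<bullet> b)" by (meson comp_arr g h isoI)
    moreover have "(c \<bullet> b) \<bullet> x = x''" "y'' \<bullet> (c \<bullet> b) = y"
      using b c a g h by (metis comp_assoc)+
    ultimately show "(s, u) \<in> seq_equiv \<C> A C" using st tu e e' by (auto simp: seq_equiv_def)
  qed
qed

context extriangulated_category
begin

lemma etriangleD:
  assumes "(A, x, B, y, C, \<delta>) \<in> etriangles \<C>"
  shows "arr x A B" "arr y B C" "\<delta> \<in> carrier (EE \<C> C A)"
    "A \<in> Obj \<C>" "B \<in> Obj \<C>" "C \<in> Obj \<C>"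
proof -
  have *: "A \<in> Obj \<C>" "C \<in> Obj \<C>" "\<delta> \<in> carrier (EE \<C> C A)" "(x, B, y) \<in> rlz \<C> C A \<delta>"
    using assms by (auto simp: etriangles_def)
  have "(x, B, y) \<in> sequences \<C> A C"
    using in_quotient_imp_subset[OF equiv_seq_equiv rlz_class] * by blast
  then show "arr x A B" "arr y B C" "\<delta> \<in> carrier (EE \<C> C A)"
    "A \<in> Obj \<C>" "B \<in> Obj \<C>" "C \<in> Obj \<C>"
    using * by (auto simp: sequences_def arr_def)
qed

lemma etriangle_exists:
  assumes "C \<in> Obj \<C>" "A \<in> Obj \<C>" "\<delta> \<in> carrier (EE \<C> C A)"
  obtains x B y where "(A, x, B, y, C, \<delta>) \<in> etriangles \<C>"
proof -
  have "rlz \<C> C A \<delta> \<noteq> {}"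
    using in_quotient_imp_non_empty[OF equiv_seq_equiv rlz_class] assms by blast
  then obtain s where "s \<in> rlz \<C> C A \<delta>" by blast
  then show ?thesis using that assms by (cases s) (auto simp: etriangles_def)
qed

lemma etriangle_unique:
  assumes "(A, x, B, y, C, \<delta>) \<in> etriangles \<C>" "(A, x', B', y', C, \<delta>) \<in> etriangles \<C>"
  obtains b b' where "arr b B B'" "arr b' B' B" "b' \<bullet> b = Ident \<C> B" "b \<bullet> b' = Ident \<C> B'"
    "b \<bullet> x = x'" "y' \<bullet> b = y"
proof -
  note a = etriangleD[OF assms(1)] and a' = etriangleD[OF assms(2)]
  have "{(x, B, y), (x', B', y')} \<subseteq> rlz \<C> C A \<delta>" using assms by (auto simp: etriangles_def)
  then have "((x, B, y), (x', B', y')) \<in> seq_equiv \<C> A C"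
    using in_quotient_imp_in_rel[OF equiv_seq_equiv rlz_class] a by blast
  then obtain b where b: "iso_mor \<C> B B' b" "b \<bullet> x = x'" "y' \<bullet> b = y"
    unfolding seq_equiv_def by blast
  show ?thesis using isoD[OF b(1) a(5) a'(5)] b that by metis
qed

lemma etriangle_equiv:
  assumes t: "(A, x, B, y, C, \<delta>) \<in> etriangles \<C>"
    and b: "arr b B B'" "arr b' B' B" "b' \<bullet> b = Ident \<C> B" "b \<bullet> b' = Ident \<C> B'"
    and "arr x' A B'" "arr y' B' C" "b \<bullet> x = x'" "y' \<bullet> b = y"
  shows "(A, x', B', y', C, \<delta>) \<in> etriangles \<C>"
proof -
  note a = etriangleD[OF t]
  have "((x, B, y), (x', B', y')) \<in> seq_equiv \<C> A C"
    using a assms isoI[OF b] by (auto simp: seq_equiv_def sequences_def arr_def)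
  then have "(x', B', y') \<in> rlz \<C> C A \<delta>"
    using in_quotient_imp_closed[OF equiv_seq_equiv rlz_class] a t by (auto simp: etriangles_def)
  then show ?thesis using a by (simp add: etriangles_def)
qed

lemma push_closed:
  "arr a A A' \<Longrightarrow> C \<in> Obj \<C> \<Longrightarrow> \<delta> \<in> carrier (EE \<C> C A) \<Longrightarrow> push \<C> a \<delta> \<in> carrier (EE \<C> C A')"
  using push_hom unfolding arr_def hom_def by blast

lemma pull_closed:
  "arr c C' C \<Longrightarrow> A \<in> Obj \<C> \<Longrightarrow> \<delta> \<in> carrier (EE \<C> C A) \<Longrightarrow> pull \<C> c \<delta> \<in> carrier (EE \<C> C' A)"
  using pull_hom unfolding arr_def hom_def by blast

lemma push_mult:
  "arr a A A' \<Longrightarrow> C \<in> Obj \<C> \<Longrightarrow> \<delta> \<in> carrier (EE \<C> C A) \<Longrightarrow> \<epsilon> \<in> carrier (EE \<C> C A) \<Longrightarrow>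
    push \<C> a (\<delta> \<otimes>\<^bsub>EE \<C> C A\<^esub> \<epsilon>) = push \<C> a \<delta> \<otimes>\<^bsub>EE \<C> C A'\<^esub> push \<C> a \<epsilon>"
  by (meson arrD push_hom hom_mult)

lemma pull_mult:
  "arr c C' C \<Longrightarrow> A \<in> Obj \<C> \<Longrightarrow> \<delta> \<in> carrier (EE \<C> C A) \<Longrightarrow> \<epsilon> \<in> carrier (EE \<C> C A) \<Longrightarrow>
    pull \<C> c (\<delta> \<otimes>\<^bsub>EE \<C> C A\<^esub> \<epsilon>) = pull \<C> c \<delta> \<otimes>\<^bsub>EE \<C> C' A\<^esub> pull \<C> c \<epsilon>"
  by (meson arrD pull_hom hom_mult)

lemma EE_one: "C \<in> Obj \<C> \<Longrightarrow> A \<in> Obj \<C> \<Longrightarrow> \<one>\<^bsub>EE \<C> C A\<^esub> \<in> carrier (EE \<C> C A)"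
  by (simp add: EE_comm_group comm_groupE(2))

lemma push_one: "arr a A A' \<Longrightarrow> C \<in> Obj \<C> \<Longrightarrow> push \<C> a \<one>\<^bsub>EE \<C> C A\<^esub> = \<one>\<^bsub>EE \<C> C A'\<^esub>"
  by (meson EE_comm_group arrD comm_group.axioms(2) hom_one push_hom)

lemma pull_one: "arr c C' C \<Longrightarrow> A \<in> Obj \<C> \<Longrightarrow> pull \<C> c \<one>\<^bsub>EE \<C> C A\<^esub> = \<one>\<^bsub>EE \<C> C' A\<^esub>"
  by (meson EE_comm_group arrD comm_group.axioms(2) hom_one pull_hom)

lemma push_comp:
  "arr a A A' \<Longrightarrow> arr a' A' A'' \<Longrightarrow> C \<in> Obj \<C> \<Longrightarrow> \<delta> \<in> carrier (EE \<C> C A) \<Longrightarrow>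
    push \<C> (a' \<bullet> a) \<delta> = push \<C> a' (push \<C> a \<delta>)"
  by (meson arrD push_Comp)

lemma pull_comp:
  "arr c C' C \<Longrightarrow> arr c' C'' C' \<Longrightarrow> A \<in> Obj \<C> \<Longrightarrow> \<delta> \<in> carrier (EE \<C> C A) \<Longrightarrow>
    pull \<C> (c \<bullet> c') \<delta> = pull \<C> c' (pull \<C> c \<delta>)"
  by (meson arrD pull_Comp)

lemma push_pull_comm:
  "arr a A A' \<Longrightarrow> arr c C' C \<Longrightarrow> \<delta> \<in> carrier (EE \<C> C A) \<Longrightarrow>
    push \<C> a (pull \<C> c \<delta>) = pull \<C> c (push \<C> a \<delta>)"
  by (meson arrD push_pull)

lemma square_one_is_one:
  assumes "comm_group G" "x \<in> carrier G" "x = x \<otimes>\<^bsub>G\<^esub> x" shows "x = \<one>\<^bsub>G\<^esub>"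
  by (metis assms comm_group.axioms(2) group.l_cancel_one')

lemma push_zero:
  assumes "A \<in> Obj \<C>" "A' \<in> Obj \<C>" "C \<in> Obj \<C>" "\<delta> \<in> carrier (EE \<C> C A)"
  shows "push \<C> (zero_mor A A') \<delta> = \<one>\<^bsub>EE \<C> C A'\<^esub>"
proof (rule square_one_is_one)
  note z = zero_arr[OF assms(1,2)]
  show "comm_group (EE \<C> C A')" using EE_comm_group assms by blast
  show "push \<C> (zero_mor A A') \<delta> \<in> carrier (EE \<C> C A')" using push_closed z assms by blast
  show "push \<C> (zero_mor A A') \<delta> = push \<C> (zero_mor A A') \<delta> \<otimes>\<^bsub>EE \<C> C A'\<^esub> push \<C> (zero_mor A A') \<delta>"
    using push_add[OF assms(3,1,2,4)] z zero_add[OF z] by (metis arrD)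
qed

lemma pull_zero:
  assumes "C \<in> Obj \<C>" "C' \<in> Obj \<C>" "A \<in> Obj \<C>" "\<delta> \<in> carrier (EE \<C> C A)"
  shows "pull \<C> (zero_mor C' C) \<delta> = \<one>\<^bsub>EE \<C> C' A\<^esub>"
proof (rule square_one_is_one)
  note z = zero_arr[OF assms(2,1)]
  show "comm_group (EE \<C> C' A)" using EE_comm_group assms by blast
  show "pull \<C> (zero_mor C' C) \<delta> \<in> carrier (EE \<C> C' A)" using pull_closed z assms by blast
  show "pull \<C> (zero_mor C' C) \<delta> = pull \<C> (zero_mor C' C) \<delta> \<otimes>\<^bsub>EE \<C> C' A\<^esub> pull \<C> (zero_mor C' C) \<delta>"
    using pull_add[OF assms(1,2,3,4)] z zero_add[OF z] by (metis arrD)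
qed

lemma etriangle_id_zero:
  assumes "zero_object \<C> Z" "A \<in> Obj \<C>"
  shows "(A, Ident \<C> A, A, zero_mor A Z, Z, \<one>\<^bsub>EE \<C> Z A\<^esub>) \<in> etriangles \<C>"
  using rlz_zero[OF biproduct_swap[OF biproduct_zero_left[OF assms]]] .

lemma etriangle_zero_id:
  assumes "zero_object \<C> Z" "A \<in> Obj \<C>"
  shows "(Z, zero_mor Z A, A, Ident \<C> A, A, \<one>\<^bsub>EE \<C> A Z\<^esub>) \<in> etriangles \<C>"
  using rlz_zero[OF biproduct_zero_left[OF assms]] .

text \<open>Compare with \<open>B \<rightarrow> B \<rightarrow> 0\<close>, whose extension is zero.\<close>

lemma push_inflation:
  assumes t: "(A, x, B, y, C, \<delta>) \<in> etriangles \<C>"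
  shows "push \<C> x \<delta> = \<one>\<^bsub>EE \<C> C B\<^esub>"
proof -
  note a = etriangleD[OF t]
  obtain Z where Z: "zero_object \<C> Z" using ex_zero_object by blast
  obtain c where c: "c \<in> mor \<C> C Z" "push \<C> x \<delta> = pull \<C> c \<one>\<^bsub>EE \<C> Z B\<^esub>"
    using ET3[OF t etriangle_id_zero[OF Z a(5)], of x "Ident \<C> B"] a arrD[OF a(1)] arrD[OF id_arr[OF a(5)]]
    by auto
  then show ?thesis using pull_one[of c C Z B] a zero_objectD[OF Z] by (simp add: arr_def)
qed

lemma pull_deflation:
  assumes t: "(A, x, B, y, C, \<delta>) \<in> etriangles \<C>"
  shows "pull \<C> y \<delta> = \<one>\<^bsub>EE \<C> B A\<^esub>"
proof -
  note a = etriangleD[OF t]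
  obtain Z where Z: "zero_object \<C> Z" using ex_zero_object by blast
  obtain c where c: "c \<in> mor \<C> Z A" "push \<C> c \<one>\<^bsub>EE \<C> B Z\<^esub> = pull \<C> y \<delta>"
    using ET3_op[OF etriangle_zero_id[OF Z a(5)] t, of "Ident \<C> B" y] a arrD[OF a(2)] arrD[OF id_arr[OF a(5)]]
    by auto
  then show ?thesis using push_one[of c Z A B] a zero_objectD[OF Z] by (simp add: arr_def)
qed

lemma comp_inflation_deflation:
  assumes t: "(A, x, B, y, C, \<delta>) \<in> etriangles \<C>"
  shows "y \<bullet> x = zero_mor A C"
proof -
  note a = etriangleD[OF t]
  obtain Z where Z: "zero_object \<C> Z" using ex_zero_object by blast
  obtain c where c: "c \<in> mor \<C> Z C" "y \<bullet> x = c \<bullet> zero_mor A Z"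
    using ET3[OF etriangle_id_zero[OF Z a(4)] t, of "Ident \<C> A" x] a arrD[OF a(1)] arrD[OF id_arr[OF a(4)]]
    by auto
  then show ?thesis using comp_zero[of c Z C A] a zero_objectD[OF Z] by (simp add: arr_def)
qed

text \<open>Compare \<open>Q \<rightarrow> Q \<rightarrow> 0\<close> with the given triangle: an inflation is a weak kernel of the deflation.\<close>

lemma weak_kernel:
  assumes t: "(A, x, B, y, C, \<delta>) \<in> etriangles \<C>" and w: "arr w Q B" "y \<bullet> w = zero_mor Q C"
  obtains a where "arr a Q A" "w = x \<bullet> a"
proof -
  note a = etriangleD[OF t]
  have Q: "Q \<in> Obj \<C>" using w arrD by blast
  obtain Z where Z: "zero_object \<C> Z" using ex_zero_object by blast
  have z: "arr (zero_mor Z C) Z C" using zero_arr a zero_objectD[OF Z] by blast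
  have "zero_mor Z C \<bullet> zero_mor Q Z = zero_mor Q C" using comp_zero z Q by blast
  then obtain c where c: "c \<in> mor \<C> Q A" "w \<bullet> Ident \<C> Q = x \<bullet> c"
    using ET3_op[OF etriangle_id_zero[OF Z Q] t, of w "zero_mor Z C"] w arrD[OF w(1)] arrD[OF z]
    by auto
  then show ?thesis using that a Q comp_id[OF w(1)] by (simp add: arr_def)
qed

text \<open>This form of the weak kernel property keeps subtraction out of later computations.\<close>

lemma weak_kernel_diff:
  assumes t: "(A, x, B, y, C, \<delta>) \<in> etriangles \<C>" and b: "arr b Q B" "arr b' Q B" "y \<bullet> b = y \<bullet> b'"
  obtains a where "arr a Q A" "b = (x \<bullet> a) \<boxplus>\<^bsub>Q,B\<^esub> b'"
proof -
  note a = etriangleD[OF t]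
  define w where "w = b \<boxplus>\<^bsub>Q,B\<^esub> neg_mor Q B b'"
  note n = neg_arr[OF b(2)]
  have w: "arr w Q B" unfolding w_def using add_arr b n by blast
  have "y \<bullet> w = (y \<bullet> b) \<boxplus>\<^bsub>Q,C\<^esub> neg_mor Q C (y \<bullet> b')"
    unfolding w_def using comp_add[OF b(1) n a(2)] comp_neg[OF b(2) a(2)] by simp
  then have "y \<bullet> w = zero_mor Q C" using b add_neg comp_arr[OF b(2) a(2)] by simp
  then obtain k where k: "arr k Q A" "w = x \<bullet> k" using weak_kernel[OF t w] by blast
  have "w \<boxplus>\<^bsub>Q,B\<^esub> b' = b" unfolding w_def
    using add_assoc[OF b(1) n b(2)] neg_add[OF b(2)] add_zero[OF b(1)] by simp
  then show ?thesis using that k by metis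
qed

text \<open>The endomorphism is \<open>1 + u\<close> with \<open>u = x \<bullet> h\<close> and \<open>u \<bullet> u = 0\<close>.\<close>

lemma endomorphism_inverse:
  assumes t: "(A, x, B, y, C, \<delta>) \<in> etriangles \<C>" and b: "arr b B B" "b \<bullet> x = x" "y \<bullet> b = y"
  obtains b' where "arr b' B B" "b' \<bullet> b = Ident \<C> B" "b \<bullet> b' = Ident \<C> B"
proof -
  note a = etriangleD[OF t]
  let ?I = "Ident \<C> B" let ?O = "zero_mor B B"
  note i = id_arr[OF a(5)]
  obtain h where h: "arr h B A" "b = (x \<bullet> h) \<boxplus>\<^bsub>B,B\<^esub> ?I"
    using weak_kernel_diff[OF t b(1) i] b comp_id[OF a(2)] by metis
  define u where "u = x \<bullet> h"
  have u: "arr u B B" unfolding u_def using h a comp_arr by blast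
  have bu: "b = u \<boxplus>\<^bsub>B,B\<^esub> ?I" using h u_def by simp
  have "(u \<bullet> x) \<boxplus>\<^bsub>A,B\<^esub> x = zero_mor A B \<boxplus>\<^bsub>A,B\<^esub> x"
    using add_comp[OF a(1) u i] bu b id_comp[OF a(1)] zero_add[OF a(1)] by simp
  then have "u \<bullet> x = zero_mor A B"
    using add_cancel comp_arr[OF a(1) u] zero_arr a by blast
  then have uu: "u \<bullet> u = ?O"
    using comp3_zero[OF h(1) a(1) u] by (simp add: u_def)
  define v where "v = neg_mor B B u \<boxplus>\<^bsub>B,B\<^esub> ?I"
  note nu = neg_arr[OF u]
  have v: "arr v B B" unfolding v_def using add_arr i nu by blast
  have z: "neg_mor B B ?O = ?O"
    using a(5) Hom_comm_group by (metis comm_group.axioms(2) group.is_monoid monoid.inv_one)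
  have uv: "u \<bullet> v = u"
    unfolding v_def using comp_add[OF nu i u] comp_neg[OF u u] uu z comp_id[OF u] zero_add[OF u] by simp
  have "?O = (u \<bullet> u) \<boxplus>\<^bsub>B,B\<^esub> (neg_mor B B u \<bullet> u)"
    using add_comp[OF u u nu] add_neg[OF u] zero_comp[OF u] a(5) by simp
  then have nuu: "neg_mor B B u \<bullet> u = ?O"
    using uu zero_add[OF comp_arr[OF u nu]] by simp
  have vu: "v \<bullet> u = u"
    unfolding v_def using add_comp[OF u nu i] nuu id_comp[OF u] zero_add[OF u] by simp
  have s: "u \<boxplus>\<^bsub>B,B\<^esub> v = ?I"
    unfolding v_def using add_assoc[OF u nu i] add_neg[OF u] zero_add[OF i] by simp
  have "b \<bullet> v = ?I" using bu add_comp[OF v u i] uv id_comp[OF v] s by simp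
  moreover have "v \<bullet> b = ?I" using bu comp_add[OF u i v] vu comp_id[OF v] s by simp
  ultimately show ?thesis using that v by blast
qed

text \<open>Realize the transported extension by any triangle.  The two isomorphisms of the ends extend to
  morphisms of triangles in both directions, and both composites are invertible by
  \<open>endomorphism_inverse\<close>.\<close>

lemma etriangle_iso_ends:
  assumes t: "(A, x, B, y, C, \<delta>) \<in> etriangles \<C>"
    and a: "arr a A A'" "arr a' A' A" "a' \<bullet> a = Ident \<C> A" "a \<bullet> a' = Ident \<C> A'"
    and c: "arr c C C'" "arr c' C' C" "c' \<bullet> c = Ident \<C> C" "c \<bullet> c' = Ident \<C> C'"
  shows "(A', x \<bullet> a', B, c \<bullet> y, C', push \<C> a (pull \<C> c' \<delta>)) \<in> etriangles \<C>"
proof -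
  note d = etriangleD[OF t]
  let ?\<epsilon> = "push \<C> a (pull \<C> c' \<delta>)"
  have ob: "A' \<in> Obj \<C>" "C' \<in> Obj \<C>" using a c arrD by blast+
  have p: "pull \<C> c' \<delta> \<in> carrier (EE \<C> C' A)" using pull_closed c d by blast
  have e: "?\<epsilon> \<in> carrier (EE \<C> C' A')" using push_closed a p ob by blast
  obtain x' B' y' where t': "(A', x', B', y', C', ?\<epsilon>) \<in> etriangles \<C>"
    using etriangle_exists[OF ob(2,1) e] by blast
  note d' = etriangleD[OF t']
  have "pull \<C> c ?\<epsilon> = push \<C> a (pull \<C> c (pull \<C> c' \<delta>))"
    using push_pull_comm[OF a(1) c(1) p] by simp
  also have "pull \<C> c (pull \<C> c' \<delta>) = \<delta>"
    using pull_comp[OF c(2,1) d(4,3)] c pull_Ident d by simp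
  finally have 1: "push \<C> a \<delta> = pull \<C> c ?\<epsilon>" by simp
  have 2: "push \<C> a' ?\<epsilon> = pull \<C> c' \<delta>"
    using push_comp[OF a(1,2) ob(2) p] a push_Ident[OF ob(2) d(4) p] by simp
  obtain b where b: "arr b B B'" "b \<bullet> x = x' \<bullet> a" "y' \<bullet> b = c \<bullet> y"
    using rlz_morphism[OF t t' _ _ 1] a c d d' by (auto simp: arr_def)
  obtain b' where b': "arr b' B' B" "b' \<bullet> x' = x \<bullet> a'" "y \<bullet> b' = c' \<bullet> y'"
    using rlz_morphism[OF t' t _ _ 2] a c d d' by (auto simp: arr_def)
  have "(b' \<bullet> b) \<bullet> x = x" "y \<bullet> (b' \<bullet> b) = y"
    using b b' a c comp_assoc[OF d(1) b(1) b'(1)] comp_assoc[OF a(1) d'(1) b'(1)]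
      comp_assoc[OF a(1,2) d(1)] comp_id[OF d(1)] comp_assoc[OF b(1) b'(1) d(2)]
      comp_assoc[OF b(1) d'(2) c(2)] comp_assoc[OF d(2) c(1,2)] id_comp[OF d(2)] by simp_all
  then obtain u where u: "arr u B B" "u \<bullet> (b' \<bullet> b) = Ident \<C> B"
    using endomorphism_inverse[OF t comp_arr[OF b(1) b'(1)]] by metis
  have "(b \<bullet> b') \<bullet> x' = x'" "y' \<bullet> (b \<bullet> b') = y'"
    using b b' a c comp_assoc[OF d'(1) b'(1) b(1)] comp_assoc[OF a(2) d(1) b(1)]
      comp_assoc[OF a(2,1) d'(1)] comp_id[OF d'(1)] comp_assoc[OF b'(1) b(1) d'(2)]
      comp_assoc[OF b'(1) d(2) c(1)] comp_assoc[OF d'(2) c(2,1)] id_comp[OF d'(2)] by simp_all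
  then obtain v where v: "arr v B' B'" "(b \<bullet> b') \<bullet> v = Ident \<C> B'"
    using endomorphism_inverse[OF t' comp_arr[OF b'(1) b(1)]] by metis
  have ub: "arr (u \<bullet> b') B' B" "arr (b' \<bullet> v) B' B" using comp_arr b' u v by blast+
  have l: "(u \<bullet> b') \<bullet> b = Ident \<C> B" "b \<bullet> (b' \<bullet> v) = Ident \<C> B'"
    using comp_assoc[OF b(1) b'(1) u(1)] comp_assoc[OF v(1) b'(1) b(1)] u v by simp_all
  have "u \<bullet> b' = b' \<bullet> v"
    using comp_assoc[OF ub(2) b(1) ub(1)] l comp_id[OF ub(1)] id_comp[OF ub(2)] by simp
  then have g: "arr (b' \<bullet> v) B' B" "(b' \<bullet> v) \<bullet> b = Ident \<C> B" "b \<bullet> (b' \<bullet> v) = Ident \<C> B'"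
    using ub l by auto
  have xx: "arr (x \<bullet> a') A' B" "arr (c \<bullet> y) B C'" using comp_arr a c d by blast+
  have "b \<bullet> (x \<bullet> a') = x'"
    using b(2) comp_assoc[OF a(2) d(1) b(1)] comp_assoc[OF a(2,1) d'(1)] a comp_id[OF d'(1)] by simp
  then have gx: "(b' \<bullet> v) \<bullet> x' = x \<bullet> a'"
    using comp_assoc[OF xx(1) b(1) g(1)] g id_comp[OF xx(1)] by simp
  have gy: "(c \<bullet> y) \<bullet> (b' \<bullet> v) = y'"
    using b(3) comp_assoc[OF g(1) b(1) d'(2)] g comp_id[OF d'(2)] by simp
  show ?thesis
    by (rule etriangle_equiv[OF t' g(1) b(1) g(3) g(2) xx gx gy])
qed

lemma split_biproduct:
  assumes t: "(A, x, B, y, C, \<one>\<^bsub>EE \<C> C A\<^esub>) \<in> etriangles \<C>"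
  obtains j p where "biproduct \<C> A C B x j p y"
proof -
  note a = etriangleD[OF t]
  obtain S i j p q where S: "biproduct \<C> A C S i j p q" using ex_biproduct a by blast
  obtain b b' where b: "arr b S B" "arr b' B S" "b' \<bullet> b = Ident \<C> S" "b \<bullet> b' = Ident \<C> B"
    "b \<bullet> i = x" "y \<bullet> b = q"
    using etriangle_unique[OF rlz_zero[OF S] t] by blast
  have "q \<bullet> b' = y" using b comp_assoc[OF b(2,1) a(2)] comp_id[OF a(2)] by simp
  then show ?thesis using biproduct_transport[OF S b(1-4)] b that by simp
qed

lemma split_swap:
  assumes t: "(A, x, B, y, C, \<one>\<^bsub>EE \<C> C A\<^esub>) \<in> etriangles \<C>"
  obtains j p where "(C, j, B, p, A, \<one>\<^bsub>EE \<C> A C\<^esub>) \<in> etriangles \<C>"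
  using split_biproduct[OF t] biproduct_swap rlz_zero by metis

lemma retraction_splits:
  assumes t: "(A, x, B, y, C, \<delta>) \<in> etriangles \<C>" and r: "arr r B A" "r \<bullet> x = Ident \<C> A"
  shows "\<delta> = \<one>\<^bsub>EE \<C> C A\<^esub>"
proof -
  note a = etriangleD[OF t]
  have "\<delta> = push \<C> r (push \<C> x \<delta>)" using push_comp[OF a(1) r(1) a(6,3)] r push_Ident a by simp
  then show ?thesis using push_inflation[OF t] push_one r a by simp
qed

lemma section_splits:
  assumes t: "(A, x, B, y, C, \<delta>) \<in> etriangles \<C>" and s: "arr s C B" "y \<bullet> s = Ident \<C> C"
  shows "\<delta> = \<one>\<^bsub>EE \<C> C A\<^esub>"
proof -
  note a = etriangleD[OF t]
  have "\<delta> = pull \<C> s (pull \<C> y \<delta>)" using pull_comp[OF a(2) s(1) a(4,3)] s pull_Ident a by simp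
  then show ?thesis using pull_deflation[OF t] pull_one s a by simp
qed

text \<open>If \<open>f\<^sub>*\<theta> = 0\<close> then \<open>f\<close> extends along the inflation of \<open>\<theta>\<close>, and the extension induces the
  morphism of triangles which exhibits \<open>\<theta>\<close> as a base change.\<close>

lemma push_kernel:
  assumes t: "(A, f, B, f', D, \<delta>) \<in> etriangles \<C>"
    and \<theta>: "P \<in> Obj \<C>" "\<theta> \<in> carrier (EE \<C> P A)" "push \<C> f \<theta> = \<one>\<^bsub>EE \<C> P B\<^esub>"
  obtains c where "arr c P D" "\<theta> = pull \<C> c \<delta>"
proof -
  note a = etriangleD[OF t]
  obtain x G y where G: "(A, x, G, y, P, \<theta>) \<in> etriangles \<C>"
    using etriangle_exists[OF \<theta>(1) a(4) \<theta>(2)] by blast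
  note g = etriangleD[OF G]
  obtain S i j p q where S: "biproduct \<C> B P S i j p q" using ex_biproduct a g by blast
  note s = biproductD[OF S]
  have "push \<C> f \<theta> = pull \<C> (Ident \<C> P) \<one>\<^bsub>EE \<C> P B\<^esub>"
    using \<theta> pull_Ident EE_one a by simp
  then obtain b where b: "arr b G S" "b \<bullet> x = i \<bullet> f"
    using rlz_morphism[OF G rlz_zero[OF S], of f "Ident \<C> P"] a g s id_arr[OF g(6)]
    by (auto simp: arr_def)
  have pb: "arr (p \<bullet> b) G B" using comp_arr b s by blast
  have "(p \<bullet> b) \<bullet> x = f"
    using comp_assoc[OF g(1) b(1) s(6)] b comp_assoc[OF a(1) s(4,6)] s(8) id_comp[OF a(1)] by simp
  also have "\<dots> = f \<bullet> Ident \<C> A" using comp_id[OF a(1)] by simp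
  finally obtain c where "c \<in> mor \<C> P D" "push \<C> (Ident \<C> A) \<theta> = pull \<C> c \<delta>"
    using ET3[OF G t _ _ ] pb id_arr[OF a(4)] by (metis arrD)
  then show ?thesis using that push_Ident g a by (simp add: arr_def)
qed

text \<open>The pullback \<open>M\<close> of two deflations \<open>y1\<close>, \<open>y2\<close> realizes \<open>i\<^sub>*\<delta>1 + j\<^sub>*\<delta>2\<close> in \<open>\<E>(C, A1 \<oplus> A2)\<close>.  Applying the
  octahedral axiom to \<open>A2 \<rightarrow> A1 \<oplus> A2 \<rightarrow> M\<close> identifies the cone of \<open>A2 \<rightarrow> M\<close> with \<open>B1\<close>, and
  symmetrically for \<open>A1\<close>.\<close>

lemma pullback_half:
  assumes S: "biproduct \<C> A1 A2 S i j p q"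
    and t1: "(A1, x1, B1, y1, C, \<delta>1) \<in> etriangles \<C>"
    and M: "(S, x, M, y, C, \<mu>) \<in> etriangles \<C>"
    and \<mu>: "push \<C> p \<mu> = \<delta>1" "push \<C> q \<mu> = \<delta>2"
  obtains m e where "(A2, m, M, e, B1, pull \<C> y1 \<delta>2) \<in> etriangles \<C>"
proof -
  note s = biproductD[OF S] and a1 = etriangleD[OF t1] and am = etriangleD[OF M]
  have d2: "\<delta>2 \<in> carrier (EE \<C> C A2)" using push_closed[OF s(7) am(6,3)] \<mu> by simp
  obtain E h' d e \<delta>'' where 1: "(A2, x \<bullet> j, M, h', E, \<delta>'') \<in> etriangles \<C>"
    and 2: "(A1, d, E, e, C, push \<C> p \<mu>) \<in> etriangles \<C>" and 3: "push \<C> j \<delta>'' = pull \<C> e \<mu>"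
    using ET4[OF rlz_zero[OF biproduct_swap[OF S]] M] by blast
  note a2 = etriangleD[OF 1] and a3 = etriangleD[OF 2]
  have "push \<C> q (push \<C> j \<delta>'') = \<delta>''"
    using push_comp[OF s(5,7) a2(6,3)] s(9) push_Ident a2 by simp
  then have 4: "\<delta>'' = pull \<C> e \<delta>2"
    using 3 push_pull_comm[OF s(7) a3(2) am(3)] \<mu> by simp
  obtain b b' where b: "arr b E B1" "arr b' B1 E" "b' \<bullet> b = Ident \<C> E" "b \<bullet> b' = Ident \<C> B1"
    "b \<bullet> d = x1" "y1 \<bullet> b = e"
    using etriangle_unique[OF 2[unfolded \<mu>] t1] by blast
  have "e \<bullet> b' = y1" using b comp_assoc[OF b(2,1) a1(2)] comp_id[OF a1(2)] by simp
  then have 5: "pull \<C> b' \<delta>'' = pull \<C> y1 \<delta>2"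
    using 4 pull_comp[OF a3(2) b(2) s(2) d2] by simp
  note i = id_arr[OF s(2)]
  have 6: "pull \<C> b' \<delta>'' \<in> carrier (EE \<C> B1 A2)" using pull_closed b s a2 by blast
  show ?thesis
    using that etriangle_iso_ends[OF 1 i i comp_id[OF i] comp_id[OF i] b(1-4)] 5
      push_Ident[OF a1(5) s(2) 6] by metis
qed

lemma pullback_triangles:
  assumes t1: "(A1, x1, B1, y1, C, \<delta>1) \<in> etriangles \<C>"
    and t2: "(A2, x2, B2, y2, C, \<delta>2) \<in> etriangles \<C>"
  obtains M m e m' e' where "(A2, m, M, e, B1, pull \<C> y1 \<delta>2) \<in> etriangles \<C>"
    "(A1, m', M, e', B2, pull \<C> y2 \<delta>1) \<in> etriangles \<C>"
proof -
  note a1 = etriangleD[OF t1] and a2 = etriangleD[OF t2]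
  obtain S i j p q where S: "biproduct \<C> A1 A2 S i j p q" using ex_biproduct a1 a2 by blast
  note s = biproductD[OF S]
  define \<mu> where "\<mu> = push \<C> i \<delta>1 \<otimes>\<^bsub>EE \<C> C S\<^esub> push \<C> j \<delta>2"
  have c: "push \<C> i \<delta>1 \<in> carrier (EE \<C> C S)" "push \<C> j \<delta>2 \<in> carrier (EE \<C> C S)"
    using push_closed s a1 a2 by blast+
  have \<mu>c: "\<mu> \<in> carrier (EE \<C> C S)"
    unfolding \<mu>_def using c EE_comm_group s a1 by (simp add: comm_groupE(1))
  obtain x M y where M: "(S, x, M, y, C, \<mu>) \<in> etriangles \<C>"
    using etriangle_exists[OF a1(6) s(3) \<mu>c] by blast
  interpret G1: comm_group "EE \<C> C A1" using EE_comm_group a1 by blast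
  interpret G2: comm_group "EE \<C> C A2" using EE_comm_group a2 by blast
  have "push \<C> p \<mu> = push \<C> (p \<bullet> i) \<delta>1 \<otimes>\<^bsub>EE \<C> C A1\<^esub> push \<C> (p \<bullet> j) \<delta>2"
    unfolding \<mu>_def using push_mult[OF s(6) a1(6) c] push_comp[OF s(4,6) a1(6,3)] push_comp[OF s(5,6) a2(6,3)]
    by simp
  then have p: "push \<C> p \<mu> = \<delta>1" using s a1 a2 push_zero push_Ident by simp
  have "push \<C> q \<mu> = push \<C> (q \<bullet> i) \<delta>1 \<otimes>\<^bsub>EE \<C> C A2\<^esub> push \<C> (q \<bullet> j) \<delta>2"
    unfolding \<mu>_def using push_mult[OF s(7) a1(6) c] push_comp[OF s(4,7) a1(6,3)] push_comp[OF s(5,7) a2(6,3)]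
    by simp
  then have q: "push \<C> q \<mu> = \<delta>2" using s a1 a2 push_zero push_Ident by simp
  show ?thesis
    using pullback_half[OF S t1 M p q] pullback_half[OF biproduct_swap[OF S] t2 M q p] that by metis
qed

text \<open>Dually, the pushout \<open>M\<close> of two inflations realizes \<open>p\<^sup>*\<delta>1 + q\<^sup>*\<delta>2\<close> in \<open>\<E>(C1 \<oplus> C2, A)\<close>.\<close>

lemma pushout_half:
  assumes S: "biproduct \<C> C1 C2 S i j p q"
    and t1: "(A, x1, B1, y1, C1, \<delta>1) \<in> etriangles \<C>"
    and M: "(A, x, M, y, S, \<mu>) \<in> etriangles \<C>"
    and \<mu>: "pull \<C> i \<mu> = \<delta>1" "pull \<C> j \<mu> = \<delta>2"
  obtains m e where "(B1, m, M, e, C2, push \<C> x1 \<delta>2) \<in> etriangles \<C>"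
proof -
  note s = biproductD[OF S] and am = etriangleD[OF M]
  have d2: "\<delta>2 \<in> carrier (EE \<C> C2 A)" using pull_closed[OF s(5) am(4,3)] \<mu> by simp
  obtain E h' d e \<delta>'' where 1: "(E, h', M, q \<bullet> y, C2, \<delta>'') \<in> etriangles \<C>"
    and 2: "(A, e, E, d, C1, pull \<C> i \<mu>) \<in> etriangles \<C>" and 3: "pull \<C> q \<delta>'' = push \<C> e \<mu>"
    using ET4_op[OF rlz_zero[OF S] M] by blast
  note a2 = etriangleD[OF 1] and a3 = etriangleD[OF 2]
  have "pull \<C> j (pull \<C> q \<delta>'') = \<delta>''"
    using pull_comp[OF s(7,5) a2(4,3)] s(9) pull_Ident a2 by simp
  then have 4: "\<delta>'' = push \<C> e \<delta>2"
    using 3 push_pull_comm[OF a3(1) s(5) am(3)] \<mu> by simp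
  obtain b b' where b: "arr b E B1" "arr b' B1 E" "b' \<bullet> b = Ident \<C> E" "b \<bullet> b' = Ident \<C> B1"
    "b \<bullet> e = x1" "y1 \<bullet> b = d"
    using etriangle_unique[OF 2[unfolded \<mu>] t1] by blast
  have 5: "push \<C> b \<delta>'' = push \<C> x1 \<delta>2"
    using 4 push_comp[OF a3(1) b(1) s(2) d2] b by simp
  note i = id_arr[OF s(2)]
  have 6: "pull \<C> (Ident \<C> C2) \<delta>'' = \<delta>''" using pull_Ident a2 by blast
  show ?thesis
    using that etriangle_iso_ends[OF 1 b(1-4) i i comp_id[OF i] comp_id[OF i]] 5 6 by metis
qed

lemma pushout_triangles:
  assumes t1: "(A, x1, B1, y1, C1, \<delta>1) \<in> etriangles \<C>"
    and t2: "(A, x2, B2, y2, C2, \<delta>2) \<in> etriangles \<C>"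
  obtains M m e m' e' where "(B1, m, M, e, C2, push \<C> x1 \<delta>2) \<in> etriangles \<C>"
    "(B2, m', M, e', C1, push \<C> x2 \<delta>1) \<in> etriangles \<C>"
proof -
  note a1 = etriangleD[OF t1] and a2 = etriangleD[OF t2]
  obtain S i j p q where S: "biproduct \<C> C1 C2 S i j p q" using ex_biproduct a1 a2 by blast
  note s = biproductD[OF S]
  define \<mu> where "\<mu> = pull \<C> p \<delta>1 \<otimes>\<^bsub>EE \<C> S A\<^esub> pull \<C> q \<delta>2"
  have c: "pull \<C> p \<delta>1 \<in> carrier (EE \<C> S A)" "pull \<C> q \<delta>2 \<in> carrier (EE \<C> S A)"
    using pull_closed s a1 a2 by blast+
  have \<mu>c: "\<mu> \<in> carrier (EE \<C> S A)"
    unfolding \<mu>_def using c EE_comm_group s a1 by (simp add: comm_groupE(1))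
  obtain x M y where M: "(A, x, M, y, S, \<mu>) \<in> etriangles \<C>"
    using etriangle_exists[OF s(3) a1(4) \<mu>c] by blast
  interpret G1: comm_group "EE \<C> C1 A" using EE_comm_group a1 by blast
  interpret G2: comm_group "EE \<C> C2 A" using EE_comm_group a2 by blast
  have "pull \<C> i \<mu> = pull \<C> (p \<bullet> i) \<delta>1 \<otimes>\<^bsub>EE \<C> C1 A\<^esub> pull \<C> (q \<bullet> i) \<delta>2"
    unfolding \<mu>_def using pull_mult[OF s(4) a1(4) c] pull_comp[OF s(6,4) a1(4,3)] pull_comp[OF s(7,4) a2(4,3)]
    by simp
  then have p: "pull \<C> i \<mu> = \<delta>1" using s a1 a2 pull_zero pull_Ident by simp
  have "pull \<C> j \<mu> = pull \<C> (p \<bullet> j) \<delta>1 \<otimes>\<^bsub>EE \<C> C2 A\<^esub> pull \<C> (q \<bullet> j) \<delta>2"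
    unfolding \<mu>_def using pull_mult[OF s(5) a1(4) c] pull_comp[OF s(6,5) a1(4,3)] pull_comp[OF s(7,5) a2(4,3)]
    by simp
  then have q: "pull \<C> j \<mu> = \<delta>2" using s a1 a2 pull_zero pull_Ident by simp
  show ?thesis
    using pushout_half[OF S t1 M p q] pushout_half[OF biproduct_swap[OF S] t2 M q p] that by metis
qed

end


section \<open>Proper classes\<close>

context proper_class
begin

lemma xi_etriangle: "T \<in> \<xi> \<Longrightarrow> T \<in> etriangles \<C>"
  using subset_etriangles by blast

lemmas xiD = etriangleD[OF xi_etriangle]

lemma zero_id_in: "zero_object \<C> Z \<Longrightarrow> A \<in> Obj \<C> \<Longrightarrow>
    (Z, zero_mor Z A, A, Ident \<C> A, A, \<one>\<^bsub>EE \<C> A Z\<^esub>) \<in> \<xi>"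
  using etriangle_zero_id split_in by blast

lemma split_swap_in:
  assumes "(A, x, B, y, C, \<one>\<^bsub>EE \<C> C A\<^esub>) \<in> \<xi>"
  obtains j p where "(C, j, B, p, A, \<one>\<^bsub>EE \<C> A C\<^esub>) \<in> \<xi>"
  using split_swap[OF xi_etriangle[OF assms]] split_in by metis

lemma pullback_in:
  assumes t1: "(A1, x1, B1, y1, C, \<delta>1) \<in> \<xi>" and t2: "(A2, x2, B2, y2, C, \<delta>2) \<in> \<xi>"
  obtains M m e m' e' \<epsilon> \<epsilon>' where "(A2, m, M, e, B1, \<epsilon>) \<in> \<xi>" "(A1, m', M, e', B2, \<epsilon>') \<in> \<xi>"
proof -
  obtain M m e m' e' where M: "(A2, m, M, e, B1, pull \<C> y1 \<delta>2) \<in> etriangles \<C>"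
      "(A1, m', M, e', B2, pull \<C> y2 \<delta>1) \<in> etriangles \<C>"
    using pullback_triangles[OF xi_etriangle[OF t1] xi_etriangle[OF t2]] by metis
  show ?thesis
    by (rule that[OF base_change[OF t2 _ _ M(1)] base_change[OF t1 _ _ M(2)]])
      (use xiD(2)[OF t1] xiD(2)[OF t2] in \<open>auto simp: arr_def\<close>)
qed

lemma pushout_in:
  assumes t1: "(A, x1, B1, y1, C1, \<delta>1) \<in> \<xi>" and t2: "(A, x2, B2, y2, C2, \<delta>2) \<in> \<xi>"
  obtains M m e m' e' \<epsilon> \<epsilon>' where "(B1, m, M, e, C2, \<epsilon>) \<in> \<xi>" "(B2, m', M, e', C1, \<epsilon>') \<in> \<xi>"
proof -
  obtain M m e m' e' where M: "(B1, m, M, e, C2, push \<C> x1 \<delta>2) \<in> etriangles \<C>"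
      "(B2, m', M, e', C1, push \<C> x2 \<delta>1) \<in> etriangles \<C>"
    using pushout_triangles[OF xi_etriangle[OF t1] xi_etriangle[OF t2]] by metis
  show ?thesis
    by (rule that[OF cobase_change[OF t2 _ _ M(1)] cobase_change[OF t1 _ _ M(2)]])
      (use xiD(1)[OF t1] xiD(1)[OF t2] in \<open>auto simp: arr_def\<close>)
qed

text \<open>The extension of the composite deflation becomes a cobase change of \<open>\<delta>'\<close> after base change
  along \<open>g\<close>, so saturation applies.\<close>

lemma deflations_compose:
  assumes t': "(K, k, B, f, Y, \<delta>') \<in> \<xi>" and t: "(L, l, Y, g, X, \<delta>) \<in> \<xi>"
  obtains E h d e \<epsilon> \<epsilon>' where "(E, h, B, g \<bullet> f, X, \<epsilon>) \<in> \<xi>" "(K, e, E, d, L, \<epsilon>') \<in> \<xi>"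
proof -
  obtain E h d e \<epsilon> where 1: "(E, h, B, g \<bullet> f, X, \<epsilon>) \<in> etriangles \<C>"
    and 2: "(K, e, E, d, L, pull \<C> l \<delta>') \<in> etriangles \<C>" and 3: "pull \<C> g \<epsilon> = push \<C> e \<delta>'"
    using ET4_op[OF xi_etriangle[OF t] xi_etriangle[OF t']] by blast
  have 4: "(K, e, E, d, L, pull \<C> l \<delta>') \<in> \<xi>"
    using base_change[OF t' _ _ 2] xiD(1)[OF t] arrD by blast
  note e = xiD(1)[OF 4]
  have "push \<C> e \<delta>' \<in> carrier (EE \<C> Y E)" using push_closed[OF e] xiD[OF t'] by blast
  then obtain m M q where 5: "(E, m, M, q, Y, push \<C> e \<delta>') \<in> etriangles \<C>"
    using etriangle_exists xiD[OF t'] xiD[OF 4] by metis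
  have "(E, m, M, q, Y, push \<C> e \<delta>') \<in> \<xi>"
    using cobase_change[OF t' _ _ 5] e arrD by blast
  then have "(E, h, B, g \<bullet> f, X, \<epsilon>) \<in> \<xi>"
    using saturated[OF 1 t, of m M q] 3 by simp
  then show ?thesis using that 4 by blast
qed

lemma projectiveD:
  assumes "P \<in> projectives \<C> \<xi>" "(A, x, B, y, C, \<delta>) \<in> \<xi>"
  shows "P \<in> Obj \<C>" "(\<lambda>h. y \<bullet> h) ` mor \<C> P B = mor \<C> P C" "inj_on (\<lambda>h. x \<bullet> h) (mor \<C> P A)"
proof -
  show "P \<in> Obj \<C>" using assms by (simp add: projectives_def)
  have "short_exact_sequence (Hom \<C> P C) (Hom \<C> P B) (Hom \<C> P A)
       (\<lambda>h. y \<bullet> h) (\<lambda>h. x \<bullet> h)" using assms unfolding projectives_def by blast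
  then have "(\<lambda>h. y \<bullet> h) \<in> epi (Hom \<C> P B) (Hom \<C> P C)" "(\<lambda>h. x \<bullet> h) \<in> mon (Hom \<C> P A) (Hom \<C> P B)"
    using short_exact_sequenceD by blast+
  then show "(\<lambda>h. y \<bullet> h) ` mor \<C> P B = mor \<C> P C" "inj_on (\<lambda>h. x \<bullet> h) (mor \<C> P A)"
    by (simp_all add: epi_def mon_def)
qed

lemma projective_obj: "P \<in> projectives \<C> \<xi> \<Longrightarrow> P \<in> Obj \<C>"
  by (simp add: projectives_def)

lemma projective_lift:
  assumes "P \<in> projectives \<C> \<xi>" "(A, x, B, y, C, \<delta>) \<in> \<xi>" "arr u P C"
  obtains v where "arr v P B" "y \<bullet> v = u"
proof -
  have "u \<in> (\<lambda>h. y \<bullet> h) ` mor \<C> P B"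
    using projectiveD(2)[OF assms(1,2)] assms(3) by (simp add: arr_def)
  then obtain v where "v \<in> mor \<C> P B" "y \<bullet> v = u" by blast
  then show ?thesis using that projectiveD(1)[OF assms(1,2)] xiD(5)[OF assms(2)] arrI by blast
qed

lemma projective_cancel:
  assumes "P \<in> projectives \<C> \<xi>" "(A, x, B, y, C, \<delta>) \<in> \<xi>" "arr a P A" "arr a' P A" "x \<bullet> a = x \<bullet> a'"
  shows "a = a'"
  using projectiveD(3)[OF assms(1,2)] assms unfolding arr_def inj_on_def by blast

lemma projective_splits:
  assumes "P \<in> projectives \<C> \<xi>" "(A, x, B, y, P, \<delta>) \<in> \<xi>"
  shows "\<delta> = \<one>\<^bsub>EE \<C> P A\<^esub>"
proof -
  obtain s where "arr s P B" "y \<bullet> s = Ident \<C> P"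
    using projective_lift[OF assms id_arr] projective_obj[OF assms(1)] by blast
  then show ?thesis using section_splits[OF xi_etriangle[OF assms(2)]] by blast
qed

end

text \<open>Subcategories are not assumed closed under isomorphism, but any zero object is the cocone of the
  identity of the given one.\<close>

lemma (in proper_class) zero_in_subcategory:
  assumes "closed_cocones \<xi> \<Y>" "Z \<in> \<Y>" "zero_object \<C> Z" "zero_object \<C> K"
  shows "K \<in> \<Y>"
  using zero_id_in[OF assms(4) zero_objectD[OF assms(3)]] assms unfolding closed_cocones_def by blast

locale enough_proper_class = proper_class \<C> \<xi>
  for \<C> :: "('o, 'm, 'e, 'z) extricat_scheme" (structure)
  and \<xi> :: "('o, 'm, 'e) triangle set" +
  assumes enough: "enough_projectives \<C> \<xi>"
begin

text \<open>Saturation is a condition on deflations.  The dual condition follows from it: an extension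
  lies in \<open>\<xi>\<close> as soon as its base change to a projective cover vanishes.  For the composite inflation
  this base change \<open>\<theta>\<close> satisfies \<open>f\<^sub>*\<theta> = 0\<close>, so it is a base change of \<open>\<delta>\<close> and vanishes.\<close>

lemma inflations_compose:
  assumes t: "(A, f, B, f', D, \<delta>) \<in> \<xi>" and t': "(B, g, C, g', F, \<delta>') \<in> \<xi>"
  obtains E h d e \<epsilon> \<epsilon>' where "(A, g \<bullet> f, C, h, E, \<epsilon>) \<in> \<xi>" "(D, d, E, e, F, \<epsilon>') \<in> \<xi>"
proof -
  obtain E h d e \<epsilon> where 1: "(A, g \<bullet> f, C, h, E, \<epsilon>) \<in> etriangles \<C>"
    and 2: "(D, d, E, e, F, push \<C> f' \<delta>') \<in> etriangles \<C>" and 3: "push \<C> f \<epsilon> = pull \<C> e \<delta>'"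
    using ET4[OF xi_etriangle[OF t] xi_etriangle[OF t']] by blast
  have 4: "(D, d, E, e, F, push \<C> f' \<delta>') \<in> \<xi>"
    using cobase_change[OF t' _ _ 2] xiD(2)[OF t] arrD by blast
  note a = etriangleD[OF 1] and b = xiD[OF t] and b' = xiD[OF t'] and e = xiD[OF 4]
  obtain K k P p \<kappa> where P: "(K, k, P, p, E, \<kappa>) \<in> \<xi>" "P \<in> projectives \<C> \<xi>"
    using enough a(6) unfolding enough_projectives_def by blast
  note p = xiD[OF P(1)]
  have zero: "\<theta> = \<one>\<^bsub>EE \<C> P V\<^esub>" if "(V, v, W, w, U, \<omega>) \<in> \<xi>" "arr c P U" "\<theta> = pull \<C> c \<omega>"
    for V v W w U \<omega> c \<theta>
  proof -
    note o = xiD[OF that(1)]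
    have "\<theta> \<in> carrier (EE \<C> P V)" using pull_closed that(2,3) o by blast
    then obtain x' B' y' where 6: "(V, x', B', y', P, \<theta>) \<in> etriangles \<C>"
      using etriangle_exists p o by metis
    then have "(V, x', B', y', P, \<theta>) \<in> \<xi>"
      using base_change[OF that(1)] that(2,3) arrD by blast
    then show ?thesis using projective_splits[OF P(2)] by blast
  qed
  let ?\<theta> = "pull \<C> p \<epsilon>"
  have \<theta>: "?\<theta> \<in> carrier (EE \<C> P A)" using pull_closed p a by blast
  have "push \<C> f ?\<theta> = pull \<C> (e \<bullet> p) \<delta>'"
    using push_pull_comm[OF b(1) p(2) a(3)] 3 pull_comp[OF e(2) p(2) b'(4,3)] by simp
  then have "push \<C> f ?\<theta> = \<one>\<^bsub>EE \<C> P B\<^esub>"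
    using zero[OF t' comp_arr[OF p(2) e(2)]] by blast
  then obtain c where "arr c P D" "?\<theta> = pull \<C> c \<delta>"
    using push_kernel[OF xi_etriangle[OF t] p(5) \<theta>] by blast
  then have 7: "?\<theta> = \<one>\<^bsub>EE \<C> P A\<^esub>" using zero[OF t] by blast
  obtain m M q where m: "(A, m, M, q, P, \<one>\<^bsub>EE \<C> P A\<^esub>) \<in> etriangles \<C>"
    using etriangle_exists \<theta> 7 p a by metis
  have "(A, g \<bullet> f, C, h, E, \<epsilon>) \<in> \<xi>"
    using saturated[OF 1 P(1)] split_in[OF m] 7 by metis
  then show ?thesis using that 4 by blast
qed

end


section \<open>Bounded resolutions\<close>

text \<open>Recursion from the right-hand end of \<open>0 \<rightarrow> Y n \<rightarrow> \<dots> \<rightarrow> Y 0 \<rightarrow> M \<rightarrow> 0\<close> makes the inductions over the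
  length immediate.  The class \<open>S i\<close> prescribed for \<open>Y i\<close> depends on the position, so that resolutions
  by one subcategory and resolutions of mixed type are instances of the same notion.\<close>

primrec (in proper_class) has_res :: "nat \<Rightarrow> (nat \<Rightarrow> 'o set) \<Rightarrow> 'o \<Rightarrow> bool" where
  "has_res 0 S M \<longleftrightarrow> M \<in> S 0"
| "has_res (Suc n) S M \<longleftrightarrow>
     (\<exists>K x X y \<delta>. (K, x, X, y, M, \<delta>) \<in> \<xi> \<and> X \<in> S 0 \<and> has_res n (\<lambda>i. S (Suc i)) K)"

context proper_class
begin

abbreviation dim_le :: "nat \<Rightarrow> 'o set \<Rightarrow> 'o \<Rightarrow> bool" where
  "dim_le n \<Y> \<equiv> has_res n (\<lambda>_. \<Y>)"

lemma has_res_SucI: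
  "(K, x, X, y, M, \<delta>) \<in> \<xi> \<Longrightarrow> X \<in> S 0 \<Longrightarrow> has_res n (\<lambda>i. S (Suc i)) K \<Longrightarrow> has_res (Suc n) S M"
  unfolding has_res.simps by blast

lemma dim_le_SucI:
  "(K, x, X, y, M, \<delta>) \<in> \<xi> \<Longrightarrow> X \<in> \<Y> \<Longrightarrow> dim_le n \<Y> K \<Longrightarrow> dim_le (Suc n) \<Y> M"
  unfolding has_res.simps by blast

lemma exact_bounded_0: "(\<exists>d. exact_bounded \<C> \<xi> 0 Y d M) \<longleftrightarrow> Y 0 = M"
proof
  assume "Y 0 = M"
  then have "exact_bounded \<C> \<xi> 0 Y (\<lambda>_. Ident \<C> M) M"
    unfolding exact_bounded_def by (intro exI[of _ "\<lambda>_. M"] exI[of _ "\<lambda>_. Ident \<C> M"]) auto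
  then show "\<exists>d. exact_bounded \<C> \<xi> 0 Y d M" by blast
qed (auto simp: exact_bounded_def)

lemma exact_bounded_Suc:
  "(\<exists>d. exact_bounded \<C> \<xi> (Suc n) Y d M) \<longleftrightarrow>
     (\<exists>K x y \<delta>. (K, x, Y 0, y, M, \<delta>) \<in> \<xi> \<and> (\<exists>d. exact_bounded \<C> \<xi> n (\<lambda>i. Y (Suc i)) d K))"
  (is "?l \<longleftrightarrow> ?r")
proof
  assume ?l
  then obtain K g f where k: "K 0 = M" "K (Suc n) = Y (Suc n)" "f (Suc n) = Ident \<C> (Y (Suc n))"
    "\<And>i. i < Suc n \<Longrightarrow> \<exists>\<delta>. (K (Suc i), g i, Y i, f i, K i, \<delta>) \<in> \<xi>"
    unfolding exact_bounded_def by blast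
  have "exact_bounded \<C> \<xi> n (\<lambda>i. Y (Suc i)) (case_nat (f 1) (\<lambda>i. g (Suc i) \<bullet> f (Suc (Suc i)))) (K 1)"
    unfolding exact_bounded_def using k
    by (intro exI[of _ "\<lambda>i. K (Suc i)"] exI[of _ "\<lambda>i. g (Suc i)"] exI[of _ "\<lambda>i. f (Suc i)"]) auto
  then show ?r using k(1) k(4)[of 0] by auto
next
  assume ?r
  then obtain K0 x y \<delta> d K g f where t: "(K0, x, Y 0, y, M, \<delta>) \<in> \<xi>"
    and k: "K 0 = K0" "K n = Y (Suc n)" "f n = Ident \<C> (Y (Suc n))"
    "\<And>i. i < n \<Longrightarrow> \<exists>\<delta>. (K (Suc i), g i, Y (Suc i), f i, K i, \<delta>) \<in> \<xi>"
    unfolding exact_bounded_def by blast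
  let ?f = "case_nat y f" and ?g = "case_nat x g"
  have "\<exists>\<delta>. (case_nat M K (Suc i), ?g i, Y i, ?f i, case_nat M K i, \<delta>) \<in> \<xi>" if "i < Suc n" for i
    using that t k by (cases i) auto
  then have "exact_bounded \<C> \<xi> (Suc n) Y (case_nat y (\<lambda>i. ?g i \<bullet> ?f (Suc i))) M"
    unfolding exact_bounded_def using k
    by (intro exI[of _ "case_nat M K"] exI[of _ ?g] exI[of _ ?f]) auto
  then show ?l by blast
qed

lemma has_res_iff_exact_bounded:
  "has_res n S M \<longleftrightarrow> (\<exists>Y d. exact_bounded \<C> \<xi> n Y d M \<and> (\<forall>i\<le>n. Y i \<in> S i))"
proof (induction n arbitrary: S M)
  case 0
  have "M \<in> S 0 \<longleftrightarrow> (\<exists>Y. Y 0 = M \<and> Y 0 \<in> S 0)" by (auto intro: exI[of _ "\<lambda>_. M"])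
  then show ?case using exact_bounded_0[of _ M] by auto
next
  case (Suc n)
  show ?case (is "_ \<longleftrightarrow> ?r")
  proof
    assume "has_res (Suc n) S M"
    then obtain K x X y \<delta> Y d where t: "(K, x, X, y, M, \<delta>) \<in> \<xi>" "X \<in> S 0"
      "exact_bounded \<C> \<xi> n Y d K" "\<forall>i\<le>n. Y i \<in> S (Suc i)"
      using Suc.IH by auto
    let ?Y = "case_nat X Y"
    have "\<exists>d. exact_bounded \<C> \<xi> (Suc n) ?Y d M" using exact_bounded_Suc[of n ?Y M] t by auto
    moreover have "\<forall>i\<le>Suc n. ?Y i \<in> S i" using t by (auto split: nat.split)
    ultimately show ?r by blast
  next
    assume ?r
    then obtain Y where Y: "\<exists>d. exact_bounded \<C> \<xi> (Suc n) Y d M" "\<forall>i\<le>Suc n. Y i \<in> S i" by blast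
    then obtain K x y \<delta> where t: "(K, x, Y 0, y, M, \<delta>) \<in> \<xi>"
      "\<exists>d. exact_bounded \<C> \<xi> n (\<lambda>i. Y (Suc i)) d K"
      using exact_bounded_Suc by blast
    then have "has_res n (\<lambda>i. S (Suc i)) K" unfolding Suc.IH using Y by (auto intro!: exI[of _ "\<lambda>i. Y (Suc i)"])
    then show "has_res (Suc n) S M" using has_res_SucI[of _ _ "Y 0" _ M] t Y by blast
  qed
qed

lemma has_res_mono:
  assumes "has_res n S M" "\<And>i. i \<le> n \<Longrightarrow> S i \<subseteq> T i"
  shows "has_res n T M"
  using assms
proof (induction n arbitrary: S T M)
  case 0 then show ?case by auto
next
  case (Suc n)
  then obtain K x X y \<delta> where t: "(K, x, X, y, M, \<delta>) \<in> \<xi>" "X \<in> S 0" "has_res n (\<lambda>i. S (Suc i)) K"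
    by auto
  have "has_res n (\<lambda>i. T (Suc i)) K" by (rule Suc.IH[OF t(3)]) (simp add: Suc.prems)
  moreover have "X \<in> T 0" using Suc.prems(2)[of 0] t by auto
  ultimately show ?case using has_res_SucI[OF t(1)] by blast
qed

text \<open>Pad on the left with zero objects.\<close>

lemma dim_le_mono:
  assumes "dim_le m \<Y> M" "m \<le> n" and Y: "\<Y> \<subseteq> Obj \<C>" "Z \<in> \<Y>" "zero_object \<C> Z"
  shows "dim_le n \<Y> M"
  using assms(2,1)
proof (induction n rule: dec_induct)
  case (step k)
  have "dim_le (Suc k) \<Y> M" if "dim_le k \<Y> M" for k M using that
  proof (induction k arbitrary: M)
    case 0
    then have "(Z, zero_mor Z M, M, Ident \<C> M, M, \<one>\<^bsub>EE \<C> M Z\<^esub>) \<in> \<xi>" using zero_id_in Y by auto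
    then show ?case using 0 Y dim_le_SucI by simp blast
  qed (simp, blast)
  then show ?case using step by blast
qed

lemma res_dim_le_enat_iff:
  assumes Y: "\<Y> \<subseteq> Obj \<C>" "Z \<in> \<Y>" "zero_object \<C> Z"
  shows "res_dim \<C> \<xi> \<Y> M \<le> enat n \<longleftrightarrow> dim_le n \<Y> M"
proof -
  have r: "res_dim \<C> \<xi> \<Y> M = Inf {enat k |k. dim_le k \<Y> M}"
    unfolding res_dim_def has_res_iff_exact_bounded by (auto intro!: arg_cong[of _ _ Inf])
  let ?A = "{enat k |k. dim_le k \<Y> M}"
  show ?thesis
  proof
    assume l: "res_dim \<C> \<xi> \<Y> M \<le> enat n"
    have "?A \<noteq> {}"
    proof
      assume e: "?A = {}"
      show False using l unfolding r e by (simp add: top_enat_def)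
    qed
    then have "Inf ?A \<in> ?A" unfolding Inf_enat_def using LeastI_ex[of "\<lambda>x. x \<in> ?A"] by auto
    then obtain k where "Inf ?A = enat k" "dim_le k \<Y> M" by auto
    then show "dim_le n \<Y> M" using l r dim_le_mono[OF _ _ Y] by auto
  next
    assume "dim_le n \<Y> M"
    then show "res_dim \<C> \<xi> \<Y> M \<le> enat n" unfolding r by (auto intro: Inf_lower)
  qed
qed

lemma res_dim_finite_iff:
  assumes Y: "\<Y> \<subseteq> Obj \<C>" "Z \<in> \<Y>" "zero_object \<C> Z"
  shows "res_dim \<C> \<xi> \<Y> M < \<infinity> \<longleftrightarrow> (\<exists>n. dim_le n \<Y> M)"
  using res_dim_le_enat_iff[OF Y]
  by (metis enat_ord_simps(4) not_infinity_eq order.refl infinity_ileE)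


section \<open>Unbounded resolutions\<close>

text \<open>Dependent choice: resolving one step at a time inside a class \<open>\<D>\<close>.\<close>

lemma resolution_exists:
  assumes step: "\<And>M. M \<in> \<D> \<Longrightarrow> \<exists>K x X y \<delta>. (K, x, X, y, M, \<delta>) \<in> \<xi> \<and> X \<in> \<Y> \<and> K \<in> \<D>"
    and M: "M \<in> \<D>"
  obtains X d K g f where "\<And>i. X i \<in> \<Y>" "resolution_triangles \<C> \<xi> M X d K g f" "\<And>i. K i \<in> \<D>"
proof -
  have "\<exists>s. \<forall>M\<in>\<D>. case s M of (K, x, X, y, \<delta>) \<Rightarrow> (K, x, X, y, M, \<delta>) \<in> \<xi> \<and> X \<in> \<Y> \<and> K \<in> \<D>"
    by (rule bchoice) (use step in auto)
  then obtain s where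
    s: "\<forall>M\<in>\<D>. case s M of (K, x, X, y, \<delta>) \<Rightarrow> (K, x, X, y, M, \<delta>) \<in> \<xi> \<and> X \<in> \<Y> \<and> K \<in> \<D>" ..
  define K where "K n = ((\<lambda>M. fst (s M)) ^^ n) M" for n
  define g where "g n = fst (snd (s (K n)))" for n
  define X where "X n = fst (snd (snd (s (K n))))" for n
  define f where "f n = fst (snd (snd (snd (s (K n)))))" for n
  have K0: "K 0 = M" by (simp add: K_def)
  have KS: "K (Suc n) = fst (s (K n))" for n by (simp add: K_def)
  have KD: "K n \<in> \<D>" for n
  proof (induction n)
    case 0 then show ?case using M K0 by simp
  next
    case (Suc n) then show ?case using bspec[OF s Suc] KS by (simp split: prod.splits)
  qed
  have t: "X n \<in> \<Y> \<and> (\<exists>\<delta>. (K (Suc n), g n, X n, f n, K n, \<delta>) \<in> \<xi>)" for n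
    using bspec[OF s KD[of n]] unfolding KS g_def X_def f_def by (auto split: prod.splits)
  have "resolution_triangles \<C> \<xi> M X (case_nat (f 0) (\<lambda>n. g n \<bullet> f (Suc n))) K g f"
    unfolding resolution_triangles_def using K0 t by simp
  then show ?thesis using that t KD by blast
qed

lemma resolution_triangles_tail:
  assumes "resolution_triangles \<C> \<xi> M X d K g f"
  shows "resolution_triangles \<C> \<xi> (K j) (\<lambda>n. X (j + n)) (\<lambda>n. if n = 0 then f j else d (j + n))
    (\<lambda>n. K (j + n)) (\<lambda>n. g (j + n)) (\<lambda>n. f (j + n))"
  using assms unfolding resolution_triangles_def by simp

lemma resolution_triangle:
  assumes "resolution_triangles \<C> \<xi> M X d K g f"
  obtains \<delta> where "(K (Suc n), g n, X n, f n, K n, \<delta>) \<in> \<xi>"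
  using assms unfolding resolution_triangles_def by blast

text \<open>Cut the infinite resolution at its \<open>n\<close>th syzygy.\<close>

lemma dim_le_of_syzygy:
  assumes "resolution_triangles \<C> \<xi> M X d K g f" "\<And>i. X i \<in> \<Y>" "K n \<in> \<Y>"
  shows "dim_le n \<Y> M"
proof -
  have "dim_le j \<Y> (K (n - j))" if "j \<le> n" for j using that
  proof (induction j)
    case 0 then show ?case using assms by simp
  next
    case (Suc j)
    have "\<exists>\<delta>. (K (n - j), g (n - Suc j), X (n - Suc j), f (n - Suc j), K (n - Suc j), \<delta>) \<in> \<xi>"
      using resolution_triangle[OF assms(1), of "n - Suc j"] Suc.prems by (metis Suc_diff_Suc Suc_le_lessD)
    then show ?case using Suc assms(2) dim_le_SucI by (meson Suc_leD)
  qed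
  from this[of n] show ?thesis using assms(1) by (simp add: resolution_triangles_def)
qed

lemma res_imp_triangle:
  assumes "M \<in> res \<C> \<xi> \<Y>"
  obtains K x X y \<delta> where "(K, x, X, y, M, \<delta>) \<in> \<xi>" "X \<in> \<Y>"
proof -
  obtain X d K g f where "\<And>i. X i \<in> \<Y>" "resolution_triangles \<C> \<xi> M X d K g f"
    using assms unfolding res_def is_resolution_def by blast
  then show ?thesis using that resolution_triangle[of M X d K g f 0]
    by (metis resolution_triangles_def)
qed

end


section \<open>Cohomology of projective resolutions\<close>

context proper_class
begin

abbreviation proj_res :: "'o \<Rightarrow> (nat \<Rightarrow> 'o) \<Rightarrow> (nat \<Rightarrow> 'm) \<Rightarrow> bool" where
  "proj_res \<equiv> is_resolution \<C> \<xi> (projectives \<C> \<xi>)"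

lemma resolution_arr:
  assumes "resolution_triangles \<C> \<xi> M X d K g f"
  shows "arr (g n) (K (Suc n)) (X n)" "arr (f n) (X n) (K n)" "arr (d 0) (X 0) M"
    "arr (d (Suc n)) (X (Suc n)) (X n)" "M \<in> Obj \<C>" "f n \<bullet> d (Suc n) = zero_mor (X (Suc n)) (K n)"
proof -
  have t: "arr (g n) (K (Suc n)) (X n)" "arr (f n) (X n) (K n)" "f n \<bullet> g n = zero_mor (K (Suc n)) (K n)" for n
    using resolution_triangle[OF assms] xiD comp_inflation_deflation[OF xi_etriangle] by metis+
  have e: "K 0 = M" "d 0 = f 0" "d (Suc n) = g n \<bullet> f (Suc n)" for n
    using assms by (auto simp: resolution_triangles_def)
  show "arr (g n) (K (Suc n)) (X n)" "arr (f n) (X n) (K n)" by fact+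
  show "arr (d 0) (X 0) M" "M \<in> Obj \<C>" using t(2)[of 0] e arrD by auto
  show "arr (d (Suc n)) (X (Suc n)) (X n)" using t e comp_arr by metis
  have "f n \<bullet> d (Suc n) = (f n \<bullet> g n) \<bullet> f (Suc n)" using comp_assoc[OF t(2)[of "Suc n"] t(1,2)] e by simp
  then show "f n \<bullet> d (Suc n) = zero_mor (X (Suc n)) (K n)"
    using t(3) zero_comp[OF t(2)[of "Suc n"]] arrD[OF t(2)[of n]] by simp
qed

lemma proj_resD:
  assumes "proj_res A P d"
  shows "P n \<in> projectives \<C> \<xi>" "arr (d 0) (P 0) A" "arr (d (Suc n)) (P (Suc n)) (P n)"
    "P n \<in> Obj \<C>" "A \<in> Obj \<C>"
    "d 0 \<bullet> d (Suc 0) = zero_mor (P (Suc 0)) A"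
    "d (Suc n) \<bullet> d (Suc (Suc n)) = zero_mor (P (Suc (Suc n))) (P n)"
proof -
  obtain K g f where r: "resolution_triangles \<C> \<xi> A P d K g f" and p: "\<And>n. P n \<in> projectives \<C> \<xi>"
    using assms unfolding is_resolution_def by blast
  note a = resolution_arr[OF r]
  have e: "K 0 = A" "d 0 = f 0" "d (Suc n) = g n \<bullet> f (Suc n)" for n
    using r by (auto simp: resolution_triangles_def)
  show "P n \<in> projectives \<C> \<xi>" "arr (d 0) (P 0) A" "arr (d (Suc n)) (P (Suc n)) (P n)"
    "P n \<in> Obj \<C>" "A \<in> Obj \<C>" using p a projective_obj by auto
  show "d 0 \<bullet> d (Suc 0) = zero_mor (P (Suc 0)) A" using a(6)[of 0] e by simp
  have "d (Suc n) \<bullet> d (Suc (Suc n)) = g n \<bullet> (f (Suc n) \<bullet> d (Suc (Suc n)))"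
    using comp_assoc[OF a(4)[of "Suc n"] a(2)[of "Suc n"] a(1)[of n]] e(3)[of n] by simp
  then show "d (Suc n) \<bullet> d (Suc (Suc n)) = zero_mor (P (Suc (Suc n))) (P n)"
    using a(6)[of "Suc n"] comp_zero[OF a(1)[of n]] p projective_obj by simp
qed

text \<open>The inflation \<open>g n\<close> is a weak kernel of \<open>f n\<close>, and \<open>f (n + 1)\<close> is surjective on morphisms from
  the projective object \<open>Q\<close>.\<close>

lemma resolution_exact:
  assumes r: "resolution_triangles \<C> \<xi> A P d K g f" and Q: "Q \<in> projectives \<C> \<xi>"
    and u: "arr u Q (P n)" "arr u' Q (P n)" "f n \<bullet> u = f n \<bullet> u'"
  obtains v where "arr v Q (P (Suc n))" "u = (d (Suc n) \<bullet> v) \<boxplus>\<^bsub>Q,P n\<^esub> u'"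
proof -
  obtain \<delta> where t: "(K (Suc n), g n, P n, f n, K n, \<delta>) \<in> \<xi>" using resolution_triangle[OF r] .
  obtain \<delta>' where t': "(K (Suc (Suc n)), g (Suc n), P (Suc n), f (Suc n), K (Suc n), \<delta>') \<in> \<xi>"
    using resolution_triangle[OF r] .
  obtain a where a: "arr a Q (K (Suc n))" "u = (g n \<bullet> a) \<boxplus>\<^bsub>Q,P n\<^esub> u'"
    using weak_kernel_diff[OF xi_etriangle[OF t] u] .
  obtain v where v: "arr v Q (P (Suc n))" "f (Suc n) \<bullet> v = a" using projective_lift[OF Q t' a(1)] .
  have "d (Suc n) = g n \<bullet> f (Suc n)" using r by (simp add: resolution_triangles_def)
  then have "g n \<bullet> a = d (Suc n) \<bullet> v"
    using v comp_assoc[OF v(1) resolution_arr(2)[OF r] resolution_arr(1)[OF r]] by simp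
  then show ?thesis using that a v by simp
qed

lemma proj_res_lift:
  assumes "proj_res A P d" "Q \<in> projectives \<C> \<xi>" "arr u Q A"
  obtains v where "arr v Q (P 0)" "d 0 \<bullet> v = u"
proof -
  obtain K g f where r: "resolution_triangles \<C> \<xi> A P d K g f"
    using assms unfolding is_resolution_def by blast
  obtain \<delta> where "(K (Suc 0), g 0, P 0, f 0, K 0, \<delta>) \<in> \<xi>" using resolution_triangle[OF r] .
  moreover have "K 0 = A" "d 0 = f 0" using r by (auto simp: resolution_triangles_def)
  ultimately show ?thesis using projective_lift assms that by metis
qed

text \<open>The differential \<open>d n = g (n - 1) \<bullet> f n\<close> and the deflation \<open>f n\<close> identify the same morphisms from
  \<open>Q\<close>: an inflation need not be a monomorphism, but composition with it is injective on morphisms from a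
  projective object.\<close>

lemma proj_res_exact:
  assumes p: "proj_res A P d" and Q: "Q \<in> projectives \<C> \<xi>"
    and u: "arr u Q (P n)" "arr u' Q (P n)" "d n \<bullet> u = d n \<bullet> u'"
  obtains v where "arr v Q (P (Suc n))" "u = (d (Suc n) \<bullet> v) \<boxplus>\<^bsub>Q,P n\<^esub> u'"
proof -
  obtain K g f where r: "resolution_triangles \<C> \<xi> A P d K g f"
    using p unfolding is_resolution_def by blast
  have "f n \<bullet> u = f n \<bullet> u'"
  proof (cases n)
    case 0 then show ?thesis using u r by (simp add: resolution_triangles_def)
  next
    case (Suc m)
    obtain \<delta> where t: "(K (Suc m), g m, P m, f m, K m, \<delta>) \<in> \<xi>" using resolution_triangle[OF r] .
    have d: "d n = g m \<bullet> f n" using r Suc by (simp add: resolution_triangles_def)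
    have a: "arr (f n) (P n) (K (Suc m))" "arr (g m) (K (Suc m)) (P m)"
      using resolution_arr[OF r] Suc by auto
    have "g m \<bullet> (f n \<bullet> u) = g m \<bullet> (f n \<bullet> u')"
      using u(3) d comp_assoc[OF u(1) a] comp_assoc[OF u(2) a] by simp
    then show ?thesis using projective_cancel[OF Q t comp_arr[OF u(1) a(1)] comp_arr[OF u(2) a(1)]] by blast
  qed
  then show ?thesis using resolution_exact[OF r Q u(1,2)] that by blast
qed

text \<open>Only lifting and exactness for morphisms from projective objects are used, hence the comparison
  theorem has its classical proof although \<open>\<C>\<close> is not abelian.\<close>

lemma comparison_map:
  assumes p: "proj_res A P d" and q: "proj_res A Q e"
  obtains \<phi> where "\<And>n. arr (\<phi> n) (P n) (Q n)" "e 0 \<bullet> \<phi> 0 = d 0"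
    "\<And>n. e (Suc n) \<bullet> \<phi> (Suc n) = \<phi> n \<bullet> d (Suc n)"
proof -
  note P = proj_resD[OF p] and Q = proj_resD[OF q]
  define T where "T n = (case n of 0 \<Rightarrow> A | Suc m \<Rightarrow> Q m)" for n
  have eT: "arr (e n) (Q n) (T n)" for n using Q by (cases n) (auto simp: T_def)
  \<comment> \<open>The second conjunct is the condition under which the next component exists.\<close>
  define I where "I n x \<longleftrightarrow> arr x (P n) (Q n) \<and> e n \<bullet> (x \<bullet> d (Suc n)) = zero_mor (P (Suc n)) (T n)
      \<and> (n = 0 \<longrightarrow> e 0 \<bullet> x = d 0)" for n x
  have "\<exists>\<phi>. \<forall>n. I n (\<phi> n) \<and> e (Suc n) \<bullet> \<phi> (Suc n) = \<phi> n \<bullet> d (Suc n)"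
  proof (rule dependent_nat_choice)
    obtain x where x: "arr x (P 0) (Q 0)" "e 0 \<bullet> x = d 0" using proj_res_lift[OF q P(1) P(2)] .
    have "e 0 \<bullet> (x \<bullet> d (Suc 0)) = zero_mor (P (Suc 0)) A"
      using comp_assoc[OF P(3)[of 0] x(1) Q(2)] x P(6) by simp
    then show "\<exists>x. I 0 x" using x by (auto simp: I_def T_def)
  next
    fix x n assume "I n x"
    then have x: "arr x (P n) (Q n)" "e n \<bullet> (x \<bullet> d (Suc n)) = zero_mor (P (Suc n)) (T n)"
      by (auto simp: I_def)
    note xd = comp_arr[OF P(3)[of n] x(1)] and z = zero_arr[OF P(4)[of "Suc n"] Q(4)[of n]]
    have "e n \<bullet> (x \<bullet> d (Suc n)) = e n \<bullet> zero_mor (P (Suc n)) (Q n)"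
      using x(2) comp_zero[OF eT P(4)] by simp
    from proj_res_exact[OF q P(1) xd z this] obtain y where y: "arr y (P (Suc n)) (Q (Suc n))"
      "x \<bullet> d (Suc n) = (e (Suc n) \<bullet> y) \<boxplus>\<^bsub>P (Suc n),Q n\<^esub> zero_mor (P (Suc n)) (Q n)" .
    then have y2: "e (Suc n) \<bullet> y = x \<bullet> d (Suc n)" using add_zero[OF comp_arr[OF y(1) Q(3)]] by simp
    have "e (Suc n) \<bullet> (y \<bullet> d (Suc (Suc n))) = x \<bullet> (d (Suc n) \<bullet> d (Suc (Suc n)))"
      using comp_assoc[OF P(3) y(1) Q(3)] comp_assoc[OF P(3) P(3) x(1)] y2 by simp
    then have "e (Suc n) \<bullet> (y \<bullet> d (Suc (Suc n))) = zero_mor (P (Suc (Suc n))) (Q n)"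
      using P(7) comp_zero[OF x(1) P(4)] by simp
    then show "\<exists>y. I (Suc n) y \<and> e (Suc n) \<bullet> y = x \<bullet> d (Suc n)"
      using y(1) y2 by (auto simp: I_def T_def)
  qed
  then show ?thesis using that unfolding I_def by blast
qed

lemma comparison_homotopy:
  assumes p: "proj_res A P d" and \<theta>: "\<And>n. arr (\<theta> n) (P n) (P n)" "d 0 \<bullet> \<theta> 0 = d 0"
    "\<And>n. d (Suc n) \<bullet> \<theta> (Suc n) = \<theta> n \<bullet> d (Suc n)"
  obtains s where "\<And>n. arr (s n) (P n) (P (Suc n))"
    "\<And>n. \<theta> (Suc n) = (d (Suc (Suc n)) \<bullet> s (Suc n)) \<boxplus>\<^bsub>P (Suc n),P (Suc n)\<^esub>
           (Ident \<C> (P (Suc n)) \<boxplus>\<^bsub>P (Suc n),P (Suc n)\<^esub> (s n \<bullet> d (Suc n)))"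
proof -
  note P = proj_resD[OF p]
  have i: "arr (Ident \<C> (P n)) (P n) (P n)" for n using id_arr P by blast
  define I where "I n x \<longleftrightarrow> arr x (P n) (P (Suc n)) \<and>
    \<theta> n \<bullet> d (Suc n) = ((d (Suc n) \<bullet> x) \<bullet> d (Suc n)) \<boxplus>\<^bsub>P (Suc n),P n\<^esub> d (Suc n)" for n x
  have "\<exists>s. \<forall>n. I n (s n) \<and>
     \<theta> (Suc n) = (d (Suc (Suc n)) \<bullet> s (Suc n)) \<boxplus>\<^bsub>P (Suc n),P (Suc n)\<^esub>
           (Ident \<C> (P (Suc n)) \<boxplus>\<^bsub>P (Suc n),P (Suc n)\<^esub> (s n \<bullet> d (Suc n)))"
  proof (rule dependent_nat_choice)
    have "d 0 \<bullet> \<theta> 0 = d 0 \<bullet> Ident \<C> (P 0)" using \<theta>(2) comp_id[OF P(2)] by simp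
    from proj_res_exact[OF p P(1) \<theta>(1) i this] obtain x where x: "arr x (P 0) (P (Suc 0))"
      "\<theta> 0 = (d (Suc 0) \<bullet> x) \<boxplus>\<^bsub>P 0,P 0\<^esub> Ident \<C> (P 0)" .
    have "\<theta> 0 \<bullet> d (Suc 0) = ((d (Suc 0) \<bullet> x) \<bullet> d (Suc 0)) \<boxplus>\<^bsub>P (Suc 0),P 0\<^esub> d (Suc 0)"
      using x add_comp[OF P(3) comp_arr[OF x(1) P(3)] i] id_comp[OF P(3)] by simp
    then show "\<exists>x. I 0 x" using x by (auto simp: I_def)
  next
    fix x n assume "I n x"
    then have x: "arr x (P n) (P (Suc n))"
      "\<theta> n \<bullet> d (Suc n) = ((d (Suc n) \<bullet> x) \<bullet> d (Suc n)) \<boxplus>\<^bsub>P (Suc n),P n\<^esub> d (Suc n)"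
      by (auto simp: I_def)
    let ?d = "d (Suc n)" and ?d' = "d (Suc (Suc n))"
    let ?w = "Ident \<C> (P (Suc n)) \<boxplus>\<^bsub>P (Suc n),P (Suc n)\<^esub> (x \<bullet> ?d)"
    note xd = comp_arr[OF P(3) x(1)]
    have w: "arr ?w (P (Suc n)) (P (Suc n))" using add_arr i xd by blast
    have "?d \<bullet> ?w = ?d \<boxplus>\<^bsub>P (Suc n),P n\<^esub> (?d \<bullet> (x \<bullet> ?d))"
      using comp_add[OF i xd P(3)] comp_id[OF P(3)] by simp
    also have "\<dots> = (?d \<bullet> (x \<bullet> ?d)) \<boxplus>\<^bsub>P (Suc n),P n\<^esub> ?d"
      using add_comm[OF P(3) comp_arr[OF xd P(3)]] by simp
    also have "\<dots> = ?d \<bullet> \<theta> (Suc n)" using x \<theta>(3) comp_assoc[OF P(3) x(1) P(3)] by simp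
    finally have "?d \<bullet> \<theta> (Suc n) = ?d \<bullet> ?w" by simp
    from proj_res_exact[OF p P(1) \<theta>(1) w this] obtain y where y: "arr y (P (Suc n)) (P (Suc (Suc n)))"
      "\<theta> (Suc n) = (?d' \<bullet> y) \<boxplus>\<^bsub>P (Suc n),P (Suc n)\<^esub> ?w" .
    have "(x \<bullet> ?d) \<bullet> ?d' = zero_mor (P (Suc (Suc n))) (P (Suc n))"
      using comp_assoc[OF P(3) P(3) x(1)] P(7) comp_zero[OF x(1) P(4)] by simp
    then have "?w \<bullet> ?d' = ?d'"
      using add_comp[OF P(3) i xd] id_comp[OF P(3)] add_zero[OF P(3)] by simp
    then have "\<theta> (Suc n) \<bullet> ?d' = ((?d' \<bullet> y) \<bullet> ?d') \<boxplus>\<^bsub>P (Suc (Suc n)),P (Suc n)\<^esub> ?d'"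
      using y add_comp[OF P(3) comp_arr[OF y(1) P(3)] w] by simp
    then show "\<exists>y. I (Suc n) y \<and> \<theta> (Suc n) = (?d' \<bullet> y) \<boxplus>\<^bsub>P (Suc n),P (Suc n)\<^esub> ?w"
      using y by (auto simp: I_def)
  qed
  then show ?thesis using that unfolding I_def by blast
qed

text \<open>The index is one less than the cohomological degree, which is positive throughout: in degree
  zero there are no coboundaries and vanishing would mean something else.\<close>

definition exact_at :: "(nat \<Rightarrow> 'o) \<Rightarrow> (nat \<Rightarrow> 'm) \<Rightarrow> 'o \<Rightarrow> nat \<Rightarrow> bool" where
  "exact_at P d N m \<longleftrightarrow> (\<forall>h. arr h (P (Suc m)) N \<and> h \<bullet> d (Suc (Suc m)) = zero_mor (P (Suc (Suc m))) N
     \<longrightarrow> (\<exists>u. arr u (P m) N \<and> h = u \<bullet> d (Suc m)))"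

lemma exact_atD:
  assumes "exact_at P d N m" "arr h (P (Suc m)) N" "h \<bullet> d (Suc (Suc m)) = zero_mor (P (Suc (Suc m))) N"
  obtains u where "arr u (P m) N" "h = u \<bullet> d (Suc m)"
  using assms unfolding exact_at_def by blast

text \<open>A cocycle \<open>h\<close> on \<open>P\<close> is transported to \<open>Q\<close> and back; the result differs from \<open>h\<close> by a
  coboundary, by the homotopy.\<close>

lemma exact_at_independent:
  assumes p: "proj_res A P d" and q: "proj_res A Q e" and ex: "exact_at Q e N m"
  shows "exact_at P d N m"
  unfolding exact_at_def
proof (intro allI impI, elim conjE)
  fix h assume h: "arr h (P (Suc m)) N" "h \<bullet> d (Suc (Suc m)) = zero_mor (P (Suc (Suc m))) N"
  note P = proj_resD[OF p] and Q = proj_resD[OF q]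
  obtain \<phi> where \<phi>: "\<And>n. arr (\<phi> n) (P n) (Q n)" "e 0 \<bullet> \<phi> 0 = d 0"
    "\<And>n. e (Suc n) \<bullet> \<phi> (Suc n) = \<phi> n \<bullet> d (Suc n)" using comparison_map[OF p q] by metis
  obtain \<psi> where \<psi>: "\<And>n. arr (\<psi> n) (Q n) (P n)" "d 0 \<bullet> \<psi> 0 = e 0"
    "\<And>n. d (Suc n) \<bullet> \<psi> (Suc n) = \<psi> n \<bullet> e (Suc n)" using comparison_map[OF q p] by metis
  define \<theta> where "\<theta> n = \<psi> n \<bullet> \<phi> n" for n
  have \<theta>: "arr (\<theta> n) (P n) (P n)" for n unfolding \<theta>_def using comp_arr \<phi> \<psi> by blast
  have \<theta>0: "d 0 \<bullet> \<theta> 0 = d 0"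
    unfolding \<theta>_def using comp_assoc[OF \<phi>(1) \<psi>(1) P(2)] \<phi> \<psi> by simp
  have \<theta>S: "d (Suc n) \<bullet> \<theta> (Suc n) = \<theta> n \<bullet> d (Suc n)" for n
    unfolding \<theta>_def using comp_assoc[OF \<phi>(1) \<psi>(1) P(3)] comp_assoc[OF \<phi>(1) Q(3) \<psi>(1)]
      comp_assoc[OF P(3) \<phi>(1) \<psi>(1)] \<phi>(3) \<psi>(3) by simp
  obtain s where s: "\<And>n. arr (s n) (P n) (P (Suc n))"
    "\<And>n. \<theta> (Suc n) = (d (Suc (Suc n)) \<bullet> s (Suc n)) \<boxplus>\<^bsub>P (Suc n),P (Suc n)\<^esub>
           (Ident \<C> (P (Suc n)) \<boxplus>\<^bsub>P (Suc n),P (Suc n)\<^esub> (s n \<bullet> d (Suc n)))"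
    using comparison_homotopy[OF p \<theta> \<theta>0 \<theta>S] by metis
  let ?k = "Suc m"
  note i = id_arr[OF P(4)[of ?k]] and sd = comp_arr[OF P(3)[of m] s(1)[of m]]
  have hp: "arr (h \<bullet> \<psi> ?k) (Q ?k) N" using comp_arr h \<psi> by blast
  have N: "N \<in> Obj \<C>" using h arrD by blast
  have "(h \<bullet> \<psi> ?k) \<bullet> e (Suc ?k) = (h \<bullet> d (Suc ?k)) \<bullet> \<psi> (Suc ?k)"
    using comp_assoc[OF Q(3) \<psi>(1) h(1)] comp_assoc[OF \<psi>(1) P(3) h(1)] \<psi>(3) by simp
  then have "(h \<bullet> \<psi> ?k) \<bullet> e (Suc ?k) = zero_mor (Q (Suc ?k)) N"
    using h(2) zero_comp[OF \<psi>(1)] N by simp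
  then obtain u where u: "arr u (Q m) N" "h \<bullet> \<psi> ?k = u \<bullet> e ?k"
    using exact_atD[OF ex hp] by metis
  note u\<phi> = comp_arr[OF \<phi>(1) u(1)] and hs = comp_arr[OF s(1) h(1)]
  have "h \<bullet> \<theta> ?k = (u \<bullet> \<phi> m) \<bullet> d ?k"
    unfolding \<theta>_def using comp_assoc[OF \<phi>(1) \<psi>(1) h(1)] u comp_assoc[OF \<phi>(1) Q(3) u(1)] \<phi>(3)
      comp_assoc[OF P(3) \<phi>(1) u(1)] by simp
  moreover have "h \<bullet> \<theta> ?k = h \<boxplus>\<^bsub>P ?k,N\<^esub> ((h \<bullet> s m) \<bullet> d ?k)"
  proof -
    have 1: "h \<bullet> (d (Suc ?k) \<bullet> s ?k) = zero_mor (P ?k) N"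
      using comp_assoc[OF s(1) P(3) h(1)] h(2) zero_comp[OF s(1)] N by simp
    have "h \<bullet> \<theta> ?k = (h \<bullet> (d (Suc ?k) \<bullet> s ?k)) \<boxplus>\<^bsub>P ?k,N\<^esub> (h \<boxplus>\<^bsub>P ?k,N\<^esub> (h \<bullet> (s m \<bullet> d ?k)))"
      using s(2)[of m] comp_add[OF comp_arr[OF s(1) P(3)] add_arr[OF i sd] h(1)] comp_add[OF i sd h(1)]
        comp_id[OF h(1)] by simp
    also have "\<dots> = h \<boxplus>\<^bsub>P ?k,N\<^esub> (h \<bullet> (s m \<bullet> d ?k))"
      using 1 zero_add[OF add_arr[OF h(1) comp_arr[OF sd h(1)]]] by simp
    finally show ?thesis using comp_assoc[OF P(3) s(1) h(1)] by simp
  qed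
  ultimately have eq: "h \<boxplus>\<^bsub>P ?k,N\<^esub> ((h \<bullet> s m) \<bullet> d ?k) = (u \<bullet> \<phi> m) \<bullet> d ?k" by simp
  let ?v = "(u \<bullet> \<phi> m) \<boxplus>\<^bsub>P m,N\<^esub> neg_mor (P m) N (h \<bullet> s m)"
  note n = neg_arr[OF hs] and c = comp_arr[OF P(3) hs]
  have v: "arr ?v (P m) N" using add_arr u\<phi> n by blast
  have "?v \<bullet> d ?k \<boxplus>\<^bsub>P ?k,N\<^esub> ((h \<bullet> s m) \<bullet> d ?k) = (?v \<boxplus>\<^bsub>P m,N\<^esub> (h \<bullet> s m)) \<bullet> d ?k"
    using add_comp[OF P(3) v hs] by simp
  also have "?v \<boxplus>\<^bsub>P m,N\<^esub> (h \<bullet> s m) = u \<bullet> \<phi> m"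
    using add_assoc[OF u\<phi> n hs] neg_add[OF hs] add_zero[OF u\<phi>] by simp
  finally have "h = ?v \<bullet> d ?k"
    using eq add_cancel[OF h(1) comp_arr[OF P(3) v] c] by simp
  then show "\<exists>u. arr u (P m) N \<and> h = u \<bullet> d ?k" using v by blast
qed

lemma precomp_hom:
  assumes "arr a A B" "N \<in> Obj \<C>"
  shows "group_hom (Hom \<C> B N) (Hom \<C> A N) (\<lambda>h. h \<bullet> a)"
proof (rule group_hom.intro)
  have o: "A \<in> Obj \<C>" "B \<in> Obj \<C>" using assms arrD by blast+
  show "group (Hom \<C> B N)" "group (Hom \<C> A N)"
    using Hom_comm_group o assms comm_group.axioms(2) by blast+
  have "h \<bullet> a \<in> mor \<C> A N" if "h \<in> mor \<C> B N" for h
    using comp_arr[OF assms(1) arrI[OF o(2) assms(2) that]] arrD by blast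
  moreover have "(h \<boxplus>\<^bsub>B,N\<^esub> h') \<bullet> a = (h \<bullet> a) \<boxplus>\<^bsub>A,N\<^esub> (h' \<bullet> a)" if "h \<in> mor \<C> B N" "h' \<in> mor \<C> B N" for h h'
    using add_comp assms(1) arrI[OF o(2) assms(2)] that by blast
  ultimately show "group_hom_axioms (Hom \<C> B N) (Hom \<C> A N) (\<lambda>h. h \<bullet> a)"
    by (auto simp: group_hom_axioms_def hom_def)
qed

lemma cohomology_trivial_iff:
  assumes p: "proj_res A P d" and N: "N \<in> Obj \<C>"
  shows "trivial_group (cocycles \<C> P d N (Suc m) Mod coboundaries \<C> P d N (Suc m)) \<longleftrightarrow> exact_at P d N m"
proof -
  note P = proj_resD[OF p]
  let ?G = "Hom \<C> (P (Suc m)) N" and ?z = "\<lambda>h. h \<bullet> d (Suc (Suc m))" and ?b = "\<lambda>h. h \<bullet> d (Suc m)"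
  define Z where "Z = kernel ?G (Hom \<C> (P (Suc (Suc m))) N) ?z"
  define B where "B = ?b ` mor \<C> (P m) N"
  interpret G: comm_group ?G using Hom_comm_group P N by blast
  interpret z: group_hom ?G "Hom \<C> (P (Suc (Suc m))) N" ?z by (rule precomp_hom[OF P(3) N])
  interpret b: group_hom "Hom \<C> (P m) N" ?G ?b by (rule precomp_hom[OF P(3) N])
  have Zs: "subgroup Z ?G" unfolding Z_def by (rule z.subgroup_kernel)
  have Bs: "subgroup B ?G" unfolding B_def by (rule b.img_is_subgroup)
  have BZ: "B \<subseteq> Z"
  proof
    fix h assume "h \<in> B"
    then obtain u where u: "arr u (P m) N" "h = u \<bullet> d (Suc m)" using P N by (auto simp: B_def arr_def)
    have "h \<bullet> d (Suc (Suc m)) = zero_mor (P (Suc (Suc m))) N"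
      using comp_assoc[OF P(3) P(3) u(1)] u P(7) comp_zero[OF u(1) P(4)] by simp
    then show "h \<in> Z" unfolding Z_def kernel_def using comp_arr[OF P(3) u(1)] u arrD by simp
  qed
  let ?C = "cocycles \<C> P d N (Suc m)"
  have C: "?C = ?G\<lparr>carrier := Z\<rparr>" by (simp add: cocycles_def Z_def)
  have cb: "coboundaries \<C> P d N (Suc m) = B" by (simp add: coboundaries_def B_def)
  interpret C: comm_group ?C unfolding C
    by (rule group.group_comm_groupI[OF subgroup.subgroup_is_group[OF Zs G.is_group]])
      (use subgroup.mem_carrier[OF Zs] G.m_comm in auto)
  have BC: "subgroup B ?C" unfolding C using G.subgroup_incl[OF Bs Zs BZ] .
  have carC: "carrier ?C = Z" by (simp add: C)
  interpret Q: comm_group "?C Mod B" by (rule C.abelian_FactGroup[OF BC])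
  have "trivial_group (?C Mod B) \<longleftrightarrow> (\<forall>h\<in>Z. B #>\<^bsub>?C\<^esub> h = B)"
    unfolding Q.trivial_group_subset carrier_FactGroup one_FactGroup carC by blast
  also have "\<dots> \<longleftrightarrow> Z \<subseteq> B"
    using C.coset_join1[OF _ _ BC] C.coset_join2[OF _ BC] C.is_group subgroup.subset[OF BC] carC by blast
  also have "\<dots> \<longleftrightarrow> exact_at P d N m"
    unfolding exact_at_def Z_def B_def kernel_def using P N by (auto simp: arr_def)
  finally show ?thesis using cb by simp
qed

end

context enough_proper_class
begin

lemma proj_resolution_exists:
  assumes "A \<in> Obj \<C>"
  obtains P d where "proj_resolution \<C> \<xi> A = (P, d)" "proj_res A P d"
proof -
  have "\<exists>K x X y \<delta>. (K, x, X, y, M, \<delta>) \<in> \<xi> \<and> X \<in> projectives \<C> \<xi> \<and> K \<in> Obj \<C>"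
    if "M \<in> Obj \<C>" for M using enough that xiD(4) unfolding enough_projectives_def by meson
  from resolution_exists[OF this assms] obtain X d K g f where
    "\<And>i. X i \<in> projectives \<C> \<xi>" "resolution_triangles \<C> \<xi> A X d K g f" by metis
  then have "proj_res A X d" unfolding is_resolution_def by blast
  then have "\<exists>r. case r of (P, d) \<Rightarrow> proj_res A P d" by auto
  from someI_ex[OF this] show ?thesis
    using that unfolding proj_resolution_def by (auto split: prod.splits)
qed

lemma xt_trivial_iff:
  assumes p: "proj_res A P d" and N: "N \<in> Obj \<C>"
  shows "trivial_group (xt \<C> \<xi> (Suc m) A N) \<longleftrightarrow> exact_at P d N m"
proof -
  obtain Q e where q: "proj_resolution \<C> \<xi> A = (Q, e)" "proj_res A Q e"
    using proj_resolution_exists proj_resD(5)[OF p] .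
  have "trivial_group (xt \<C> \<xi> (Suc m) A N) \<longleftrightarrow> exact_at Q e N m"
    unfolding xt_def q(1) Let_def using cohomology_trivial_iff[OF q(2) N] by simp
  then show ?thesis using exact_at_independent p q(2) by blast
qed

text \<open>Dimension shifting: the tail of a resolution of \<open>A\<close> resolves the syzygy.\<close>

lemma xt_syzygy:
  assumes r: "resolution_triangles \<C> \<xi> A P d K g f" and P: "\<And>i. P i \<in> projectives \<C> \<xi>"
    and N: "N \<in> Obj \<C>" and "1 \<le> i"
  shows "trivial_group (xt \<C> \<xi> (n + i) A N) \<longleftrightarrow> trivial_group (xt \<C> \<xi> i (K n) N)"
proof -
  obtain m where i: "i = Suc m" using assms(4) by (cases i) auto
  let ?d = "\<lambda>k. if k = 0 then f n else d (n + k)"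
  have 1: "proj_res A P d" using r P unfolding is_resolution_def by blast
  have 2: "proj_res (K n) (\<lambda>k. P (n + k)) ?d"
    using resolution_triangles_tail[OF r, of n] P unfolding is_resolution_def by blast
  have "exact_at P d N (n + m) \<longleftrightarrow> exact_at (\<lambda>k. P (n + k)) ?d N m" by (simp add: exact_at_def)
  then show ?thesis using xt_trivial_iff[OF 1 N, of "n + m"] xt_trivial_iff[OF 2 N, of m] i by simp
qed

text \<open>The relevant piece of the long exact sequence of \<open>\<C>(P, N') \<rightarrow> \<C>(P, H) \<rightarrow> \<C>(P, N)\<close>.\<close>

lemma xt_second_variable:
  assumes t: "(N', x, H, y, N, \<delta>) \<in> \<xi>" and A: "A \<in> Obj \<C>" and "1 \<le> k"
    and H: "trivial_group (xt \<C> \<xi> k A H)" and N': "trivial_group (xt \<C> \<xi> (Suc k) A N')"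
  shows "trivial_group (xt \<C> \<xi> k A N)"
proof -
  obtain m where k: "k = Suc m" using assms(3) by (cases k) auto
  obtain P d where p: "proj_res A P d" using proj_resolution_exists[OF A] by blast
  note P = proj_resD[OF p] and T = xiD[OF t]
  have eH: "exact_at P d H m" and eN': "exact_at P d N' k"
    using xt_trivial_iff[OF p] H N' T k by auto
  have "exact_at P d N m" unfolding exact_at_def
  proof (intro allI impI, elim conjE)
    fix h assume h: "arr h (P (Suc m)) N" "h \<bullet> d (Suc (Suc m)) = zero_mor (P (Suc (Suc m))) N"
    have ho: "arr h (P k) N" using h k by simp
    obtain h' where h': "arr h' (P k) H" "y \<bullet> h' = h" using projective_lift[OF P(1) t ho] .
    note hd = comp_arr[OF P(3)[of k] h'(1)]
    have "y \<bullet> (h' \<bullet> d (Suc k)) = zero_mor (P (Suc k)) N"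
      using comp_assoc[OF P(3)[of k] h'(1) T(2)] h' h k by simp
    then obtain w where w: "arr w (P (Suc k)) N'" "h' \<bullet> d (Suc k) = x \<bullet> w"
      using weak_kernel[OF xi_etriangle[OF t] hd] by metis
    note z = zero_arr[OF P(4)[of "Suc (Suc k)"] T(4)] and wd = comp_arr[OF P(3)[of "Suc k"] w(1)]
    have "x \<bullet> (w \<bullet> d (Suc (Suc k))) = (h' \<bullet> d (Suc k)) \<bullet> d (Suc (Suc k))"
      using comp_assoc[OF P(3)[of "Suc k"] w(1) T(1)] w by simp
    also have "\<dots> = zero_mor (P (Suc (Suc k))) H"
      using comp_assoc[OF P(3)[of "Suc k"] P(3)[of k] h'(1)] P(7) comp_zero[OF h'(1) P(4)] by simp
    also have "\<dots> = x \<bullet> zero_mor (P (Suc (Suc k))) N'" using comp_zero[OF T(1) P(4)] by simp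
    finally have "w \<bullet> d (Suc (Suc k)) = zero_mor (P (Suc (Suc k))) N'"
      using projective_cancel[OF P(1) t wd z] by blast
    then obtain u where u: "arr u (P k) N'" "w = u \<bullet> d (Suc k)" using exact_atD[OF eN' w(1)] by metis
    let ?n = "neg_mor (P k) N' u"
    note n = neg_arr[OF u(1)]
    note xn = comp_arr[OF n T(1)] and xu = comp_arr[OF u(1) T(1)]
    let ?h = "h' \<boxplus>\<^bsub>P k,H\<^esub> (x \<bullet> ?n)"
    have hh: "arr ?h (P k) H" using add_arr h' xn by blast
    have "h' \<bullet> d (Suc k) = (x \<bullet> u) \<bullet> d (Suc k)" using w u comp_assoc[OF P(3) u(1) T(1)] by simp
    then have "?h \<bullet> d (Suc k) = ((x \<bullet> u) \<boxplus>\<^bsub>P k,H\<^esub> (x \<bullet> ?n)) \<bullet> d (Suc k)"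
      using add_comp[OF P(3) h'(1) xn] add_comp[OF P(3) xu xn] by simp
    also have "(x \<bullet> u) \<boxplus>\<^bsub>P k,H\<^esub> (x \<bullet> ?n) = zero_mor (P k) H"
      using comp_add[OF u(1) n T(1)] add_neg[OF u(1)] comp_zero[OF T(1) P(4)] by simp
    finally have "?h \<bullet> d (Suc k) = zero_mor (P (Suc k)) H" using zero_comp[OF P(3)] T by simp
    then obtain v where v: "arr v (P m) H" "?h = v \<bullet> d (Suc m)"
      using exact_atD[OF eH, of ?h] hh k by auto
    have "y \<bullet> (x \<bullet> ?n) = zero_mor (P k) N"
      using comp3_zero[OF n T(1,2) comp_inflation_deflation[OF xi_etriangle[OF t]]] .
    then have "y \<bullet> ?h = h" using comp_add[OF h'(1) xn T(2)] h' add_zero[OF ho] by simp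
    then have "h = (y \<bullet> v) \<bullet> d (Suc m)" using v comp_assoc[OF P(3) v(1) T(2)] by simp
    then show "\<exists>u. arr u (P m) N \<and> h = u \<bullet> d (Suc m)" using comp_arr[OF v(1) T(2)] by blast
  qed
  then show ?thesis using xt_trivial_iff[OF p] T k by blast
qed

end


section \<open>Morphisms seen by projective objects\<close>

text \<open>Natural transformations from \<open>\<C>(_, A)\<close> to \<open>\<C>(_, N)\<close>, both restricted to projective objects.  For a
  projective resolution \<open>P\<close> of \<open>A\<close> they correspond to the morphisms \<open>P 0 \<rightarrow> N\<close> which vanish on \<open>P 1\<close>, so
  they form \<open>\<xi>xt\<^sup>0(A, N)\<close>.  They need not come from morphisms \<open>A \<rightarrow> N\<close>, and since a deflation need
  not be an epimorphism, distinct morphisms may induce the same transformation.  This description of \<open>\<xi>xt\<^sup>0\<close> involves no choice of a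
  resolution and is functorial in \<open>A\<close>.\<close>

definition (in proper_class) restricted_map :: "'o \<Rightarrow> 'o \<Rightarrow> ('o \<Rightarrow> 'm \<Rightarrow> 'm) \<Rightarrow> bool" where
  "restricted_map A N t \<longleftrightarrow>
     (\<forall>Q u. Q \<in> projectives \<C> \<xi> \<and> arr u Q A \<longrightarrow> arr (t Q u) Q N) \<and>
     (\<forall>Q u v. Q \<in> projectives \<C> \<xi> \<and> arr u Q A \<and> arr v Q A \<longrightarrow>
        t Q (u \<boxplus>\<^bsub>Q,A\<^esub> v) = t Q u \<boxplus>\<^bsub>Q,N\<^esub> t Q v) \<and>
     (\<forall>Q Q' u v. Q \<in> projectives \<C> \<xi> \<and> Q' \<in> projectives \<C> \<xi> \<and> arr u Q A \<and> arr v Q' Q \<longrightarrow>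
        t Q' (u \<bullet> v) = t Q u \<bullet> v)"

context enough_proper_class
begin

lemma restricted_map_zero:
  assumes "restricted_map A N t" "Q \<in> projectives \<C> \<xi>" "A \<in> Obj \<C>"
  shows "t Q (zero_mor Q A) = zero_mor Q N"
proof -
  note z = zero_arr[OF projective_obj[OF assms(2)] assms(3)]
  have tz: "arr (t Q (zero_mor Q A)) Q N" using assms z unfolding restricted_map_def by blast
  have "t Q (zero_mor Q A \<boxplus>\<^bsub>Q,A\<^esub> zero_mor Q A) = t Q (zero_mor Q A) \<boxplus>\<^bsub>Q,N\<^esub> t Q (zero_mor Q A)"
    using assms(1,2) z unfolding restricted_map_def by blast
  then have "t Q (zero_mor Q A) \<boxplus>\<^bsub>Q,N\<^esub> t Q (zero_mor Q A) = zero_mor Q N \<boxplus>\<^bsub>Q,N\<^esub> t Q (zero_mor Q A)"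
    using zero_add[OF z] zero_add[OF tz] by simp
  then show ?thesis using add_cancel[OF tz _ tz] zero_arr arrD[OF tz] by blast
qed

text \<open>The part \<open>\<xi>xt\<^sup>0(B, N) \<rightarrow> \<xi>xt\<^sup>0(A, N) \<rightarrow> \<xi>xt\<^sup>1(C, N)\<close> of the long exact sequence.  A morphism \<open>b\<close> from a
  projective object to \<open>B\<close> is a sum \<open>x \<bullet> a + q \<bullet> v\<close> with \<open>v\<close> a morphism to the projective cover \<open>P 0\<close> of
  \<open>C\<close>.  The given transformation prescribes the value on \<open>x \<bullet> a\<close>.  By vanishing of \<open>\<xi>xt\<^sup>1\<close> the
  transformation which it induces on the first syzygy of \<open>C\<close> is the restriction of some \<open>u : P 0 \<rightarrow> N\<close>,
  and \<open>u \<bullet> v\<close> is taken as the value on \<open>q \<bullet> v\<close>; the choice of \<open>u\<close> makes the sum independent of the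
  decomposition.\<close>

lemma restricted_map_extends:
  assumes tr: "(A, x, B, y, C, \<delta>) \<in> \<xi>" and N: "N \<in> Obj \<C>"
    and xt: "trivial_group (xt \<C> \<xi> 1 C N)" and t: "restricted_map A N t"
  obtains s where "restricted_map B N s"
    "\<And>Q u. Q \<in> projectives \<C> \<xi> \<Longrightarrow> arr u Q A \<Longrightarrow> s Q (x \<bullet> u) = t Q u"
proof -
  note T = xiD[OF tr]
  obtain P d where p: "proj_res C P d" using proj_resolution_exists[OF T(6)] by blast
  obtain K g f where r: "resolution_triangles \<C> \<xi> C P d K g f"
    using p unfolding is_resolution_def by blast
  note PP = proj_resD[OF p] and R = resolution_arr[OF r]
  have e: "K 0 = C" "d 0 = f 0" "d (Suc n) = g n \<bullet> f (Suc n)" for n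
    using r by (auto simp: resolution_triangles_def)
  obtain \<epsilon> where c: "(K (Suc 0), g 0, P 0, f 0, C, \<epsilon>) \<in> \<xi>"
    using resolution_triangle[OF r, of 0] e by metis
  obtain \<epsilon>' where c': "(K (Suc (Suc 0)), g (Suc 0), P (Suc 0), f (Suc 0), K (Suc 0), \<epsilon>') \<in> \<xi>"
    using resolution_triangle[OF r] .
  note c0 = xiD[OF c] and c1 = xiD[OF c']
  have t1: "arr (t Q u) Q N" if "Q \<in> projectives \<C> \<xi>" "arr u Q A" for Q u
    using t that unfolding restricted_map_def by blast
  have t2: "t Q (u \<boxplus>\<^bsub>Q,A\<^esub> v) = t Q u \<boxplus>\<^bsub>Q,N\<^esub> t Q v"
    if "Q \<in> projectives \<C> \<xi>" "arr u Q A" "arr v Q A" for Q u v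
    using t that unfolding restricted_map_def by blast
  have t3: "t Q' (u \<bullet> v) = t Q u \<bullet> v"
    if "Q \<in> projectives \<C> \<xi>" "Q' \<in> projectives \<C> \<xi>" "arr u Q A" "arr v Q' Q" for Q Q' u v
    using t that unfolding restricted_map_def by blast
  \<comment> \<open>The projective cover of \<open>C\<close> maps to the given triangle.\<close>
  obtain q where q: "arr q (P 0) B" "y \<bullet> q = f 0" using projective_lift[OF PP(1) tr c0(2)] .
  have "y \<bullet> (q \<bullet> g 0) = zero_mor (K (Suc 0)) C"
    using comp_assoc[OF c0(1) q(1) T(2)] q comp_inflation_deflation[OF xi_etriangle[OF c]] by simp
  from weak_kernel[OF xi_etriangle[OF tr] comp_arr[OF c0(1) q(1)] this]
  obtain k where k: "arr k (K (Suc 0)) A" "q \<bullet> g 0 = x \<bullet> k" by metis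
  \<comment> \<open>The resulting cocycle on \<open>P 1\<close> is a coboundary.\<close>
  let ?kf = "k \<bullet> f (Suc 0)"
  note kf = comp_arr[OF c1(2) k(1)]
  have "t (P (Suc 0)) ?kf \<bullet> d (Suc (Suc 0)) = t (P (Suc (Suc 0))) (?kf \<bullet> d (Suc (Suc 0)))"
    using t3[OF PP(1) PP(1) kf PP(3)] by simp
  also have "?kf \<bullet> d (Suc (Suc 0)) = zero_mor (P (Suc (Suc 0))) A"
    using comp_assoc[OF PP(3) c1(2) k(1)] R(6)[of "Suc 0"] comp_zero[OF k(1) PP(4)] by simp
  also have "t (P (Suc (Suc 0))) (zero_mor (P (Suc (Suc 0))) A) = zero_mor (P (Suc (Suc 0))) N"
    using restricted_map_zero[OF t PP(1) T(4)] .
  finally have cocycle: "t (P (Suc 0)) ?kf \<bullet> d (Suc (Suc 0)) = zero_mor (P (Suc (Suc 0))) N" .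
  have "exact_at P d N 0" using xt_trivial_iff[OF p N, of 0] xt by simp
  from exact_atD[OF this t1[OF PP(1) kf] cocycle]
  obtain u where u: "arr u (P 0) N" "t (P (Suc 0)) ?kf = u \<bullet> d (Suc 0)" .
  have tk: "t Q (k \<bullet> w) = u \<bullet> (g 0 \<bullet> w)" if Q: "Q \<in> projectives \<C> \<xi>" and w: "arr w Q (K (Suc 0))" for Q w
  proof -
    obtain v where v: "arr v Q (P (Suc 0))" "f (Suc 0) \<bullet> v = w" using projective_lift[OF Q c' w] .
    have "t Q (k \<bullet> w) = t (P (Suc 0)) ?kf \<bullet> v"
      using comp_assoc[OF v(1) c1(2) k(1)] v t3[OF PP(1) Q kf v(1)] by simp
    also have "\<dots> = u \<bullet> (d (Suc 0) \<bullet> v)" using u comp_assoc[OF v(1) PP(3) u(1)] by simp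
    finally show ?thesis using e(3)[of 0] comp_assoc[OF v(1) c1(2) c0(1)] v by simp
  qed
  define R where "R Q b n \<longleftrightarrow> (\<exists>a v. arr a Q A \<and> arr v Q (P 0) \<and>
      b = (x \<bullet> a) \<boxplus>\<^bsub>Q,B\<^esub> (q \<bullet> v) \<and> n = t Q a \<boxplus>\<^bsub>Q,N\<^esub> (u \<bullet> v))" for Q b n
  have ex: "\<exists>n. R Q b n" if Q: "Q \<in> projectives \<C> \<xi>" and b: "arr b Q B" for Q b
  proof -
    obtain v where v: "arr v Q (P 0)" "f 0 \<bullet> v = y \<bullet> b"
      using projective_lift[OF Q c comp_arr[OF b T(2)]] .
    have "y \<bullet> b = y \<bullet> (q \<bullet> v)" using comp_assoc[OF v(1) q(1) T(2)] q v by simp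
    then show ?thesis
      using weak_kernel_diff[OF xi_etriangle[OF tr] b comp_arr[OF v(1) q(1)]] v(1)
      unfolding R_def by metis
  qed
  have un: "n = n'" if Q: "Q \<in> projectives \<C> \<xi>" and nn: "R Q b n" "R Q b n'" for Q b n n'
  proof -
    obtain a v where a: "arr a Q A" "arr v Q (P 0)" "b = (x \<bullet> a) \<boxplus>\<^bsub>Q,B\<^esub> (q \<bullet> v)" "n = t Q a \<boxplus>\<^bsub>Q,N\<^esub> (u \<bullet> v)"
      using nn unfolding R_def by blast
    obtain a' v' where a': "arr a' Q A" "arr v' Q (P 0)" "b = (x \<bullet> a') \<boxplus>\<^bsub>Q,B\<^esub> (q \<bullet> v')"
      "n' = t Q a' \<boxplus>\<^bsub>Q,N\<^esub> (u \<bullet> v')"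
      using nn unfolding R_def by blast
    have yb: "y \<bullet> ((x \<bullet> a) \<boxplus>\<^bsub>Q,B\<^esub> (q \<bullet> v)) = f 0 \<bullet> v" if "arr a Q A" "arr v Q (P 0)" for a v
      using comp_add[OF comp_arr[OF that(1) T(1)] comp_arr[OF that(2) q(1)] T(2)]
        comp3_zero[OF that(1) T(1,2) comp_inflation_deflation[OF xi_etriangle[OF tr]]]
        comp_assoc[OF that(2) q(1) T(2)] q zero_add[OF comp_arr[OF that(2) c0(2)]] by simp
    have "f 0 \<bullet> v = f 0 \<bullet> v'" using yb[OF a(1,2)] yb[OF a'(1,2)] a a' by simp
    then obtain w where w: "arr w Q (K (Suc 0))" "v = (g 0 \<bullet> w) \<boxplus>\<^bsub>Q,P 0\<^esub> v'"
      using weak_kernel_diff[OF xi_etriangle[OF c] a(2) a'(2)] by metis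
    note gw = comp_arr[OF w(1) c0(1)] and kw = comp_arr[OF w(1) k(1)]
    note qv = comp_arr[OF a'(2) q(1)] and uv = comp_arr[OF a'(2) u(1)]
    have "q \<bullet> v = (x \<bullet> (k \<bullet> w)) \<boxplus>\<^bsub>Q,B\<^esub> (q \<bullet> v')"
      using w comp_add[OF gw a'(2) q(1)] comp_assoc[OF w(1) c0(1) q(1)] k comp_assoc[OF w(1) k(1) T(1)]
      by simp
    then have "(x \<bullet> a') \<boxplus>\<^bsub>Q,B\<^esub> (q \<bullet> v') = (x \<bullet> (a \<boxplus>\<^bsub>Q,A\<^esub> (k \<bullet> w))) \<boxplus>\<^bsub>Q,B\<^esub> (q \<bullet> v')"
      using a a' comp_add[OF a(1) kw T(1)] add_assoc[OF comp_arr[OF a(1) T(1)] comp_arr[OF kw T(1)] qv]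
      by simp
    then have "x \<bullet> a' = x \<bullet> (a \<boxplus>\<^bsub>Q,A\<^esub> (k \<bullet> w))"
      using add_cancel[OF comp_arr[OF a'(1) T(1)] comp_arr[OF add_arr[OF a(1) kw] T(1)] qv] by blast
    then have "a' = a \<boxplus>\<^bsub>Q,A\<^esub> (k \<bullet> w)"
      using projective_cancel[OF Q tr a'(1) add_arr[OF a(1) kw]] by blast
    then have "n' = (t Q a \<boxplus>\<^bsub>Q,N\<^esub> (u \<bullet> (g 0 \<bullet> w))) \<boxplus>\<^bsub>Q,N\<^esub> (u \<bullet> v')"
      using a' t2[OF Q a(1) kw] tk[OF Q w(1)] by simp
    also have "\<dots> = t Q a \<boxplus>\<^bsub>Q,N\<^esub> (u \<bullet> v)"
      using add_assoc[OF t1[OF Q a(1)] comp_arr[OF gw u(1)] uv] comp_add[OF gw a'(2) u(1)] w by simp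
    finally show ?thesis using a by simp
  qed
  define s where "s Q b = (SOME n. R Q b n)" for Q b
  have s: "R Q b (s Q b)" if "Q \<in> projectives \<C> \<xi>" "arr b Q B" for Q b
    unfolding s_def using someI_ex[OF ex[OF that]] .
  have RN: "arr n Q N" if "Q \<in> projectives \<C> \<xi>" "R Q b n" for Q b n
    using that t1 comp_arr[OF _ u(1)] add_arr unfolding R_def by blast
  have Radd: "R Q (b \<boxplus>\<^bsub>Q,B\<^esub> b') (n \<boxplus>\<^bsub>Q,N\<^esub> n')" if Q: "Q \<in> projectives \<C> \<xi>" and nn: "R Q b n" "R Q b' n'"
    for Q b b' n n'
  proof -
    obtain a v where a: "arr a Q A" "arr v Q (P 0)" "b = (x \<bullet> a) \<boxplus>\<^bsub>Q,B\<^esub> (q \<bullet> v)" "n = t Q a \<boxplus>\<^bsub>Q,N\<^esub> (u \<bullet> v)"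
      using nn unfolding R_def by blast
    obtain a' v' where a': "arr a' Q A" "arr v' Q (P 0)" "b' = (x \<bullet> a') \<boxplus>\<^bsub>Q,B\<^esub> (q \<bullet> v')"
      "n' = t Q a' \<boxplus>\<^bsub>Q,N\<^esub> (u \<bullet> v')"
      using nn unfolding R_def by blast
    have "b \<boxplus>\<^bsub>Q,B\<^esub> b' = (x \<bullet> (a \<boxplus>\<^bsub>Q,A\<^esub> a')) \<boxplus>\<^bsub>Q,B\<^esub> (q \<bullet> (v \<boxplus>\<^bsub>Q,P 0\<^esub> v'))"
      using a a' comp_add[OF a(1) a'(1) T(1)] comp_add[OF a(2) a'(2) q(1)]
        add_middle[OF comp_arr[OF a(1) T(1)] comp_arr[OF a(2) q(1)]
          comp_arr[OF a'(1) T(1)] comp_arr[OF a'(2) q(1)]] by simp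
    moreover have "n \<boxplus>\<^bsub>Q,N\<^esub> n' = t Q (a \<boxplus>\<^bsub>Q,A\<^esub> a') \<boxplus>\<^bsub>Q,N\<^esub> (u \<bullet> (v \<boxplus>\<^bsub>Q,P 0\<^esub> v'))"
      using a a' t2[OF Q a(1) a'(1)] comp_add[OF a(2) a'(2) u(1)]
        add_middle[OF t1[OF Q a(1)] comp_arr[OF a(2) u(1)] t1[OF Q a'(1)] comp_arr[OF a'(2) u(1)]]
      by simp
    ultimately show ?thesis unfolding R_def using add_arr[OF a(1) a'(1)] add_arr[OF a(2) a'(2)] by blast
  qed
  have Rnat: "R Q' (b \<bullet> w) (n \<bullet> w)"
    if Q: "Q \<in> projectives \<C> \<xi>" "Q' \<in> projectives \<C> \<xi>" and w: "arr w Q' Q" and n: "R Q b n" for Q Q' b w n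
  proof -
    obtain a v where a: "arr a Q A" "arr v Q (P 0)" "b = (x \<bullet> a) \<boxplus>\<^bsub>Q,B\<^esub> (q \<bullet> v)" "n = t Q a \<boxplus>\<^bsub>Q,N\<^esub> (u \<bullet> v)"
      using n unfolding R_def by blast
    have "b \<bullet> w = (x \<bullet> (a \<bullet> w)) \<boxplus>\<^bsub>Q',B\<^esub> (q \<bullet> (v \<bullet> w))"
      using a add_comp[OF w comp_arr[OF a(1) T(1)] comp_arr[OF a(2) q(1)]]
        comp_assoc[OF w a(1) T(1)] comp_assoc[OF w a(2) q(1)] by simp
    moreover have "n \<bullet> w = t Q' (a \<bullet> w) \<boxplus>\<^bsub>Q',N\<^esub> (u \<bullet> (v \<bullet> w))"
      using a add_comp[OF w t1[OF Q(1) a(1)] comp_arr[OF a(2) u(1)]] t3[OF Q a(1) w]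
        comp_assoc[OF w a(2) u(1)] by simp
    ultimately show ?thesis unfolding R_def using comp_arr[OF w a(1)] comp_arr[OF w a(2)] by blast
  qed
  have "restricted_map B N s"
    unfolding restricted_map_def
  proof (intro conjI allI impI; elim conjE)
    fix Q u assume "Q \<in> projectives \<C> \<xi>" "arr u Q B"
    then show "arr (s Q u) Q N" using RN s by blast
  next
    fix Q u v assume Q: "Q \<in> projectives \<C> \<xi>" "arr u Q B" "arr v Q B"
    show "s Q (u \<boxplus>\<^bsub>Q,B\<^esub> v) = s Q u \<boxplus>\<^bsub>Q,N\<^esub> s Q v"
      using un[OF Q(1) s[OF Q(1) add_arr[OF Q(2,3)]] Radd[OF Q(1) s[OF Q(1,2)] s[OF Q(1,3)]]] .
  next
    fix Q Q' u v assume Q: "Q \<in> projectives \<C> \<xi>" "Q' \<in> projectives \<C> \<xi>" "arr u Q B" "arr v Q' Q"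
    show "s Q' (u \<bullet> v) = s Q u \<bullet> v"
      using un[OF Q(2) s[OF Q(2) comp_arr[OF Q(4,3)]] Rnat[OF Q(1,2,4) s[OF Q(1,3)]]] .
  qed
  moreover have "s Q (x \<bullet> a) = t Q a" if Q: "Q \<in> projectives \<C> \<xi>" and a: "arr a Q A" for Q a
  proof -
    note QO = projective_obj[OF Q]
    have z: "arr (zero_mor Q (P 0)) Q (P 0)" using zero_arr QO PP by blast
    have "x \<bullet> a = (x \<bullet> a) \<boxplus>\<^bsub>Q,B\<^esub> (q \<bullet> zero_mor Q (P 0))"
      using comp_zero[OF q(1) QO] add_zero[OF comp_arr[OF a T(1)]] by simp
    moreover have "t Q a = t Q a \<boxplus>\<^bsub>Q,N\<^esub> (u \<bullet> zero_mor Q (P 0))"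
      using comp_zero[OF u(1) QO] add_zero[OF t1[OF Q a]] by simp
    ultimately have "R Q (x \<bullet> a) (t Q a)" unfolding R_def using a z by blast
    then show ?thesis using un[OF Q s[OF Q comp_arr[OF a T(1)]]] by blast
  qed
  ultimately show ?thesis using that by blast
qed

text \<open>The hypothesis on \<open>\<xi>xt\<^sup>0\<close> speaks of one resolution of \<open>A\<close>; evaluation at its augmentation
  translates it into a statement about all transformations.\<close>

lemma xt0_iso_faithful_full:
  assumes A: "A \<in> Obj \<C>" and B: "B \<in> Obj \<C>"
    and iso: "xt0_map \<C> \<xi> A B \<in> iso (Hom \<C> A B) (xt \<C> \<xi> 0 A B)"
  shows "\<And>r r'. arr r A B \<Longrightarrow> arr r' A B \<Longrightarrow>
       (\<And>Q u. Q \<in> projectives \<C> \<xi> \<Longrightarrow> arr u Q A \<Longrightarrow> r \<bullet> u = r' \<bullet> u) \<Longrightarrow> r = r'"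
    and "\<And>t. restricted_map A B t \<Longrightarrow>
       \<exists>r. arr r A B \<and> (\<forall>Q u. Q \<in> projectives \<C> \<xi> \<longrightarrow> arr u Q A \<longrightarrow> t Q u = r \<bullet> u)"
proof -
  obtain P d where q: "proj_resolution \<C> \<xi> A = (P, d)" and p: "proj_res A P d"
    using proj_resolution_exists[OF A] .
  note PP = proj_resD[OF p]
  let ?Z = "cocycles \<C> P d B 0"
  interpret G: comm_group "Hom \<C> (P 0) B" using Hom_comm_group PP(4) B by blast
  have co: "coboundaries \<C> P d B 0 = {zero_mor (P 0) B}" by (simp add: coboundaries_def)
  have coset: "{zero_mor (P 0) B} #>\<^bsub>?Z\<^esub> c = {c}" if "arr c (P 0) B" for c
    using zero_add[OF that] by (simp add: r_coset_def cocycles_def)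
  have map: "xt0_map \<C> \<xi> A B h = {h \<bullet> d 0}" if "arr h A B" for h
    unfolding xt0_map_def q Let_def using coset[OF comp_arr[OF PP(2) that]] co by simp
  have bij: "bij_betw (xt0_map \<C> \<xi> A B) (mor \<C> A B) (carrier (xt \<C> \<xi> 0 A B))"
    using iso by (simp add: iso_def)
  show "r = r'" if r: "arr r A B" "arr r' A B"
    and eq: "\<And>Q u. Q \<in> projectives \<C> \<xi> \<Longrightarrow> arr u Q A \<Longrightarrow> r \<bullet> u = r' \<bullet> u" for r r'
  proof -
    have "xt0_map \<C> \<xi> A B r = xt0_map \<C> \<xi> A B r'"
      using map[OF r(1)] map[OF r(2)] eq[OF PP(1) PP(2)] by simp
    then show ?thesis using bij r by (auto simp: bij_betw_def inj_on_def arr_def)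
  qed
  show "\<exists>r. arr r A B \<and> (\<forall>Q u. Q \<in> projectives \<C> \<xi> \<longrightarrow> arr u Q A \<longrightarrow> t Q u = r \<bullet> u)"
    if t: "restricted_map A B t" for t
  proof -
    let ?c = "t (P 0) (d 0)"
    have nat: "t Q (d 0 \<bullet> v) = ?c \<bullet> v" if "Q \<in> projectives \<C> \<xi>" "arr v Q (P 0)" for Q v
      using t PP(1,2) that unfolding restricted_map_def by blast
    have c: "arr ?c (P 0) B" using t PP(1,2) unfolding restricted_map_def by blast
    have "?c \<bullet> d (Suc 0) = zero_mor (P (Suc 0)) B"
      using nat[OF PP(1) PP(3)] PP(6) restricted_map_zero[OF t PP(1) A] by simp
    then have "?c \<in> carrier ?Z" using c by (simp add: cocycles_def kernel_def arr_def)
    then have "{?c} \<in> carrier (xt \<C> \<xi> 0 A B)"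
      unfolding xt_def q Let_def using coset[OF c] co by (auto simp: carrier_FactGroup)
    then obtain r where "r \<in> mor \<C> A B" "xt0_map \<C> \<xi> A B r = {?c}"
      using bij unfolding bij_betw_def by (metis imageE)
    then have r: "arr r A B" "r \<bullet> d 0 = ?c" using map A B by (auto simp: arr_def)
    have "t Q u = r \<bullet> u" if Q: "Q \<in> projectives \<C> \<xi>" and u: "arr u Q A" for Q u
    proof -
      obtain v where v: "arr v Q (P 0)" "d 0 \<bullet> v = u" using proj_res_lift[OF p Q u] .
      show ?thesis using nat[OF Q v(1)] v r comp_assoc[OF v(1) PP(2) r(1)] by simp
    qed
    then show ?thesis using r by blast
  qed
qed

end


section \<open>Dimension with respect to a quasi-resolving subcategory\<close>

locale quasi_resolving_subcategory = enough_proper_class \<C> \<xi>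
  for \<C> :: "('o, 'm, 'e, 'z) extricat_scheme" (structure)
  and \<xi> :: "('o, 'm, 'e) triangle set" +
  fixes \<X> :: "'o set"
  assumes qr: "quasi_resolving \<C> \<xi> \<X>"
begin

lemma X_obj: "\<X> \<subseteq> Obj \<C>"
  using qr by (simp add: quasi_resolving_def additive_subcategory_def)

lemma X_zero: obtains Z where "Z \<in> \<X>" "zero_object \<C> Z"
  using qr by (auto simp: quasi_resolving_def additive_subcategory_def)

lemma X_extension: "(A, x, B, y, C, \<delta>) \<in> \<xi> \<Longrightarrow> A \<in> \<X> \<Longrightarrow> C \<in> \<X> \<Longrightarrow> B \<in> \<X>"
  using qr unfolding quasi_resolving_def closed_extensions_def by fastforce

lemma X_cocone: "(A, x, B, y, C, \<delta>) \<in> \<xi> \<Longrightarrow> B \<in> \<X> \<Longrightarrow> C \<in> \<X> \<Longrightarrow> A \<in> \<X>"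
  using qr unfolding quasi_resolving_def closed_cocones_def by fastforce

text \<open>Closure under cocones keeps the kernel of a projective cover inside the subcategory.\<close>

lemma X_cover:
  assumes "M \<in> \<X>"
  obtains K x P y \<delta> where "(K, x, P, y, M, \<delta>) \<in> \<xi>" "P \<in> \<X> \<inter> projectives \<C> \<xi>" "K \<in> \<X>"
proof -
  have "M \<in> res \<C> \<xi> (\<X> \<inter> projectives \<C> \<xi>)" using qr assms unfolding quasi_resolving_def by blast
  from res_imp_triangle[OF this] obtain K x P y \<delta> where
    "(K, x, P, y, M, \<delta>) \<in> \<xi>" "P \<in> \<X> \<inter> projectives \<C> \<xi>" by metis
  then show ?thesis using that X_cocone assms by blast
qed

text \<open>Pull the extension back along the first term \<open>X \<rightarrow> K\<close> of a resolution of \<open>K\<close>: the pullback is an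
  extension of \<open>X\<close> by \<open>L\<close>, so it lies in the subcategory, and it maps onto \<open>E\<close> with the same kernel
  as \<open>X \<rightarrow> K\<close>.\<close>

lemma dim_extension_left:
  assumes t: "(L, l, E, e, K, \<delta>) \<in> \<xi>" and L: "L \<in> \<X>" and K: "dim_le m \<X> K"
  shows "dim_le m \<X> E"
proof (cases m)
  case 0 then show ?thesis using K t L X_extension by simp
next
  case (Suc k)
  then obtain K1 x X y \<epsilon> where s: "(K1, x, X, y, K, \<epsilon>) \<in> \<xi>" "X \<in> \<X>" "dim_le k \<X> K1"
    using K by auto
  obtain M a b a' b' \<eta> \<eta>' where "(K1, a, M, b, E, \<eta>) \<in> \<xi>" "(L, a', M, b', X, \<eta>') \<in> \<xi>"
    using pullback_in[OF t s(1)] by metis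
  then show ?thesis using dim_le_SucI X_extension L s Suc by metis
qed

text \<open>Compose \<open>X' \<rightarrow> Y \<rightarrow> X\<close>, where \<open>X' \<rightarrow> Y\<close> starts a resolution of \<open>Y\<close>.  The kernel of the composite lies
  in the subcategory and maps onto \<open>L\<close>.\<close>

lemma dim_cocone:
  assumes t: "(L, l, Y, g, X, \<delta>) \<in> \<xi>" and X: "X \<in> \<X>" and Y: "dim_le m \<X> Y"
  shows "dim_le m \<X> L"
proof (cases m)
  case 0 then show ?thesis using Y t X X_cocone by simp
next
  case (Suc k)
  then obtain K x X' y \<epsilon> where s: "(K, x, X', y, Y, \<epsilon>) \<in> \<xi>" "X' \<in> \<X>" "dim_le k \<X> K"
    using Y by auto
  obtain E a b c \<eta> \<eta>' where "(E, a, X', g \<bullet> y, X, \<eta>) \<in> \<xi>" "(K, b, E, c, L, \<eta>') \<in> \<xi>"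
    using deflations_compose[OF s(1) t] by metis
  then show ?thesis using dim_le_SucI X_cocone X s Suc by metis
qed

text \<open>Base change along a projective cover \<open>P \<rightarrow> X\<close> splits the extension, which gives \<open>Z = K \<oplus> P\<close> mapping
  onto \<open>Y\<close>.  Composing with the first term of a resolution of \<open>Z\<close> leaves a kernel \<open>E\<close> which is again
  an extension of an object of the subcategory, now by an object of smaller dimension.\<close>

lemma dim_extension_right:
  assumes "(K, k, Y, y, X, \<delta>) \<in> \<xi>" and "X \<in> \<X>" and "dim_le m \<X> K"
  shows "dim_le m \<X> Y"
  using assms
proof (induction m arbitrary: K k Y y X \<delta>)
  case 0 then show ?case using X_extension by simp
next
  case (Suc m)
  obtain X' x P p \<epsilon> where c: "(X', x, P, p, X, \<epsilon>) \<in> \<xi>" "P \<in> \<X> \<inter> projectives \<C> \<xi>" "X' \<in> \<X>"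
    using X_cover[OF Suc.prems(2)] .
  obtain Z a b a' b' \<eta> \<eta>' where z: "(X', a, Z, b, Y, \<eta>) \<in> \<xi>" "(K, a', Z, b', P, \<eta>') \<in> \<xi>"
    using pullback_in[OF Suc.prems(1) c(1)] by metis
  obtain j q where "(P, j, Z, q, K, \<one>\<^bsub>EE \<C> K P\<^esub>) \<in> \<xi>"
    using split_swap_in z(2) projective_splits[OF _ z(2)] c(2) by (metis IntD2)
  then have "dim_le (Suc m) \<X> Z" using dim_extension_left c Suc.prems by blast
  then obtain K1 x1 X1 y1 \<epsilon>1 where s: "(K1, x1, X1, y1, Z, \<epsilon>1) \<in> \<xi>" "X1 \<in> \<X>" "dim_le m \<X> K1"
    by auto
  obtain E h d e \<theta> \<theta>' where E: "(E, h, X1, b \<bullet> y1, Y, \<theta>) \<in> \<xi>" "(K1, e, E, d, X', \<theta>') \<in> \<xi>"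
    using deflations_compose[OF s(1) z(1)] by metis
  have "dim_le m \<X> E" using Suc.IH[OF E(2) c(3) s(3)] .
  then show ?case using dim_le_SucI[OF E(1) s(2)] by blast
qed

text \<open>This is Schanuel's lemma: the pullback \<open>Y\<close> of \<open>X \<rightarrow> M\<close> and of the first term \<open>X' \<rightarrow> M\<close> of a
  resolution of length \<open>n\<close> is an extension of \<open>X\<close> by \<open>K\<close>, and \<open>L\<close> is the cocone of \<open>Y \<rightarrow> X'\<close>.  The truncated
  subtraction covers the case \<open>n = 0\<close>, where \<open>L\<close> is itself in the subcategory.\<close>

lemma dim_syzygy_step:
  assumes t: "(L, l, X, p, M, \<delta>) \<in> \<xi>" and X: "X \<in> \<X>" and M: "dim_le n \<X> M"
  shows "dim_le (n - 1) \<X> L"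
proof (cases n)
  case 0 then show ?thesis using M t X X_cocone by simp
next
  case (Suc m)
  then obtain K x X' y \<epsilon> where s: "(K, x, X', y, M, \<epsilon>) \<in> \<xi>" "X' \<in> \<X>" "dim_le m \<X> K"
    using M by auto
  obtain Y a b a' b' \<eta> \<eta>' where "(K, a, Y, b, X, \<eta>) \<in> \<xi>" "(L, a', Y, b', X', \<eta>') \<in> \<xi>"
    using pullback_in[OF t s(1)] by metis
  then show ?thesis using dim_extension_right dim_cocone X s Suc by (metis diff_Suc_1)
qed

lemma dim_cover:
  assumes "dim_le n \<X> M"
  obtains K x P y \<delta> where "(K, x, P, y, M, \<delta>) \<in> \<xi>" "P \<in> \<X> \<inter> projectives \<C> \<xi>" "dim_le (n - 1) \<X> K"
proof -
  have "\<exists>K x P y \<delta>. (K, x, P, y, M, \<delta>) \<in> \<xi> \<and> P \<in> \<X> \<inter> projectives \<C> \<xi>"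
  proof (cases n)
    case 0 then show ?thesis using assms X_cover by (metis has_res.simps(1))
  next
    case (Suc m)
    then obtain K x X y \<epsilon> where s: "(K, x, X, y, M, \<epsilon>) \<in> \<xi>" "X \<in> \<X>" using assms by auto
    obtain L l P p \<eta> where c: "(L, l, P, p, X, \<eta>) \<in> \<xi>" "P \<in> \<X> \<inter> projectives \<C> \<xi>"
      using X_cover[OF s(2)] by metis
    then show ?thesis using deflations_compose[OF c(1) s(1)] by metis
  qed
  then show ?thesis using that dim_syzygy_step[OF _ _ assms] by blast
qed

lemma dim_syzygy:
  assumes r: "resolution_triangles \<C> \<xi> M X d K g f" and X: "\<And>i. X i \<in> \<X>" and M: "dim_le n \<X> M"
  shows "dim_le (n - j) \<X> (K j)"
proof (induction j)
  case 0 then show ?case using r M by (simp add: resolution_triangles_def)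
next
  case (Suc j)
  obtain \<delta> where "(K (Suc j), g j, X j, f j, K j, \<delta>) \<in> \<xi>" using resolution_triangle[OF r] .
  from dim_syzygy_step[OF this X Suc] show ?case by simp
qed

lemma dim_resolution:
  assumes "dim_le n \<X> M"
  obtains X d K g f where "\<And>i. X i \<in> \<X> \<inter> projectives \<C> \<xi>" "resolution_triangles \<C> \<xi> M X d K g f"
proof -
  have step: "\<exists>K x X y \<delta>. (K, x, X, y, M, \<delta>) \<in> \<xi> \<and> X \<in> \<X> \<inter> projectives \<C> \<xi> \<and> K \<in> {M. \<exists>n. dim_le n \<X> M}"
    if M: "M \<in> {M. \<exists>n. dim_le n \<X> M}" for M
  proof -
    obtain k where "dim_le k \<X> M" using M by blast
    from dim_cover[OF this] show ?thesis by (metis mem_Collect_eq)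
  qed
  have "M \<in> {M. \<exists>n. dim_le n \<X> M}" using assms by blast
  from resolution_exists[OF step this] show ?thesis using that by metis
qed

lemma dim_le_iff_syzygies:
  assumes Y: "\<X> \<inter> projectives \<C> \<xi> \<subseteq> \<Y>" "\<Y> \<subseteq> \<X>" and fin: "dim_le m \<X> M"
  shows "dim_le n \<X> M \<longleftrightarrow> (\<forall>i N. is_syzygy \<C> \<xi> \<Y> (n + i) M N \<longrightarrow> N \<in> \<X>)"
proof (intro iffI allI impI)
  fix i N assume M: "dim_le n \<X> M" and "is_syzygy \<C> \<xi> \<Y> (n + i) M N"
  then obtain X d K g f where r: "resolution_triangles \<C> \<xi> M X d K g f" "\<And>i. X i \<in> \<Y>" "K (n + i) = N"
    unfolding is_syzygy_def by blast
  then show "N \<in> \<X>" using dim_syzygy[OF r(1) _ M, of "n + i"] Y by auto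
next
  assume syz: "\<forall>i N. is_syzygy \<C> \<xi> \<Y> (n + i) M N \<longrightarrow> N \<in> \<X>"
  obtain X d K g f where r: "\<And>i. X i \<in> \<X> \<inter> projectives \<C> \<xi>" "resolution_triangles \<C> \<xi> M X d K g f"
    using dim_resolution[OF fin] by metis
  then have "is_syzygy \<C> \<xi> \<Y> (n + 0) M (K n)" unfolding is_syzygy_def using Y by auto blast
  then have "K n \<in> \<X>" using syz by blast
  then show "dim_le n \<X> M" using dim_le_of_syzygy[OF r(2)] r(1) by blast
qed

text \<open>The extension vanishes because it lives in \<open>\<E>(M, K)\<close> with \<open>K\<close> zero.  The reversed split triangle
  \<open>M \<rightarrow> X \<rightarrow> K\<close> then exhibits \<open>M\<close> as a cocone.\<close>

lemma X_of_zero_cocone: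
  assumes t: "(K, k, X, y, M, \<delta>) \<in> \<xi>" and K: "zero_object \<C> K" and X: "X \<in> \<X>"
  shows "M \<in> \<X>"
proof -
  note a = xiD[OF t]
  have "\<delta> = push \<C> (zero_mor K K) \<delta>"
    using push_Ident[OF a(6,4,3)] to_zero[OF K id_arr[OF a(4)]] by simp
  then have "\<delta> = \<one>\<^bsub>EE \<C> M K\<^esub>" using push_zero[OF a(4,4,6,3)] by simp
  then obtain j p where "(M, j, X, p, K, \<one>\<^bsub>EE \<C> K M\<^esub>) \<in> \<xi>" using split_swap_in t by metis
  moreover have "K \<in> \<X>"
    using qr zero_in_subcategory K X_zero unfolding quasi_resolving_def by metis
  ultimately show ?thesis using X_cocone X by blast
qed

end


section \<open>Approximation by an injective cogenerator\<close>

locale resolving_cogenerator = quasi_resolving_subcategory \<C> \<xi> \<X>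
  for \<C> :: "('o, 'm, 'e, 'z) extricat_scheme" (structure)
  and \<xi> :: "('o, 'm, 'e) triangle set"
  and \<X> :: "'o set" +
  fixes \<H> :: "'o set"
  assumes H_additive: "additive_subcategory \<C> \<H>"
    and H_cogenerator: "cogenerator \<xi> \<X> \<H>"
    and H_injective: "xt_injective \<C> \<xi> \<X> \<H>"
begin

lemma H_sub: "\<H> \<subseteq> \<X>"
  using H_cogenerator by (simp add: cogenerator_def)

lemma H_obj: "\<H> \<subseteq> Obj \<C>"
  using H_sub X_obj by blast

lemma H_zero: obtains Z where "Z \<in> \<H>" "zero_object \<C> Z"
  using H_additive by (auto simp: additive_subcategory_def)

lemma X_embeds:
  assumes "X \<in> \<X>"
  obtains x H y X' \<delta> where "(X, x, H, y, X', \<delta>) \<in> \<xi>" "H \<in> \<H>" "X' \<in> \<X>"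
  using H_cogenerator assms unfolding cogenerator_def by blast

lemma xt_X_H: "1 \<le> k \<Longrightarrow> X \<in> \<X> \<Longrightarrow> H \<in> \<H> \<Longrightarrow> trivial_group (xt \<C> \<xi> k X H)"
  using H_injective unfolding xt_injective_def by blast

lemma dim_H_imp_X: "dim_le n \<H> M \<Longrightarrow> dim_le n \<X> M"
  by (erule has_res_mono) (use H_sub in simp)

text \<open>Embed \<open>X\<close> into an object \<open>H0\<close> of \<open>\<H>\<close> with cone in \<open>\<X>\<close>.  The transformation extends to \<open>H0\<close>, where
  it comes from a morphism.\<close>

lemma restricted_map_X_H:
  assumes "X \<in> \<X>" "H \<in> \<H>" "restricted_map X H t"
  obtains r where "arr r X H" "\<And>Q u. Q \<in> projectives \<C> \<xi> \<Longrightarrow> arr u Q X \<Longrightarrow> t Q u = r \<bullet> u"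
proof -
  obtain x H0 y X1 \<delta> where e: "(X, x, H0, y, X1, \<delta>) \<in> \<xi>" "H0 \<in> \<H>" "X1 \<in> \<X>"
    using X_embeds[OF assms(1)] .
  note a = xiD[OF e(1)]
  have o: "H \<in> Obj \<C>" using assms H_obj by blast
  obtain s where s: "restricted_map H0 H s"
    "\<And>Q u. Q \<in> projectives \<C> \<xi> \<Longrightarrow> arr u Q X \<Longrightarrow> s Q (x \<bullet> u) = t Q u"
    using restricted_map_extends[OF e(1) o xt_X_H[OF _ e(3) assms(2)] assms(3)] by auto
  have "xt0_map \<C> \<xi> H0 H \<in> iso (Hom \<C> H0 H) (xt \<C> \<xi> 0 H0 H)"
    using H_injective e(2) assms(2) unfolding xt_injective_def by blast
  from xt0_iso_faithful_full(2)[OF a(5) o this s(1)] obtain r where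
    r: "arr r H0 H" "\<And>Q u. Q \<in> projectives \<C> \<xi> \<Longrightarrow> arr u Q H0 \<Longrightarrow> s Q u = r \<bullet> u" by blast
  have "t Q u = (r \<bullet> x) \<bullet> u" if "Q \<in> projectives \<C> \<xi>" "arr u Q X" for Q u
    using s(2)[OF that] r(2)[OF that(1) comp_arr[OF that(2) a(1)]] comp_assoc[OF that(2) a(1) r(1)] by simp
  then show ?thesis using that comp_arr[OF a(1) r(1)] by blast
qed

text \<open>The identity transformation of \<open>H\<close> extends to \<open>B\<close>, and comes from a morphism \<open>r : B \<rightarrow> H\<close> because \<open>B\<close>
  lies in \<open>\<X>\<close>.  A priori \<open>r \<bullet> x\<close> agrees with the identity on morphisms from projective objects only;
  faithfulness on \<open>\<H>\<close> makes it an equation in \<open>\<C>\<close>.\<close>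

lemma H_splits:
  assumes t: "(H, x, B, y, K, \<delta>) \<in> \<xi>" and "H \<in> \<H>" "B \<in> \<X>" and "trivial_group (xt \<C> \<xi> 1 K H)"
  shows "\<delta> = \<one>\<^bsub>EE \<C> K H\<^esub>"
proof -
  note a = xiD[OF t]
  have "restricted_map H H (\<lambda>Q u. u)" by (simp add: restricted_map_def)
  then obtain s where s: "restricted_map B H s"
    "\<And>Q u. Q \<in> projectives \<C> \<xi> \<Longrightarrow> arr u Q H \<Longrightarrow> s Q (x \<bullet> u) = u"
    using restricted_map_extends[OF t a(4) assms(4)] by metis
  obtain r where r: "arr r B H" "\<And>Q u. Q \<in> projectives \<C> \<xi> \<Longrightarrow> arr u Q B \<Longrightarrow> s Q u = r \<bullet> u"
    using restricted_map_X_H[OF assms(3,2) s(1)] by metis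
  have iso: "xt0_map \<C> \<xi> H H \<in> iso (Hom \<C> H H) (xt \<C> \<xi> 0 H H)"
    using H_injective assms(2) unfolding xt_injective_def by blast
  have "(r \<bullet> x) \<bullet> u = Ident \<C> H \<bullet> u" if "Q \<in> projectives \<C> \<xi>" "arr u Q H" for Q u
    using s(2)[OF that] r(2)[OF that(1) comp_arr[OF that(2) a(1)]] comp_assoc[OF that(2) a(1) r(1)]
      id_comp[OF that(2)] by simp
  then have "r \<bullet> x = Ident \<C> H"
    using xt0_iso_faithful_full(1)[OF a(4) a(4) iso comp_arr[OF a(1) r(1)] id_arr[OF a(4)]] by blast
  then show ?thesis using retraction_splits[OF xi_etriangle[OF t] r(1)] by blast
qed

text \<open>By dimension shifting and induction the first syzygy \<open>L 1\<close> lies in \<open>\<X>\<close>.  Pushing the triangle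
  \<open>L 1 \<rightarrow> P 0 \<rightarrow> K\<close> out along an embedding \<open>L 1 \<rightarrow> H\<close> produces an extension of \<open>K\<close> by \<open>H\<close> whose middle term
  lies in \<open>\<X>\<close>.  It splits, so \<open>K\<close> is the cocone of a morphism from \<open>\<X>\<close> to \<open>\<H>\<close>.\<close>

lemma orthogonal_in_X:
  assumes "dim_le m \<X> K" "\<And>i H. 1 \<le> i \<Longrightarrow> H \<in> \<H> \<Longrightarrow> trivial_group (xt \<C> \<xi> i K H)"
  shows "K \<in> \<X>"
  using assms
proof (induction m arbitrary: K)
  case 0 then show ?case by simp
next
  case (Suc m)
  obtain P d L g f where r: "\<And>i. P i \<in> \<X> \<inter> projectives \<C> \<xi>" "resolution_triangles \<C> \<xi> K P d L g f"
    using dim_resolution[OF Suc.prems(1)] by metis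
  have "trivial_group (xt \<C> \<xi> i (L 1) H)" if "1 \<le> i" "H \<in> \<H>" for i H
    using xt_syzygy[OF r(2) _ _ that(1), of H 1] Suc.prems(2)[OF _ that(2), of "1 + i"] r(1) H_obj that
    by auto
  moreover have "dim_le m \<X> (L 1)" using dim_syzygy[OF r(2) _ Suc.prems(1), of 1] r(1) by simp
  ultimately have L: "L 1 \<in> \<X>" using Suc.IH by blast
  have "L 0 = K" using r(2) by (simp add: resolution_triangles_def)
  then obtain \<delta> where t: "(L 1, g 0, P 0, f 0, K, \<delta>) \<in> \<xi>"
    using resolution_triangle[OF r(2), of 0] by (metis One_nat_def)
  obtain x H y X' \<epsilon> where e: "(L 1, x, H, y, X', \<epsilon>) \<in> \<xi>" "H \<in> \<H>" "X' \<in> \<X>"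
    using X_embeds[OF L] .
  obtain B a b a' b' \<eta> \<eta>' where B: "(P 0, a, B, b, X', \<eta>) \<in> \<xi>" "(H, a', B, b', K, \<eta>') \<in> \<xi>"
    using pushout_in[OF t e(1)] by metis
  have BX: "B \<in> \<X>" using X_extension[OF B(1) _ e(3)] r(1) by blast
  have "\<eta>' = \<one>\<^bsub>EE \<C> K H\<^esub>" using H_splits[OF B(2) e(2) BX] Suc.prems(2) e(2) by simp
  then obtain j p where "(K, j, B, p, H, \<one>\<^bsub>EE \<C> H K\<^esub>) \<in> \<xi>" using split_swap_in B(2) by metis
  then show ?case using X_cocone BX e(2) H_sub by blast
qed

lemma dim_le_iff_xt:
  assumes fin: "dim_le m \<X> M"
  shows "dim_le n \<X> M \<longleftrightarrow> (\<forall>i\<ge>1. \<forall>H\<in>\<H>. trivial_group (xt \<C> \<xi> (n + i) M H))"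
proof -
  obtain P d K g f where r: "\<And>i. P i \<in> \<X> \<inter> projectives \<C> \<xi>" "resolution_triangles \<C> \<xi> M P d K g f"
    using dim_resolution[OF fin] by metis
  have s: "trivial_group (xt \<C> \<xi> (n + i) M H) \<longleftrightarrow> trivial_group (xt \<C> \<xi> i (K n) H)"
    if "1 \<le> i" "H \<in> \<H>" for i H
    using xt_syzygy[OF r(2) _ _ that(1)] r(1) H_obj that by auto
  have "dim_le n \<X> M \<longleftrightarrow> K n \<in> \<X>"
  proof
    assume M: "dim_le n \<X> M"
    have "dim_le (n - n) \<X> (K n)" by (rule dim_syzygy[OF r(2) _ M]) (use r(1) in blast)
    then show "K n \<in> \<X>" by simp
  next
    assume "K n \<in> \<X>"
    then show "dim_le n \<X> M" using dim_le_of_syzygy[OF r(2)] r(1) by blast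
  qed
  also have "\<dots> \<longleftrightarrow> (\<forall>i\<ge>1. \<forall>H\<in>\<H>. trivial_group (xt \<C> \<xi> i (K n) H))"
  proof -
    have "dim_le (m - n) \<X> (K n)" by (rule dim_syzygy[OF r(2) _ fin]) (use r(1) in blast)
    then show ?thesis using orthogonal_in_X xt_X_H by blast
  qed
  also have "\<dots> \<longleftrightarrow> (\<forall>i\<ge>1. \<forall>H\<in>\<H>. trivial_group (xt \<C> \<xi> (n + i) M H))" using s by blast
  finally show ?thesis .
qed

lemma xt_vanishes_on_finite_dim:
  assumes "\<forall>i\<ge>1. \<forall>H\<in>\<H>. trivial_group (xt \<C> \<xi> (n + i) M H)" "M \<in> Obj \<C>"
    and "dim_le k \<H> N" "1 \<le> i"
  shows "trivial_group (xt \<C> \<xi> (n + i) M N)"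
  using assms(3,4)
proof (induction k arbitrary: N i)
  case 0 then show ?case using assms by simp
next
  case (Suc k)
  then obtain N' x H y \<delta> where t: "(N', x, H, y, N, \<delta>) \<in> \<xi>" "H \<in> \<H>" "dim_le k \<H> N'" by auto
  have "trivial_group (xt \<C> \<xi> (n + i) M H)" "trivial_group (xt \<C> \<xi> (Suc (n + i)) M N')"
    using assms(1) Suc.prems t(2) Suc.IH[OF t(3), of "Suc i"] by auto
  then show ?case using xt_second_variable[OF t(1) assms(2)] Suc.prems(2) by simp
qed

lemma approximation_from_pushout:
  assumes t: "(M', x, X, y, M, \<delta>) \<in> \<xi>" "X \<in> \<X>" and t': "(M', w, W, v, X', \<epsilon>) \<in> \<xi>" "X' \<in> \<X>"
  obtains w' B y' \<eta> where "(W, w', B, y', M, \<eta>) \<in> \<xi>" "B \<in> \<X>"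
proof -
  obtain B a b a' b' \<eta> \<eta>' where B: "(X, a, B, b, X', \<eta>) \<in> \<xi>" "(W, a', B, b', M, \<eta>') \<in> \<xi>"
    using pushout_in[OF t(1) t'(1)] by metis
  then show ?thesis using that X_extension t t' by blast
qed

text \<open>The Auslander--Buchweitz construction alternates a pushout, which turns a coapproximation of a
  syzygy of \<open>M\<close> into an approximation \<open>W \<rightarrow> B \<rightarrow> M\<close>, and an embedding \<open>B \<rightarrow> H\<close>, whose composite with \<open>W \<rightarrow> B\<close>
  has a cone receiving \<open>M\<close>.\<close>

lemma coapproximation:
  assumes "dim_le n \<X> M"
  shows "\<exists>x W y X \<delta>. (M, x, W, y, X, \<delta>) \<in> \<xi> \<and> X \<in> \<X> \<and> dim_le n \<H> W"
  using assms
proof (induction n arbitrary: M)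
  case 0 then show ?case using X_embeds by (metis has_res.simps(1))
next
  case (Suc n)
  then obtain M' x X y \<delta> where t: "(M', x, X, y, M, \<delta>) \<in> \<xi>" "X \<in> \<X>" "dim_le n \<X> M'" by auto
  obtain w W v X' \<epsilon> where t': "(M', w, W, v, X', \<epsilon>) \<in> \<xi>" "X' \<in> \<X>" "dim_le n \<H> W"
    using Suc.IH[OF t(3)] by blast
  obtain w' B y' \<eta> where B: "(W, w', B, y', M, \<eta>) \<in> \<xi>" "B \<in> \<X>"
    using approximation_from_pushout[OF t(1,2) t'(1,2)] .
  obtain b H c X'' \<theta> where e: "(B, b, H, c, X'', \<theta>) \<in> \<xi>" "H \<in> \<H>" "X'' \<in> \<X>"
    using X_embeds[OF B(2)] .
  obtain E h d k \<kappa> \<kappa>' where E: "(W, b \<bullet> w', H, h, E, \<kappa>) \<in> \<xi>" "(M, d, E, k, X'', \<kappa>') \<in> \<xi>"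
    using inflations_compose[OF B(1) e(1)] by metis
  then show ?case using dim_le_SucI[OF E(1) e(2) t'(3)] e(3) by blast
qed

lemma approximation:
  assumes "dim_le (Suc n) \<X> M"
  shows "\<exists>K x X y \<delta>. (K, x, X, y, M, \<delta>) \<in> \<xi> \<and> X \<in> \<X> \<and> dim_le n \<H> K"
proof -
  obtain M' x X y \<delta> where t: "(M', x, X, y, M, \<delta>) \<in> \<xi>" "X \<in> \<X>" "dim_le n \<X> M'" using assms by auto
  obtain w W v X' \<epsilon> where t': "(M', w, W, v, X', \<epsilon>) \<in> \<xi>" "X' \<in> \<X>" "dim_le n \<H> W"
    using coapproximation[OF t(3)] by blast
  show ?thesis using approximation_from_pushout[OF t(1,2) t'(1,2)] t'(3) by metis
qed

lemma dim_le_iff_coapproximation: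
  "dim_le n \<X> M \<longleftrightarrow> (\<exists>x W y X \<delta>. (M, x, W, y, X, \<delta>) \<in> \<xi> \<and> X \<in> \<X> \<and> dim_le n \<H> W)"
  using coapproximation dim_cocone dim_H_imp_X by blast

lemma res_dim_le_iff:
  "res_dim_le \<C> \<xi> \<H> K (int n) \<longleftrightarrow> dim_le n \<H> K"
proof -
  obtain Z where "Z \<in> \<H>" "zero_object \<C> Z" using H_zero .
  then show ?thesis using res_dim_le_enat_iff[OF H_obj] by (simp add: res_dim_le_def)
qed

lemma dim_le_iff_approximation:
  assumes M: "M \<in> Obj \<C>"
  shows "dim_le n \<X> M \<longleftrightarrow>
    (\<exists>K x X y \<delta>. (K, x, X, y, M, \<delta>) \<in> \<xi> \<and> X \<in> \<X> \<and> res_dim_le \<C> \<xi> \<H> K (int n - 1))"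
proof (cases n)
  case 0
  \<comment> \<open>The bound is negative, so that \<open>K\<close> has to be zero.\<close>
  have "res_dim_le \<C> \<xi> \<H> K (int n - 1) \<longleftrightarrow> zero_object \<C> K" for K
    using 0 by (simp add: res_dim_le_def)
  moreover obtain Z where "zero_object \<C> Z" using ex_zero_object by blast
  ultimately show ?thesis
    using 0 zero_id_in[OF _ M] X_of_zero_cocone by simp blast
next
  case (Suc m)
  have "res_dim_le \<C> \<xi> \<H> K (int n - 1) \<longleftrightarrow> dim_le m \<H> K" for K
    using Suc res_dim_le_iff[of K m] by simp
  then show ?thesis using approximation dim_le_SucI dim_H_imp_X Suc by metis
qed

text \<open>Take \<open>m\<close> steps of a projective resolution inside \<open>\<X>\<close> and continue with an approximation of the
  syzygy.\<close>

lemma dim_le_iff_mixed_resolution: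
  assumes "m \<le> n"
  shows "dim_le n \<X> M \<longleftrightarrow>
    has_res n (\<lambda>i. if i < m then \<X> \<inter> projectives \<C> \<xi> else if i = m then \<X> else \<H>) M"
    (is "_ \<longleftrightarrow> has_res n (?S m) M")
proof
  assume "has_res n (?S m) M"
  then show "dim_le n \<X> M" by (rule has_res_mono) (use H_sub in auto)
next
  assume "dim_le n \<X> M"
  with assms show "has_res n (?S m) M"
  proof (induction m arbitrary: n M)
    case 0
    show ?case
    proof (cases n)
      case 0 then show ?thesis using \<open>dim_le n \<X> M\<close> by simp
    next
      case (Suc k)
      obtain K x X y \<delta> where "(K, x, X, y, M, \<delta>) \<in> \<xi>" "X \<in> \<X>" "dim_le k \<H> K"
        using approximation 0(2) Suc by blast
      then show ?thesis using Suc has_res_SucI[of K x X y M \<delta> "?S 0" k] by simp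
    qed
  next
    case (Suc m)
    then obtain k where n: "n = Suc k" by (cases n) auto
    obtain K x P y \<delta> where c: "(K, x, P, y, M, \<delta>) \<in> \<xi>" "P \<in> \<X> \<inter> projectives \<C> \<xi>" "dim_le k \<X> K"
      using dim_cover[OF Suc.prems(2)] n by (metis diff_Suc_1)
    have "has_res k (?S m) K" using Suc.IH[OF _ c(3)] Suc.prems(1) n by simp
    moreover have "?S m = (\<lambda>i. ?S (Suc m) (Suc i))" by (auto simp: fun_eq_iff)
    ultimately have "has_res k (\<lambda>i. ?S (Suc m) (Suc i)) K" by (simp only:)
    moreover have "P \<in> ?S (Suc m) 0" using c(2) by simp
    ultimately show ?case unfolding n using has_res_SucI[OF c(1), of "?S (Suc m)" k] by blast
  qed
qed

text \<open>The first triangle of an \<open>\<H>\<close>-resolution splits by \<open>H_splits\<close>, as soon as its kernel is known to be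
  in \<open>\<H>\<close>.  Either closure property then transfers membership in \<open>\<H>\<close> from the middle term to \<open>W\<close>: as a
  direct summand, or as the cocone of the reversed split triangle.\<close>

lemma X_inter_finite_H_dim:
  assumes alt: "(closed_extensions \<xi> \<H> \<and> closed_cocones \<xi> \<H>) \<or> closed_summands \<C> \<H>"
    and "W \<in> \<X>" "dim_le k \<H> W"
  shows "W \<in> \<H>"
  using assms(2,3)
proof (induction k arbitrary: W)
  case 0 then show ?case by simp
next
  case (Suc k)
  then obtain W' x H y \<delta> where t: "(W', x, H, y, W, \<delta>) \<in> \<xi>" "H \<in> \<H>" "dim_le k \<H> W'" by auto
  have HX: "H \<in> \<X>" using t H_sub by blast
  have W': "W' \<in> \<H>" using Suc.IH[OF X_cocone[OF t(1) HX Suc.prems(1)] t(3)] .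
  have \<delta>: "\<delta> = \<one>\<^bsub>EE \<C> W W'\<^esub>"
    using H_splits[OF t(1) W' HX xt_X_H[OF _ Suc.prems(1) W']] by simp
  from alt show ?case
  proof
    assume "closed_extensions \<xi> \<H> \<and> closed_cocones \<xi> \<H>"
    moreover obtain j p where "(W, j, H, p, W', \<one>\<^bsub>EE \<C> W' W\<^esub>) \<in> \<xi>"
      using split_swap_in t(1) \<delta> by metis
    ultimately show ?thesis using t(2) W' unfolding closed_cocones_def by blast
  next
    assume s: "closed_summands \<C> \<H>"
    obtain j p where "biproduct \<C> W' W H x j p y"
      using split_biproduct xi_etriangle[OF t(1)] \<delta> by metis
    then show ?thesis using s t(2) unfolding closed_summands_def by blast
  qed
qed

lemma dim_X_imp_H:
  assumes alt: "(closed_extensions \<xi> \<H> \<and> closed_cocones \<xi> \<H>) \<or> closed_summands \<C> \<H>"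
    and "dim_le k \<H> W" "dim_le n \<X> W"
  shows "dim_le n \<H> W"
  using assms(2,3)
proof (induction n arbitrary: k W)
  case 0 then show ?case using X_inter_finite_H_dim[OF alt] by simp
next
  case (Suc n)
  obtain Z where Z: "Z \<in> \<H>" "zero_object \<C> Z" using H_zero .
  show ?case
  proof (cases k)
    case 0 then show ?thesis using Suc.prems(1) dim_le_mono[OF _ _ H_obj Z, of 0 W "Suc n"] by simp
  next
    case (Suc l)
    then obtain W' x H y \<delta> where t: "(W', x, H, y, W, \<delta>) \<in> \<xi>" "H \<in> \<H>" "dim_le l \<H> W'"
      using Suc.prems(1) by auto
    have "dim_le n \<X> W'" using dim_syzygy_step[OF t(1) _ Suc.prems(2)] t(2) H_sub by auto
    then show ?thesis using dim_le_SucI[OF t(1,2)] Suc.IH[OF t(3)] by blast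
  qed
qed

lemma res_dim_H_eq_X:
  assumes alt: "(closed_extensions \<xi> \<H> \<and> closed_cocones \<xi> \<H>) \<or> closed_summands \<C> \<H>"
    and W: "dim_le k \<H> W"
  shows "res_dim \<C> \<xi> \<H> W = res_dim \<C> \<xi> \<X> W"
proof -
  obtain Z where Z: "Z \<in> \<H>" "zero_object \<C> Z" using H_zero .
  obtain Z' where Z': "Z' \<in> \<X>" "zero_object \<C> Z'" using X_zero .
  have "res_dim \<C> \<xi> \<H> W \<le> enat n \<longleftrightarrow> res_dim \<C> \<xi> \<X> W \<le> enat n" for n
    using res_dim_le_enat_iff[OF H_obj Z] res_dim_le_enat_iff[OF X_obj Z'] dim_H_imp_X dim_X_imp_H[OF alt W]
    by blast
  then show ?thesis by (metis enat.exhaust enat_ord_code(3) linear order_antisym)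
qed

end

theorem theorem4p10:
  fixes \<C> :: "('o, 'm, 'e) extricat"
    and \<xi> :: "('o, 'm, 'e) triangle set"
    and \<X> \<H> :: "'o set"
    and M :: 'o
    and n :: nat
  assumes "extriangulated_category \<C>"
    and "WIC \<C>"
    and "proper_class \<C> \<xi>"
    and "enough_projectives \<C> \<xi>"
    and "enough_injectives \<C> \<xi>"
    and "quasi_resolving \<C> \<xi> \<X>"
    and "additive_subcategory \<C> \<H>"
    and "cogenerator \<xi> \<X> \<H>"
    and "xt_injective \<C> \<xi> \<X> \<H>"
    and "(closed_extensions \<xi> \<H> \<and> closed_cocones \<xi> \<H>) \<or> closed_summands \<C> \<H>"
    and "M \<in> Obj \<C>"
    and "res_dim \<C> \<xi> \<X> M < \<infinity>"
  shows
    "(res_dim \<C> \<xi> \<X> M \<le> enat n \<longleftrightarrow>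
       (\<forall>i N. is_syzygy \<C> \<xi> (\<X> \<inter> projectives \<C> \<xi>) (n + i) M N \<longrightarrow> N \<in> \<X>)) \<and>
     (res_dim \<C> \<xi> \<X> M \<le> enat n \<longleftrightarrow>
       (\<forall>i N. is_syzygy \<C> \<xi> \<X> (n + i) M N \<longrightarrow> N \<in> \<X>)) \<and>
     (res_dim \<C> \<xi> \<X> M \<le> enat n \<longleftrightarrow>
       (\<forall>i\<ge>1. \<forall>H \<in> \<H>. trivial_group (xt \<C> \<xi> (n + i) M H))) \<and>
     (res_dim \<C> \<xi> \<X> M \<le> enat n \<longleftrightarrow>
       (\<forall>i\<ge>1. \<forall>N \<in> finite_res_dim \<C> \<xi> \<H>. trivial_group (xt \<C> \<xi> (n + i) M N))) \<and>
     (res_dim \<C> \<xi> \<X> M \<le> enat n \<longleftrightarrow>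
       (\<exists>x W y X \<delta>. (M, x, W, y, X, \<delta>) \<in> \<xi> \<and> X \<in> \<X> \<and> res_dim_le \<C> \<xi> \<H> W (int n))) \<and>
     (res_dim \<C> \<xi> \<X> M \<le> enat n \<longleftrightarrow>
       (\<exists>K x X' y \<delta>. (K, x, X', y, M, \<delta>) \<in> \<xi> \<and> X' \<in> \<X> \<and>
          res_dim_le \<C> \<xi> \<H> K (int n - 1))) \<and>
     (res_dim \<C> \<xi> \<X> M \<le> enat n \<longleftrightarrow>
       (\<exists>W1 x1 X1 y1 \<delta>1 x2 W2 y2 X2 \<delta>2.
          (W1, x1, X1, y1, M, \<delta>1) \<in> \<xi> \<and> (M, x2, W2, y2, X2, \<delta>2) \<in> \<xi> \<and>
          X1 \<in> \<X> \<and> X2 \<in> \<X> \<and> res_dim_le \<C> \<xi> \<H> W1 (int n - 1) \<and>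
          res_dim \<C> \<xi> \<H> W2 = res_dim \<C> \<xi> \<X> W2 \<and> res_dim \<C> \<xi> \<X> W2 \<le> enat n)) \<and>
     (res_dim \<C> \<xi> \<X> M \<le> enat n \<longleftrightarrow>
       (\<exists>Y d. exact_bounded \<C> \<xi> n Y d M \<and> Y 0 \<in> \<X> \<and> (\<forall>i. 1 \<le> i \<and> i \<le> n \<longrightarrow> Y i \<in> \<H>))) \<and>
     (res_dim \<C> \<xi> \<X> M \<le> enat n \<longleftrightarrow>
       (\<forall>m\<le>n. \<exists>Y d. exact_bounded \<C> \<xi> n Y d M \<and> Y m \<in> \<X> \<and>
          (\<forall>i. m + 1 \<le> i \<and> i \<le> n \<longrightarrow> Y i \<in> \<H>) \<and>
          (\<forall>j<m. Y j \<in> \<X> \<inter> projectives \<C> \<xi>)))"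
proof -
  interpret resolving_cogenerator \<C> \<xi> \<X> \<H>
    by (intro resolving_cogenerator.intro quasi_resolving_subcategory.intro enough_proper_class.intro
        resolving_cogenerator_axioms.intro quasi_resolving_subcategory_axioms.intro
        enough_proper_class_axioms.intro) fact+
  obtain Z where Z: "Z \<in> \<X>" "zero_object \<C> Z" using X_zero .
  obtain Z' where Z': "Z' \<in> \<H>" "zero_object \<C> Z'" using H_zero .
  have dim: "res_dim \<C> \<xi> \<X> M \<le> enat k \<longleftrightarrow> dim_le k \<X> M" for k M
    using res_dim_le_enat_iff[OF X_obj Z] .
  obtain m where fin: "dim_le m \<X> M" using res_dim_finite_iff[OF X_obj Z] assms(12) by blast
  have 2: "dim_le n \<X> M \<longleftrightarrow>
      (\<forall>i N. is_syzygy \<C> \<xi> (\<X> \<inter> projectives \<C> \<xi>) (n + i) M N \<longrightarrow> N \<in> \<X>)"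
    using dim_le_iff_syzygies[OF _ _ fin] by simp
  have 3: "dim_le n \<X> M \<longleftrightarrow> (\<forall>i N. is_syzygy \<C> \<xi> \<X> (n + i) M N \<longrightarrow> N \<in> \<X>)"
    using dim_le_iff_syzygies[OF _ _ fin] by simp
  note 4 = dim_le_iff_xt[OF fin, of n]
  have fH: "N \<in> finite_res_dim \<C> \<xi> \<H> \<longleftrightarrow> N \<in> Obj \<C> \<and> (\<exists>k. dim_le k \<H> N)" for N
    using res_dim_finite_iff[OF H_obj Z'] by (simp add: finite_res_dim_def)
  have Hf: "N \<in> finite_res_dim \<C> \<xi> \<H>" if "N \<in> \<H>" for N
    unfolding fH using that H_obj by (auto intro: exI[of _ 0])
  have 5: "dim_le n \<X> M \<longleftrightarrow>
      (\<forall>i\<ge>1. \<forall>N \<in> finite_res_dim \<C> \<xi> \<H>. trivial_group (xt \<C> \<xi> (n + i) M N))"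
    using 4 xt_vanishes_on_finite_dim[OF _ assms(11)] fH Hf by blast
  have 6: "dim_le n \<X> M \<longleftrightarrow>
      (\<exists>x W y X \<delta>. (M, x, W, y, X, \<delta>) \<in> \<xi> \<and> X \<in> \<X> \<and> res_dim_le \<C> \<xi> \<H> W (int n))"
    unfolding res_dim_le_iff by (rule dim_le_iff_coapproximation)
  note 7 = dim_le_iff_approximation[OF assms(11), of n]
  have 8: "dim_le n \<X> M \<longleftrightarrow>
       (\<exists>W1 x1 X1 y1 \<delta>1 x2 W2 y2 X2 \<delta>2.
          (W1, x1, X1, y1, M, \<delta>1) \<in> \<xi> \<and> (M, x2, W2, y2, X2, \<delta>2) \<in> \<xi> \<and>
          X1 \<in> \<X> \<and> X2 \<in> \<X> \<and> res_dim_le \<C> \<xi> \<H> W1 (int n - 1) \<and>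
          res_dim \<C> \<xi> \<H> W2 = res_dim \<C> \<xi> \<X> W2 \<and> res_dim \<C> \<xi> \<X> W2 \<le> enat n)" (is "_ \<longleftrightarrow> ?r8")
  proof
    assume M: "dim_le n \<X> M"
    obtain W1 x1 X1 y1 \<delta>1 where a: "(W1, x1, X1, y1, M, \<delta>1) \<in> \<xi>" "X1 \<in> \<X>" "res_dim_le \<C> \<xi> \<H> W1 (int n - 1)"
      using 7 M by blast
    obtain x2 W2 y2 X2 \<delta>2 where b: "(M, x2, W2, y2, X2, \<delta>2) \<in> \<xi>" "X2 \<in> \<X>" "dim_le n \<H> W2"
      using coapproximation[OF M] by blast
    have "res_dim \<C> \<xi> \<H> W2 = res_dim \<C> \<xi> \<X> W2" "res_dim \<C> \<xi> \<X> W2 \<le> enat n"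
      using res_dim_H_eq_X[OF assms(10) b(3)] dim dim_H_imp_X[OF b(3)] by simp_all
    then show ?r8 using a b by blast
  next
    assume ?r8
    then show "dim_le n \<X> M" unfolding 7 by blast
  qed
  have 10: "dim_le n \<X> M \<longleftrightarrow> (\<exists>Y d. exact_bounded \<C> \<xi> n Y d M \<and> Y m \<in> \<X> \<and>
          (\<forall>i. m + 1 \<le> i \<and> i \<le> n \<longrightarrow> Y i \<in> \<H>) \<and> (\<forall>j<m. Y j \<in> \<X> \<inter> projectives \<C> \<xi>))" if "m \<le> n" for m
  proof -
    have "(\<forall>i\<le>n. Y i \<in> (if i < m then \<X> \<inter> projectives \<C> \<xi> else if i = m then \<X> else \<H>)) \<longleftrightarrow>
        Y m \<in> \<X> \<and> (\<forall>i. m + 1 \<le> i \<and> i \<le> n \<longrightarrow> Y i \<in> \<H>) \<and> (\<forall>j<m. Y j \<in> \<X> \<inter> projectives \<C> \<xi>)" 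
      (is "?l Y \<longleftrightarrow> ?r Y") for Y :: "nat \<Rightarrow> 'o"
    proof
      assume l: "?l Y"
      have "Y m \<in> \<X>" using l[rule_format, OF that] by simp
      moreover have "Y i \<in> \<H>" if "m + 1 \<le> i" "i \<le> n" for i using l[rule_format, OF that(2)] that(1) by simp
      moreover have "Y j \<in> \<X> \<inter> projectives \<C> \<xi>" if "j < m" for j
        using l[rule_format, of j] that \<open>m \<le> n\<close> by simp
      ultimately show "?r Y" by blast
    qed (auto simp: not_less_eq_eq)
    then show ?thesis
      unfolding dim_le_iff_mixed_resolution[OF that] unfolding has_res_iff_exact_bounded by simp
  qed
  have 9: "dim_le n \<X> M \<longleftrightarrow>
      (\<exists>Y d. exact_bounded \<C> \<xi> n Y d M \<and> Y 0 \<in> \<X> \<and> (\<forall>i. 1 \<le> i \<and> i \<le> n \<longrightarrow> Y i \<in> \<H>))"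
    using 10[of 0] by simp
  have 10: "dim_le n \<X> M \<longleftrightarrow> (\<forall>m\<le>n. \<exists>Y d. exact_bounded \<C> \<xi> n Y d M \<and> Y m \<in> \<X> \<and>
          (\<forall>i. m + 1 \<le> i \<and> i \<le> n \<longrightarrow> Y i \<in> \<H>) \<and> (\<forall>j<m. Y j \<in> \<X> \<inter> projectives \<C> \<xi>))"
    using 10 by blast
  show ?thesis using 2 3 4 5 6 7 8 9 10 unfolding dim by (intro conjI)
qed

end
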